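(* Let $p$ be an odd prime, let $\chi_N$ be an odd Dirichlet character modulo $N$ induced from a primitive odd character $\chi_f$ of conductor $f>1$, write $N=fg$, and assume $p\nmid N$. Then $$\mathcal I_{\chi_N,N,p}=\mathcal Z_{1/2}\star\nu^\times_{\chi_f,g}\qquad\text{in }\Sigma^{-1}\Lambda_K(G),$$ and for $j\in\mathbb Z/(p-1)\mathbb Z$ $$\mathcal M_{\mathcal I_{\chi_N,N,p},j}(s)=G(\chi_f)\,Z_{1/2,j}(s)\,C^{\mathrm{Iw}}_{\chi_f,g,j}(s)\,L^{(p)}_{\chi_f^{-1},j}(s),$$ where $$C^{\mathrm{Iw}}_{\chi_f,g,j}(s)=\sum_{\substack{u\mid g\\(g/u,f)=1}}\mu_{\mathrm{Mob}}(g/u)\,\chi_f(g/u)\,\omega(u)^j\langle u\rangle^s.$$ At an integer $n\ge0$ with $n\equiv j\pmod{p-1}$, the finite factor $C^{\mathrm{Iw}}_{\chi_f,g,j}(n)$ equals $$C^{\mathrm{Iw}}_{\chi_f,g}(n)=\sum_{\substack{u\mid g\\(g/u,f)=1}}\mu_{\mathrm{Mob}}(g/u)\,\chi_f(g/u)\,u^n.$$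
   Context: $\mu_{\mathrm{Mob}}$ is the Möbius function. $K/\mathbb Q_p$ is a finite extension, with valuation ring $\mathcal O$, containing the character values and compatible primitive roots of unity $\zeta_N$ and $\zeta_f=\zeta_N^g$. $G=\mathbb Z_p^\times$; $\Lambda_K(G)=\mathcal O[[G]][1/p]$ is the algebra of bounded $K$-valued measures on $G$ under multiplicative convolution $\star$ (push-forward of the product under $(x,y)\mapsto xy$). $r_c=\delta_1-c\,\delta_c$ for odd integers $c>1$ prime to $p$; $\Sigma$ is the multiplicative set generated by the $r_c$. $G(\chi_f)=\sum_{a\in(\mathbb Z/f)^\times}\chi_f(a)\zeta_f^a$. $\lambda_{1/2,c}$ is the bounded measure on $\mathbb Z_p$ with $\int_{\mathbb Z_p}(1+T)^xd\lambda_{1/2,c}(x)=\frac{(1+T)^{1/2}}T-c\frac{(1+T)^{c/2}}{(1+T)^c-1}$; $\lambda_{1/2,c}^\times$ is its restriction to $G$; $\mathcal Z_{1/2}=r_c^{-1}\star\lambda^\times_{1/2,c}$, independent of $c$. For a root of unity $z\ne1$ of order prime to $p$, $\mu_z$ is the measure on $\mathbb Z_p$ with $\mu_z(a+p^m\mathbb Z_p)=z^a/(1-z^{p^m})$, $0\le a<p^m$; $\nu_z^\times=x^{-1}\mathbf 1_G\mu_z$. For a character $\chi$ modulo $M$, $\nu^\times_{\chi,M}=\sum_{a\in(\mathbb Z/M)^\times}\chi(a)\nu^\times_{\zeta_M^a}$. $\mathcal I_{\chi_N,N,p}=r_c^{-1}\star(\lambda^\times_{1/2,c}\star\nu^\times_{\chi_N,N})$,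 independent of $c$. For $u\in\mathbb Z_p^\times$, $u_*$ is push-forward under $x\mapsto ux$, and $$\nu^\times_{\chi_f,g}=\sum_{\substack{u\mid g\\(g/u,f)=1}}\mu_{\mathrm{Mob}}(g/u)\chi_f(g/u)\,u_*\nu^\times_{\chi_f,f}$$ (here the subscript $\chi_f,g$ refers to this combination, not to a packet modulo $g$). Write $x=\omega(x)\langle x\rangle$ with $\omega(x)\in\mu_{p-1}$, $\langle x\rangle\in1+p\mathbb Z_p$. $\mathcal M_{\rho,j}(s)=\int_G\omega(x)^j\langle x\rangle^sd\rho(x)$ for $\rho\in\Lambda_K(G)$, $\mathcal M_{A/r,j}=\mathcal M_{A,j}/\mathcal M_{r,j}$ on the localization; $Z_{1/2,j}=\mathcal M_{\mathcal Z_{1/2},j}$ and $L^{(p)}_{\chi_f^{-1},j}(s)=G(\chi_f)^{-1}\mathcal M_{\nu^\times_{\chi_f,f},j}(s)$. *)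

theory Defs
  imports
    "HOL-Analysis.Analysis"
    "HOL-Algebra.Ring"
    "HOL-Computational_Algebra.Computational_Algebra"
    "HOL-Number_Theory.Number_Theory"
begin

section \<open>Finite extensions of the p-adic numbers\<close>

text \<open>
  A finite extension \<open>K\<close> of \<open>\<rat>\<^sub>p\<close> is a complete field with a nonarchimedean absolute value
  \<open>\<bar>x\<bar> = dist x 0\<close>, normalised by \<open>\<bar>p\<bar> = 1/p\<close>, that is finite-dimensional over the closure of
  \<open>\<rat>\<close>. On \<open>\<rat>\<close> the absolute value is then the p-adic one, so the closure of \<open>\<rat>\<close> in \<open>K\<close>
  is \<open>\<rat>\<^sub>p\<close> and the closure of \<open>\<int>\<close> is \<open>\<int>\<^sub>p\<close>.
\<close>

definition padic_field :: "nat \<Rightarrow> 'k::{field_char_0,complete_space} itself \<Rightarrow> bool" where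
  "padic_field p K \<longleftrightarrow> prime p
     \<and> (\<forall>x y z::'k. dist (x + z) (y + z) = dist x y)
     \<and> (\<forall>x y::'k. dist (x * y) 0 = dist x 0 * dist y 0)
     \<and> (\<forall>x y::'k. dist (x + y) 0 \<le> max (dist x 0) (dist y 0))
     \<and> dist (of_nat p :: 'k) 0 = 1 / real p
     \<and> (\<exists>B::'k set. finite B \<and>
          (\<forall>x. \<exists>q. (\<forall>b\<in>B. q b \<in> closure \<rat>) \<and> x = (\<Sum>b\<in>B. q b * b)))"

definition Zp :: "'k::{field_char_0,complete_space} set" where
  "Zp = closure \<int>"

definition Gp :: "'k::{field_char_0,complete_space} set" where
  "Gp = {x \<in> Zp. x \<noteq> 0 \<and> inverse x \<in> Zp}"

definition residue_disc :: "nat \<Rightarrow> nat \<Rightarrow> 'k::{field_char_0,complete_space} \<Rightarrow> 'k set" where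
  "residue_disc p m a = {a + of_nat p ^ m * x |x. x \<in> Zp}"

definition reps :: "nat \<Rightarrow> nat \<Rightarrow> 'k::{field_char_0,complete_space} set \<Rightarrow> nat set" where
  "reps p m X = {a. a < p ^ m \<and> of_nat a \<in> X}"


section \<open>Bounded measures\<close>

text \<open>
  A bounded \<open>K\<close>-valued measure on a compact totally disconnected space \<open>X\<close> is a bounded finitely
  additive function on the open and closed subsets of \<open>X\<close>. It is given the value 0 on all other
  sets, so that equality of measures is equality of functions.
\<close>

definition clopen :: "'a::topological_space set \<Rightarrow> 'a set \<Rightarrow> bool" where
  "clopen X U \<longleftrightarrow> openin (top_of_set X) U \<and> closedin (top_of_set X) U"

definition bounded_measures ::
    "'a::topological_space set \<Rightarrow> ('a set \<Rightarrow> 'k::{field_char_0,complete_space}) set" where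
  "bounded_measures X = {\<mu>.
     (\<forall>U. \<not> clopen X U \<longrightarrow> \<mu> U = 0) \<and>
     (\<forall>U V. clopen X U \<longrightarrow> clopen X V \<longrightarrow> U \<inter> V = {} \<longrightarrow> \<mu> (U \<union> V) = \<mu> U + \<mu> V) \<and>
     (\<exists>B. \<forall>U. dist (\<mu> U) 0 \<le> B)}"

text \<open>The integral is the limit of the Riemann sums over the partitions of \<open>X \<subseteq> \<int>\<^sub>p\<close> (with
  \<open>X = \<int>\<^sub>p\<close> or \<open>X = \<int>\<^sub>p\<^sup>\<times>\<close>) into residue classes modulo \<open>p ^ m\<close>.\<close>

definition padic_integral ::
    "nat \<Rightarrow> 'k set \<Rightarrow> ('k \<Rightarrow> 'k) \<Rightarrow> ('k set \<Rightarrow> 'k) \<Rightarrow> 'k::{field_char_0,complete_space}" where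
  "padic_integral p X h \<mu> =
     lim (\<lambda>m. \<Sum>a\<in>reps p m X. h (of_nat a) * \<mu> (X \<inter> residue_disc p m (of_nat a)))"

definition dirac ::
    "'k::{field_char_0,complete_space} set \<Rightarrow> 'k \<Rightarrow> 'k set \<Rightarrow> 'k" where
  "dirac X x U = (if clopen X U \<and> x \<in> U then 1 else 0)"

definition restrict_measure ::
    "'k::{field_char_0,complete_space} set \<Rightarrow> ('k set \<Rightarrow> 'k) \<Rightarrow> 'k set \<Rightarrow> 'k" where
  "restrict_measure X \<mu> U = (if clopen X U then \<mu> U else 0)"

definition density_measure ::
    "nat \<Rightarrow> 'k set \<Rightarrow> ('k \<Rightarrow> 'k) \<Rightarrow> ('k set \<Rightarrow> 'k) \<Rightarrow> 'k set \<Rightarrow> 'k::{field_char_0,complete_space}" where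
  "density_measure p X h \<mu> U =
     (if clopen X U then padic_integral p X (\<lambda>x. if x \<in> U then h x else 0) \<mu> else 0)"

definition pushforward ::
    "'a set \<Rightarrow> 'b::topological_space set \<Rightarrow> ('a \<Rightarrow> 'b) \<Rightarrow> ('a set \<Rightarrow> 'k) \<Rightarrow> 'b set
       \<Rightarrow> 'k::{field_char_0,complete_space}" where
  "pushforward X Y h \<mu> U = (if clopen Y U then \<mu> {x \<in> X. h x \<in> U} else 0)"

text \<open>An open and closed set \<open>W\<close> is a disjoint union of products of residue classes modulo
  \<open>p ^ m\<close> for all large \<open>m\<close>, so the limit below is that of an eventually constant sequence.\<close>

definition prod_measure ::
    "nat \<Rightarrow> 'k set \<Rightarrow> 'k set \<Rightarrow> ('k set \<Rightarrow> 'k) \<Rightarrow> ('k set \<Rightarrow> 'k) \<Rightarrow> ('k \<times> 'k) set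
       \<Rightarrow> 'k::{field_char_0,complete_space}" where
  "prod_measure p X Y \<rho> \<sigma> W =
     (if clopen (X \<times> Y) W
      then lim (\<lambda>m. \<Sum>a\<in>reps p m X. \<Sum>b\<in>reps p m Y.
             if (of_nat a, of_nat b) \<in> W
             then \<rho> (X \<inter> residue_disc p m (of_nat a)) * \<sigma> (Y \<inter> residue_disc p m (of_nat b)) else 0)
      else 0)"

definition conv ::
    "nat \<Rightarrow> ('k set \<Rightarrow> 'k) \<Rightarrow> ('k set \<Rightarrow> 'k) \<Rightarrow> 'k set \<Rightarrow> 'k::{field_char_0,complete_space}" where
  "conv p \<rho> \<sigma> = pushforward (Gp \<times> Gp) Gp (\<lambda>(x, y). x * y) (prod_measure p Gp Gp \<rho> \<sigma>)"

definition Lambda :: "nat \<Rightarrow> ('k::{field_char_0,complete_space} set \<Rightarrow> 'k) ring" where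
  "Lambda p = \<lparr>carrier = bounded_measures Gp, monoid.mult = conv p, one = dirac Gp 1,
                zero = (\<lambda>U. 0), add = (\<lambda>\<rho> \<sigma> U. \<rho> U + \<sigma> U)\<rparr>"


section \<open>Localization\<close>

text \<open>The fraction \<open>a/s\<close> is the set of all pairs equivalent to \<open>(a, s)\<close>.\<close>

definition ring_frac :: "('a, 'm) ring_scheme \<Rightarrow> 'a set \<Rightarrow> 'a \<Rightarrow> 'a \<Rightarrow> ('a \<times> 'a) set" where
  "ring_frac R S a s = {(b, t). b \<in> carrier R \<and> t \<in> S \<and>
     (\<exists>w\<in>S. w \<otimes>\<^bsub>R\<^esub> (b \<otimes>\<^bsub>R\<^esub> s) = w \<otimes>\<^bsub>R\<^esub> (a \<otimes>\<^bsub>R\<^esub> t))}"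

definition localization :: "('a, 'm) ring_scheme \<Rightarrow> 'a set \<Rightarrow> ('a \<times> 'a) set ring" where
  "localization R S =
     \<lparr>carrier = {ring_frac R S a s |a s. a \<in> carrier R \<and> s \<in> S},
      monoid.mult = (\<lambda>A B. \<Union>(a, s)\<in>A. \<Union>(b, t)\<in>B. ring_frac R S (a \<otimes>\<^bsub>R\<^esub> b) (s \<otimes>\<^bsub>R\<^esub> t)),
      one = ring_frac R S \<one>\<^bsub>R\<^esub> \<one>\<^bsub>R\<^esub>,
      zero = ring_frac R S \<zero>\<^bsub>R\<^esub> \<one>\<^bsub>R\<^esub>,
      add = (\<lambda>A B. \<Union>(a, s)\<in>A. \<Union>(b, t)\<in>B.
               ring_frac R S ((a \<otimes>\<^bsub>R\<^esub> t) \<oplus>\<^bsub>R\<^esub> (b \<otimes>\<^bsub>R\<^esub> s)) (s \<otimes>\<^bsub>R\<^esub> t))\<rparr>"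

definition r_meas :: "nat \<Rightarrow> 'k::{field_char_0,complete_space} set \<Rightarrow> 'k" where
  "r_meas c U = dirac Gp 1 U - of_nat c * dirac Gp (of_nat c) U"

inductive_set Sigma_r :: "nat \<Rightarrow> ('k::{field_char_0,complete_space} set \<Rightarrow> 'k) set"
  for p :: nat where
  one: "dirac Gp 1 \<in> Sigma_r p"
| mult: "\<rho> \<in> Sigma_r p \<Longrightarrow> odd c \<Longrightarrow> 1 < c \<Longrightarrow> coprime c p \<Longrightarrow> conv p (r_meas c) \<rho> \<in> Sigma_r p"

abbreviation Lambda_frac ::
    "nat \<Rightarrow> ('k::{field_char_0,complete_space} set \<Rightarrow> 'k) \<Rightarrow> ('k set \<Rightarrow> 'k)
       \<Rightarrow> (('k set \<Rightarrow> 'k) \<times> ('k set \<Rightarrow> 'k)) set" where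
  "Lambda_frac p \<equiv> ring_frac (Lambda p) (Sigma_r p)"

abbreviation Lambda_loc ::
    "nat \<Rightarrow> (('k::{field_char_0,complete_space} set \<Rightarrow> 'k) \<times> ('k set \<Rightarrow> 'k)) set ring" where
  "Lambda_loc p \<equiv> localization (Lambda p) (Sigma_r p)"


section \<open>The half-shifted zeta measure\<close>

text \<open>\<open>amice p \<mu>\<close> is the power series \<open>\<integral> (1 + T) ^ x d\<mu>(x)\<close> over \<open>\<int>\<^sub>p\<close>.\<close>

definition amice ::
    "nat \<Rightarrow> ('k set \<Rightarrow> 'k) \<Rightarrow> 'k::{field_char_0,complete_space} fps" where
  "amice p \<mu> = Abs_fps (\<lambda>n. padic_integral p Zp (\<lambda>x. x gchoose n) \<mu>)"

text \<open>The two summands of the transform have a pole at \<open>T = 0\<close>, hence the Laurent series.\<close>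

definition lambda_half :: "nat \<Rightarrow> nat \<Rightarrow> 'k::{field_char_0,complete_space} set \<Rightarrow> 'k" where
  "lambda_half p c = (THE \<mu>. \<mu> \<in> bounded_measures Zp \<and>
     fps_to_fls (amice p \<mu>) =
       fps_to_fls (fps_binomial (1 / 2)) / fls_X
       - of_nat c * (fps_to_fls (fps_binomial (of_nat c / 2)) / fps_to_fls ((1 + fps_X) ^ c - 1)))"

definition lambda_half_G :: "nat \<Rightarrow> nat \<Rightarrow> 'k::{field_char_0,complete_space} set \<Rightarrow> 'k" where
  "lambda_half_G p c = restrict_measure Gp (lambda_half p c)"

definition Z_half ::
    "nat \<Rightarrow> nat \<Rightarrow> (('k::{field_char_0,complete_space} set \<Rightarrow> 'k) \<times> ('k set \<Rightarrow> 'k)) set" where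
  "Z_half p c = Lambda_frac p (lambda_half_G p c) (r_meas c)"


section \<open>Dirichlet characters and character packets\<close>

definition dirichlet_char :: "nat \<Rightarrow> (int \<Rightarrow> 'k::field) \<Rightarrow> bool" where
  "dirichlet_char M chi \<longleftrightarrow> M > 0 \<and> (\<forall>a. chi (a + int M) = chi a) \<and> (\<forall>a b. chi (a * b) = chi a * chi b)
     \<and> chi 1 = 1 \<and> (\<forall>a. chi a = 0 \<longleftrightarrow> \<not> coprime a (int M))"

definition primitive_char :: "nat \<Rightarrow> (int \<Rightarrow> 'k::field) \<Rightarrow> bool" where
  "primitive_char M chi \<longleftrightarrow> dirichlet_char M chi \<and>
     (\<forall>d. d dvd M \<and> d < M \<longrightarrow> (\<exists>a. coprime a (int M) \<and> [a = 1] (mod int d) \<and> chi a \<noteq> 1))"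

definition odd_char :: "(int \<Rightarrow> 'k::field) \<Rightarrow> bool" where
  "odd_char chi \<longleftrightarrow> chi (- 1) = - 1"

definition induced_char :: "nat \<Rightarrow> (int \<Rightarrow> 'k::field) \<Rightarrow> nat \<Rightarrow> (int \<Rightarrow> 'k) \<Rightarrow> bool" where
  "induced_char N chi' f chi \<longleftrightarrow>
     f dvd N \<and> (\<forall>a. chi' a = (if coprime a (int N) then chi a else 0))"

definition primitive_root_of_unity :: "nat \<Rightarrow> 'k::field \<Rightarrow> bool" where
  "primitive_root_of_unity N z \<longleftrightarrow> N > 0 \<and> z ^ N = 1 \<and> (\<forall>k. 0 < k \<and> k < N \<longrightarrow> z ^ k \<noteq> 1)"

definition gauss_sum :: "nat \<Rightarrow> (int \<Rightarrow> 'k::field) \<Rightarrow> 'k \<Rightarrow> 'k" where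
  "gauss_sum f chi z = (\<Sum>a\<in>totatives f. chi (int a) * z ^ a)"

definition mu_z :: "nat \<Rightarrow> 'k \<Rightarrow> 'k::{field_char_0,complete_space} set \<Rightarrow> 'k" where
  "mu_z p z = (THE \<mu>. \<mu> \<in> bounded_measures Zp \<and>
     (\<forall>m a. a < p ^ m \<longrightarrow> \<mu> (residue_disc p m (of_nat a)) = z ^ a / (1 - z ^ (p ^ m))))"

definition nu_z :: "nat \<Rightarrow> 'k \<Rightarrow> 'k::{field_char_0,complete_space} set \<Rightarrow> 'k" where
  "nu_z p z = density_measure p Gp inverse (restrict_measure Gp (mu_z p z))"

definition nu_packet ::
    "nat \<Rightarrow> nat \<Rightarrow> (int \<Rightarrow> 'k) \<Rightarrow> 'k \<Rightarrow> 'k::{field_char_0,complete_space} set \<Rightarrow> 'k" where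
  "nu_packet p M chi z U = (\<Sum>a\<in>totatives M. chi (int a) * nu_z p (z ^ a) U)"

definition moebius_mu :: "nat \<Rightarrow> int" where
  "moebius_mu n = (if squarefree n then (- 1) ^ card (prime_factors n) else 0)"

definition nu_fg ::
    "nat \<Rightarrow> nat \<Rightarrow> nat \<Rightarrow> (int \<Rightarrow> 'k) \<Rightarrow> 'k \<Rightarrow> 'k::{field_char_0,complete_space} set \<Rightarrow> 'k" where
  "nu_fg p f g chi z U =
     (\<Sum>u | u dvd g \<and> coprime (g div u) f.
        of_int (moebius_mu (g div u)) * chi (int (g div u)) *
        pushforward Gp Gp (\<lambda>x. of_nat u * x) (nu_packet p f chi z) U)"

definition I_packet ::
    "nat \<Rightarrow> nat \<Rightarrow> nat \<Rightarrow> (int \<Rightarrow> 'k) \<Rightarrow> 'k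
       \<Rightarrow> (('k::{field_char_0,complete_space} set \<Rightarrow> 'k) \<times> ('k set \<Rightarrow> 'k)) set" where
  "I_packet p c N chi z =
     Lambda_frac p (conv p (lambda_half_G p c) (nu_packet p N chi z)) (r_meas c)"


section \<open>Mellin transforms\<close>

definition teich :: "nat \<Rightarrow> 'k \<Rightarrow> 'k::{field_char_0,complete_space}" where
  "teich p x = (THE w. w \<in> Zp \<and> w ^ (p - 1) = 1 \<and> x / w \<in> residue_disc p 1 1)"

definition one_unit :: "nat \<Rightarrow> 'k \<Rightarrow> 'k::{field_char_0,complete_space}" where
  "one_unit p x = x / teich p x"

text \<open>\<open>y ^ s\<close> for \<open>y \<in> 1 + p\<int>\<^sub>p\<close> and \<open>s \<in> \<int>\<^sub>p\<close>, by the binomial series.\<close>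

definition padic_pow :: "'k \<Rightarrow> 'k \<Rightarrow> 'k::{field_char_0,complete_space}" where
  "padic_pow y s = (\<Sum>n. (s gchoose n) * (y - 1) ^ n)"

text \<open>The branch \<open>j\<close> is an integer; only its class modulo \<open>p - 1\<close> matters.\<close>

definition mellin ::
    "nat \<Rightarrow> int \<Rightarrow> ('k set \<Rightarrow> 'k) \<Rightarrow> 'k \<Rightarrow> 'k::{field_char_0,complete_space}" where
  "mellin p j \<rho> s =
     padic_integral p Gp (\<lambda>x. teich p x powi j * padic_pow (one_unit p x) s) \<rho>"

text \<open>The Mellin transform of a fraction is a quotient of functions on \<open>\<int>\<^sub>p\<close>; it has a value at
  \<open>s\<close> if the fraction can be written with a denominator whose transform does not vanish at
  \<open>s\<close>.\<close>

definition mellin_regular ::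
    "nat \<Rightarrow> int \<Rightarrow> (('k set \<Rightarrow> 'k) \<times> ('k set \<Rightarrow> 'k)) set \<Rightarrow> 'k::{field_char_0,complete_space} \<Rightarrow> bool"
    where
  "mellin_regular p j X s \<longleftrightarrow> (\<exists>(A, r)\<in>X. mellin p j r s \<noteq> 0)"

definition mellin_frac ::
    "nat \<Rightarrow> int \<Rightarrow> (('k set \<Rightarrow> 'k) \<times> ('k set \<Rightarrow> 'k)) set \<Rightarrow> 'k \<Rightarrow> 'k::{field_char_0,complete_space}"
    where
  "mellin_frac p j X s =
     (THE v. \<exists>(A, r)\<in>X. mellin p j r s \<noteq> 0 \<and> v = mellin p j A s / mellin p j r s)"

text \<open>\<open>L_padic p f chi z j\<close> is the function attached to \<open>chi\<inverse>\<close>.\<close>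

definition L_padic ::
    "nat \<Rightarrow> nat \<Rightarrow> (int \<Rightarrow> 'k) \<Rightarrow> 'k \<Rightarrow> int \<Rightarrow> 'k \<Rightarrow> 'k::{field_char_0,complete_space}" where
  "L_padic p f chi z j s = inverse (gauss_sum f chi z) * mellin p j (nu_packet p f chi z) s"

definition C_Iw ::
    "nat \<Rightarrow> nat \<Rightarrow> nat \<Rightarrow> (int \<Rightarrow> 'k) \<Rightarrow> int \<Rightarrow> 'k \<Rightarrow> 'k::{field_char_0,complete_space}" where
  "C_Iw p f g chi j s =
     (\<Sum>u | u dvd g \<and> coprime (g div u) f.
        of_int (moebius_mu (g div u)) * chi (int (g div u)) *
        (teich p (of_nat u) powi j * padic_pow (one_unit p (of_nat u)) s))"

definition C_int :: "nat \<Rightarrow> nat \<Rightarrow> (int \<Rightarrow> 'k::field) \<Rightarrow> nat \<Rightarrow> 'k" where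
  "C_int f g chi n =
     (\<Sum>u | u dvd g \<and> coprime (g div u) f.
        of_int (moebius_mu (g div u)) * chi (int (g div u)) * of_nat u ^ n)"

end

theory Submission
  imports
    Defs
begin

text \<open>
  The identity of measures is a Gauss-sum computation in disguise. The measure \<open>\<mu>\<^sub>z\<close> behaves like the
  formal sum of \<open>z\<^sup>x \<delta>\<^sub>x\<close> over \<open>x \<ge> 0\<close>, and from this picture one reads off the distribution relation
  \<open>\<Sum>\<^bsub>w\<^sup>u = y\<^esub> \<nu>\<^sub>w = u\<^sub>* \<nu>\<^sub>y\<close>: summing \<open>w\<^sup>x\<close> over all \<open>u\<close>-th roots \<open>w\<close> of \<open>y\<close> leaves \<open>u y\<^bsup>x/u\<^esup>\<close> at the
  multiples \<open>x\<close> of \<open>u\<close> and nothing elsewhere, and the density \<open>1/x\<close> absorbs the factor \<open>u\<close>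
  (\<open>distribution_level\<close>, \<open>nu_z_distribution\<close>). In the packet of \<open>\<chi>\<^sub>N\<close>, the condition that \<open>a\<close> is prime to
  \<open>g\<close> is removed by Moebius inversion over the divisors \<open>d\<close> of \<open>g\<close>; the part belonging to \<open>d\<close> is a packet
  of \<open>\<chi>\<^sub>f\<close> modulo \<open>f u\<close> with \<open>u = g/d\<close>, and grouping its summands by their class modulo \<open>f\<close> turns it, by the
  distribution relation, into \<open>u\<^sub>* \<nu>\<^bsub>\<chi>\<^sub>f,f\<^esub>\<close> (\<open>nu_packet_imprimitive\<close>). Convolution by the half-shifted zeta
  measure and division by \<open>r\<^sub>c\<close> are then formal.

  The analytic statements follow because the Mellin transform at \<open>s\<close> integrates a continuous
  character of \<open>\<int>\<^sub>p\<^sup>\<times>\<close>: it is multiplicative for convolution and turns \<open>u\<^sub>*\<close> into multiplication by the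
  value of the character at \<open>u\<close> (\<open>mellin_conv\<close>, \<open>mellin_pushforward\<close>). The delicate point is that an equality
  of fractions only gives \<open>w A = w B\<close> for some product \<open>w\<close> of measures \<open>r\<^sub>c\<close>, and the transform of \<open>w\<close> may
  vanish at \<open>s\<close>. It has few zeros, however: along the sequence \<open>s + p\<^sup>n\<close> each \<open>r\<^sub>c\<close> contributes at most
  one, since two would force \<open>c\<^sup>k = 1\<close> for some \<open>k > 0\<close>. So the transforms of
  \<open>A\<close> and \<open>B\<close> agree at \<open>s + p\<^sup>n\<close> for all large \<open>n\<close>, and by continuity at \<open>s\<close> (\<open>mellin_cancel\<close>). Finally the factor
  \<open>G(\<chi>\<^sub>f)\<close> cancels against the inverse in the definition of the \<open>L\<close>-function because the Gauss sum of a
  primitive character is not zero (\<open>gauss_sum_nonzero\<close>).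

  All measures are handled through their values on residue classes modulo \<open>p\<^sup>m\<close>: by compactness of
  \<open>\<int>\<^sub>p\<close> every open and closed set is a finite union of such classes (\<open>clopen_iff_periodic\<close>), so that a
  measure is the same as a bounded compatible family of functions on \<open>\<int>/p\<^sup>m\<close>
  (\<open>measure_from_levels\<close>) and convolution is multiplication in the group rings of \<open>(\<int>/p\<^sup>m)\<^sup>\<times>\<close>
  (\<open>conv_eq_level\<close>). The definition of the zeta measure by its power series makes sense because bounded
  measures on \<open>\<int>\<^sub>p\<close> correspond to power series with bounded coefficients (\<open>amice_inject\<close>, \<open>amice_surj\<close>).
\<close>

section \<open>The absolute value\<close>

abbreviation nrm :: "'a::{zero,metric_space} \<Rightarrow> real" where "nrm x \<equiv> dist x 0"

text \<open>The locale turns the predicate into a fixed prime and a fixed field, so that types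
  need not be repeated; the metric of the field becomes the absolute value \<open>nrm\<close>.\<close>

locale padic_ext =
  fixes p :: nat and K :: "'k::{field_char_0,complete_space} itself"
  assumes padic: "padic_field p K"
begin

text \<open>The absolute value of \<open>p ^ m\<close>, which is the radius of the residue classes modulo \<open>p ^ m\<close>.\<close>

abbreviation pp :: "nat \<Rightarrow> real" where "pp m \<equiv> (1 / real p) ^ m"

lemma prime_p: "prime p"
  using padic unfolding padic_field_def by blast

lemma p_gt_1: "p > 1"
  using prime_p prime_gt_1_nat by blast

lemma dist_nrm: "dist x y = nrm (x - y :: 'k)"
proof -
  have "dist (x + (-y)) (y + (-y)) = dist x y"
    using padic unfolding padic_field_def by blast
  then show ?thesis by simp
qed

lemma nrm_mult: "nrm (x * y :: 'k) = nrm x * nrm y"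
  using padic unfolding padic_field_def by blast

lemma nrm_add_le: "nrm (x + y :: 'k) \<le> max (nrm x) (nrm y)"
  using padic unfolding padic_field_def by blast

lemma nrm_p: "nrm (of_nat p :: 'k) = 1 / real p"
  using padic unfolding padic_field_def by blast

lemma nrm_1: "nrm (1::'k) = 1"
proof -
  have "nrm (1::'k) = nrm (1::'k) * nrm (1::'k)" using nrm_mult[of 1 1] by simp
  moreover have "nrm (1::'k) \<noteq> 0" by simp
  ultimately show ?thesis by simp
qed

lemma nrm_minus: "nrm (- x :: 'k) = nrm x"
  using dist_nrm[of 0 x] by (simp add: dist_commute)

lemma nrm_minus_commute: "nrm (x - y :: 'k) = nrm (y - x)"
  using nrm_minus[of "x - y"] by simp

lemma nrm_add_leI: "nrm (x::'k) \<le> B \<Longrightarrow> nrm y \<le> B \<Longrightarrow> nrm (x + y) \<le> B"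
  using nrm_add_le[of x y] by linarith

lemma nrm_diff_leI: "nrm (x::'k) \<le> B \<Longrightarrow> nrm y \<le> B \<Longrightarrow> nrm (x - y) \<le> B"
  using nrm_add_leI[of x B "- y"] nrm_minus[of y] by simp

lemma nrm_trans_le: "nrm (x - y :: 'k) \<le> B \<Longrightarrow> nrm (y - z) \<le> B \<Longrightarrow> nrm (x - z) \<le> B"
  using nrm_add_leI[of "x - y" B "y - z"] by simp

lemma nrm_mult_leI: "nrm (x::'k) \<le> A \<Longrightarrow> nrm y \<le> B \<Longrightarrow> nrm (x * y) \<le> A * B"
  unfolding nrm_mult by (rule mult_mono) (auto intro: order_trans[OF zero_le_dist])

lemma nrm_mult_leI1: "nrm (x::'k) \<le> 1 \<Longrightarrow> nrm y \<le> B \<Longrightarrow> nrm (x * y) \<le> B"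
  using nrm_mult_leI[of x 1 y B] by simp

lemma nrm_sum_le: "(\<And>i. i \<in> A \<Longrightarrow> nrm (h i :: 'k) \<le> B) \<Longrightarrow> 0 \<le> B \<Longrightarrow> nrm (sum h A) \<le> B"
  by (induction A rule: infinite_finite_induct) (auto intro: nrm_add_leI)

lemma nrm_power: "nrm (x ^ n :: 'k) = nrm x ^ n"
  by (induction n) (auto simp: nrm_1 nrm_mult)

lemma nrm_inverse: "nrm (inverse x :: 'k) = inverse (nrm x)"
proof (cases "x = 0")
  case False
  then have "nrm x * nrm (inverse x) = 1" using nrm_mult[of x "inverse x"] nrm_1 by simp
  then show ?thesis by (metis inverse_unique)
qed simp

lemma nrm_divide: "nrm (x / y :: 'k) = nrm x / nrm y"
  by (simp add: divide_inverse nrm_mult nrm_inverse)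

text \<open>In an isosceles ultrametric triangle the two longest sides agree.\<close>

lemma nrm_eq_of_close: "nrm (x - y :: 'k) < nrm y \<Longrightarrow> nrm x = nrm y"
  using nrm_add_le[of "x - y" y] nrm_add_le[of "y - x" x] nrm_minus_commute[of x y] by simp

lemma nrm_of_nat_le: "nrm (of_nat n :: 'k) \<le> 1"
  by (induction n) (auto intro!: nrm_add_leI simp: nrm_1)

lemma nrm_of_int_le: "nrm (of_int n :: 'k) \<le> 1"
  by (cases n rule: int_cases2) (simp_all add: nrm_minus nrm_of_nat_le)

lemma pp_pos: "pp m > 0" using p_gt_1 by simp

lemma pp_le_1: "pp m \<le> 1" using p_gt_1 by (simp add: power_le_one)

lemma inverse_p_less_1: "1 / real p < 1" using p_gt_1 by simp

lemma pp_Suc_less_1: "pp (Suc m) < 1"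
  by (rule power_Suc_less_one[OF _ inverse_p_less_1]) (use p_gt_1 in simp)

lemma pp_antimono: "m \<le> n \<Longrightarrow> pp n \<le> pp m"
  using p_gt_1 by (intro power_decreasing) auto

lemma pp_tendsto: "pp \<longlonglongrightarrow> 0"
  using p_gt_1 by (intro LIMSEQ_power_zero) auto

lemma pp_less: "e > 0 \<Longrightarrow> \<exists>m. pp m < e"
  using p_gt_1 real_arch_pow_inv[of e "1 / real p"] by auto

lemma nrm_p_power: "nrm (of_nat p ^ m :: 'k) = pp m"
  by (simp add: nrm_power nrm_p)

text \<open>Bezout: \<open>1 = a k + b p\<close> cannot have both summands of absolute value below \<open>1\<close>. This
  is where the single normalisation \<open>\<bar>p\<bar> = 1/p\<close> forces the p-adic absolute value on the integers.\<close>

lemma nrm_of_int_unit: assumes "\<not> int p dvd k" shows "nrm (of_int k :: 'k) = 1"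
proof -
  have "coprime k (int p)"
    using prime_p assms prime_imp_coprime[of "int p" k] by (simp add: coprime_commute)
  then obtain a b where ab: "a * k + b * int p = 1"
    using bezout_int[of k "int p"] by (auto simp: coprime_iff_gcd_eq_1)
  have "of_int a * of_int k + of_int b * of_nat p = (1::'k)"
    using arg_cong[OF ab, of "of_int :: int \<Rightarrow> 'k"] by simp
  then have "1 \<le> max (nrm (of_int a * of_int k :: 'k)) (nrm (of_int b * of_nat p :: 'k))"
    using nrm_add_le[of "of_int a * of_int k" "of_int b * of_nat p :: 'k"] nrm_1 by simp
  moreover have "nrm (of_int b * of_nat p :: 'k) \<le> 1 / real p"
    using nrm_mult_leI1[OF nrm_of_int_le] nrm_p by simp
  moreover note inverse_p_less_1
  moreover have "nrm (of_int a * of_int k :: 'k) \<le> nrm (of_int k :: 'k)"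
    by (intro nrm_mult_leI1 nrm_of_int_le) simp
  ultimately show ?thesis using nrm_of_int_le[of k] by linarith
qed

lemma nrm_of_int_le_iff: "nrm (of_int k :: 'k) \<le> pp m \<longleftrightarrow> int p ^ m dvd k"
proof
  assume "int p ^ m dvd k"
  then obtain l where "k = int p ^ m * l" by auto
  then have "nrm (of_int k :: 'k) = pp m * nrm (of_int l :: 'k)"
    by (simp add: nrm_mult nrm_p_power)
  then show "nrm (of_int k :: 'k) \<le> pp m"
    using nrm_of_int_le[of l] pp_pos[of m] by (simp add: mult_left_le)
next
  assume "nrm (of_int k :: 'k) \<le> pp m"
  then show "int p ^ m dvd k"
  proof (induction m arbitrary: k)
    case (Suc m)
    have "int p dvd k" using Suc.prems nrm_of_int_unit[of k] pp_Suc_less_1[of m] by linarith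
    then obtain l where l: "k = int p * l" by auto
    have "nrm (of_int l :: 'k) \<le> pp m"
      using Suc.prems p_gt_1 unfolding l by (simp add: nrm_mult nrm_p field_simps)
    then show ?case using Suc.IH[of l] l by simp
  qed simp
qed

lemma nrm_nat_diff_le_iff:
  "nrm (of_nat a - of_nat b :: 'k) \<le> pp m \<longleftrightarrow> [a = b] (mod p ^ m)"
proof -
  have "nrm (of_nat a - of_nat b :: 'k) = nrm (of_int (int a - int b) :: 'k)" by simp
  then show ?thesis using nrm_of_int_le_iff[of "int a - int b" m]
    by (metis cong_iff_dvd_diff cong_int_iff of_nat_power)
qed

lemma nrm_of_nat_unit_iff: "nrm (of_nat a :: 'k) = 1 \<longleftrightarrow> \<not> p dvd a"
proof
  assume "\<not> p dvd a"
  then show "nrm (of_nat a :: 'k) = 1" using nrm_of_int_unit[of "int a"] by (simp add: int_dvd_int_iff)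
next
  assume 1: "nrm (of_nat a :: 'k) = 1"
  show "\<not> p dvd a"
  proof
    assume "p dvd a"
    then have "nrm (of_nat a :: 'k) \<le> pp 1"
      using nrm_of_int_le_iff[of "int a" 1] by (simp add: int_dvd_int_iff)
    then show False using 1 pp_Suc_less_1[of 0] by simp
  qed
qed

section \<open>Limits and series\<close>

lemma k_tendsto_iff: "(X \<longlongrightarrow> (L::'k)) F \<longleftrightarrow> ((\<lambda>n. nrm (X n - L)) \<longlongrightarrow> 0) F"
  using tendsto_dist_iff[of X L F] by (simp add: dist_nrm[of _ L])

text \<open>Limits in the field are reduced to real null sequences. Since the type class of the field
  relates neither addition nor multiplication to the metric, continuity of the ring operations is
  derived below from the ultrametric inequality.\<close>

lemma k_tendsto_bound:
  assumes "eventually (\<lambda>n. nrm (X n - L :: 'k) \<le> g n) F" "(g \<longlongrightarrow> 0) F" shows "(X \<longlongrightarrow> L) F"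
  unfolding k_tendsto_iff
  by (rule tendsto_sandwich[OF _ assms(1) tendsto_const assms(2)]) simp

lemma k_tendsto_eps:
  "X \<longlonglongrightarrow> (L::'k) \<longleftrightarrow> (\<forall>e>0. \<exists>m0. \<forall>m\<ge>m0. nrm (X m - L) \<le> e)"
proof
  assume "X \<longlonglongrightarrow> L"
  then show "\<forall>e>0. \<exists>m0. \<forall>m\<ge>m0. nrm (X m - L) \<le> e"
    unfolding lim_sequentially dist_nrm[of _ L] by (meson less_imp_le)
next
  assume r: "\<forall>e>0. \<exists>m0. \<forall>m\<ge>m0. nrm (X m - L) \<le> e"
  show "X \<longlonglongrightarrow> L" unfolding lim_sequentially dist_nrm[of _ L]
  proof (intro allI impI)
    fix e :: real assume "e > 0"
    then obtain m0 where "\<forall>m\<ge>m0. nrm (X m - L) \<le> e / 2" using r half_gt_zero by blast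
    then show "\<exists>no. \<forall>n\<ge>no. nrm (X n - L) < e" using \<open>e > 0\<close> by (intro exI[of _ m0]) force
  qed
qed

lemma k_tendsto_add:
  assumes "(X \<longlongrightarrow> (a::'k)) F" "(Y \<longlongrightarrow> b) F" shows "((\<lambda>n. X n + Y n) \<longlongrightarrow> a + b) F"
proof (rule k_tendsto_bound)
  have "nrm (X n + Y n - (a + b)) \<le> max (nrm (X n - a)) (nrm (Y n - b))" for n
    using nrm_add_le[of "X n - a" "Y n - b"] by (simp add: algebra_simps)
  then show "\<forall>\<^sub>F n in F. nrm (X n + Y n - (a + b)) \<le> max (nrm (X n - a)) (nrm (Y n - b))" by simp
  show "((\<lambda>n. max (nrm (X n - a)) (nrm (Y n - b))) \<longlongrightarrow> 0) F"
    using tendsto_max[OF assms[unfolded k_tendsto_iff]] by simp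
qed

lemma k_tendsto_mult:
  assumes "(X \<longlongrightarrow> (a::'k)) F" "(Y \<longlongrightarrow> b) F" shows "((\<lambda>n. X n * Y n) \<longlongrightarrow> a * b) F"
proof (rule k_tendsto_bound)
  let ?x = "\<lambda>n. nrm (X n - a)" and ?y = "\<lambda>n. nrm (Y n - b)"
  have "nrm (X n * Y n - a * b) \<le> ?x n * ?y n + nrm a * ?y n + ?x n * nrm b" for n
  proof -
    have e: "X n * Y n - a * b = ((X n - a) * (Y n - b) + a * (Y n - b)) + (X n - a) * b"
      by (simp add: algebra_simps)
    have "nrm (X n * Y n - a * b) \<le> max (max (?x n * ?y n) (nrm a * ?y n)) (?x n * nrm b)"
      unfolding e using nrm_add_le[of "(X n - a) * (Y n - b)" "a * (Y n - b)"]
        nrm_add_le[of "(X n - a) * (Y n - b) + a * (Y n - b)" "(X n - a) * b"]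
      by (simp add: nrm_mult)
    also have "\<dots> \<le> ?x n * ?y n + nrm a * ?y n + ?x n * nrm b" by simp
    finally show ?thesis .
  qed
  then show "\<forall>\<^sub>F n in F. nrm (X n * Y n - a * b) \<le> ?x n * ?y n + nrm a * ?y n + ?x n * nrm b" by simp
  have x: "(?x \<longlongrightarrow> 0) F" "(?y \<longlongrightarrow> 0) F" using assms unfolding k_tendsto_iff by auto
  show "((\<lambda>n. ?x n * ?y n + nrm a * ?y n + ?x n * nrm b) \<longlongrightarrow> 0) F"
    by (rule tendsto_eq_intros x refl | simp)+
qed

lemma k_tendsto_cmult: "(X \<longlongrightarrow> (a::'k)) F \<Longrightarrow> ((\<lambda>n. c * X n) \<longlongrightarrow> c * a) F"
  by (rule k_tendsto_mult[OF tendsto_const])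

lemma k_tendsto_diff:
  assumes "(X \<longlongrightarrow> (a::'k)) F" "(Y \<longlongrightarrow> b) F" shows "((\<lambda>n. X n - Y n) \<longlongrightarrow> a - b) F"
  using k_tendsto_add[OF assms(1) k_tendsto_cmult[OF assms(2), of "-1"]] by simp

lemma k_tendsto_sum:
  "(\<And>i. i \<in> A \<Longrightarrow> (X i \<longlongrightarrow> (a i::'k)) F) \<Longrightarrow> ((\<lambda>n. \<Sum>i\<in>A. X i n) \<longlongrightarrow> (\<Sum>i\<in>A. a i)) F"
  by (induction A rule: infinite_finite_induct) (auto intro: k_tendsto_add)

lemma k_tendsto_power: "(X \<longlongrightarrow> (a::'k)) F \<Longrightarrow> ((\<lambda>n. X n ^ k) \<longlongrightarrow> a ^ k) F"
  by (induction k) (auto intro: k_tendsto_mult)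

lemma nrm_limit_le:
  assumes "X \<longlonglongrightarrow> (a::'k)" "eventually (\<lambda>n. nrm (X n) \<le> B) sequentially" shows "nrm a \<le> B"
proof -
  have "(\<lambda>n. nrm (X n)) \<longlonglongrightarrow> nrm a" by (intro tendsto_dist assms tendsto_const)
  then show ?thesis using assms(2) by (rule tendsto_upperbound) simp
qed

lemma lim_eq_of_diff_null:
  assumes "(\<lambda>n. X n - Y n :: 'k) \<longlonglongrightarrow> 0" "Y \<longlonglongrightarrow> L" shows "X \<longlonglongrightarrow> L"
  using k_tendsto_add[OF assms] by simp

text \<open>By the ultrametric inequality it suffices to compare every term with one fixed term.\<close>

lemma k_convergentI:
  assumes "\<And>e. e > 0 \<Longrightarrow> \<exists>m0. \<forall>m\<ge>m0. nrm (X m - X m0 :: 'k) \<le> e"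
  shows "convergent X"
proof -
  have "Cauchy X" unfolding Cauchy_def
  proof (intro allI impI)
    fix e :: real assume "e > 0"
    then obtain m0 where m0: "\<forall>m\<ge>m0. nrm (X m - X m0) \<le> e / 2" using assms half_gt_zero by blast
    have "dist (X m) (X n) < e" if "m \<ge> m0" "n \<ge> m0" for m n
      using nrm_trans_le[of "X m" "X m0" "e/2" "X n"] m0 that \<open>e > 0\<close>
      unfolding dist_nrm[of "X m" "X n"] nrm_minus_commute[of "X m0" "X n"] by force
    then show "\<exists>M. \<forall>m\<ge>M. \<forall>n\<ge>M. dist (X m) (X n) < e" by blast
  qed
  then show ?thesis by (rule Cauchy_convergent)
qed

lemma series_diff_le:
  fixes t :: "nat \<Rightarrow> 'k"
  assumes t: "\<And>n. nrm (t n) \<le> g n" and g: "\<And>m n. m \<le> n \<Longrightarrow> g n \<le> g m" and "m \<le> M"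
  shows "nrm ((\<Sum>n<M. t n) - (\<Sum>n<m. t n)) \<le> g m"
proof -
  have "(\<Sum>n<M. t n) - (\<Sum>n<m. t n) = sum t {m..<M}"
    unfolding lessThan_atLeast0 using assms(3) by (intro sum_diff_nat_ivl) simp_all
  also have "nrm \<dots> \<le> g m"
    using t g order_trans[OF zero_le_dist t] by (intro nrm_sum_le) (auto intro: order_trans)
  finally show ?thesis .
qed

text \<open>In an ultrametric field a series converges as soon as its terms tend to zero, and the
  tail is bounded by its largest term.\<close>

lemma series_LIMSEQ:
  fixes t :: "nat \<Rightarrow> 'k"
  assumes t: "\<And>n. nrm (t n) \<le> g n" and g: "\<And>m n. m \<le> n \<Longrightarrow> g n \<le> g m" "g \<longlonglongrightarrow> 0"
  shows "(\<lambda>M. \<Sum>n<M. t n) \<longlonglongrightarrow> lim (\<lambda>M. \<Sum>n<M. t n)"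
proof -
  have "convergent (\<lambda>M. \<Sum>n<M. t n)"
  proof (rule k_convergentI)
    fix e :: real assume "e > 0"
    then have "\<forall>\<^sub>F m in sequentially. g m < e" using g(2) by (intro order_tendstoD)
    then obtain m where "g m < e" unfolding eventually_sequentially by blast
    then have "\<forall>M\<ge>m. nrm ((\<Sum>n<M. t n) - (\<Sum>n<m. t n)) \<le> e"
      using series_diff_le[OF t g(1), where m = m] by (meson less_imp_le order_trans)
    then show "\<exists>m. \<forall>M\<ge>m. nrm ((\<Sum>n<M. t n) - (\<Sum>n<m. t n)) \<le> e" by blast
  qed
  then show ?thesis by (simp add: convergent_LIMSEQ_iff)
qed

lemma series_tail_le:
  fixes t :: "nat \<Rightarrow> 'k"
  assumes t: "\<And>n. nrm (t n) \<le> g n" and g: "\<And>m n. m \<le> n \<Longrightarrow> g n \<le> g m"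
    and L: "(\<lambda>M. \<Sum>n<M. t n) \<longlonglongrightarrow> L"
  shows "nrm (L - (\<Sum>n<m. t n)) \<le> g m"
proof (rule nrm_limit_le)
  show "(\<lambda>M. (\<Sum>n<M. t n) - (\<Sum>n<m. t n)) \<longlonglongrightarrow> L - (\<Sum>n<m. t n)"
    by (rule k_tendsto_diff[OF L tendsto_const])
  have "\<forall>M\<ge>m. nrm ((\<Sum>n<M. t n) - (\<Sum>n<m. t n)) \<le> g m"
    by (intro allI impI series_diff_le[OF t g])
  then show "\<forall>\<^sub>F M in sequentially. nrm ((\<Sum>n<M. t n) - (\<Sum>n<m. t n)) \<le> g m"
    unfolding eventually_sequentially by (rule exI)
qed

section \<open>The ring of p-adic integers\<close>

lemma Zp_iff_int: "x \<in> (Zp::'k set) \<longleftrightarrow> (\<forall>e>0. \<exists>k::int. nrm (x - of_int k) < e)"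
  unfolding Zp_def closure_approachable dist_nrm[of _ x] nrm_minus_commute[of _ x]
  by (auto simp: Ints_def)

lemma Zp_of_int [simp]: "of_int k \<in> (Zp::'k set)"
  unfolding Zp_iff_int by (auto intro!: exI[of _ k])

lemma Zp_of_nat [simp]: "of_nat k \<in> (Zp::'k set)"
  using Zp_of_int[of "int k"] by (simp del: Zp_of_int)

lemma Zp_0 [simp]: "0 \<in> (Zp::'k set)" and Zp_1 [simp]: "1 \<in> (Zp::'k set)"
  using Zp_of_nat[of 0] Zp_of_nat[of 1] by (simp_all del: Zp_of_nat)

text \<open>Every residue class modulo \<open>p ^ m\<close> has a representative among the natural numbers below
  \<open>p ^ m\<close>; all sums over residue classes rest on this.\<close>

lemma Zp_nat_approx:
  assumes "x \<in> (Zp::'k set)" obtains a where "a < p ^ m" "nrm (x - of_nat a) \<le> pp m"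
proof -
  obtain k where k: "nrm (x - of_int k) < pp m" using assms pp_pos[of m] unfolding Zp_iff_int by blast
  define a where "a = nat (k mod int p ^ m)"
  have pos: "int p ^ m > 0" using p_gt_1 by simp
  have a: "int a = k mod int p ^ m" unfolding a_def using pos by simp
  have "int p ^ m dvd k - int a" unfolding a by (simp add: minus_mod_eq_mult_div)
  then have "nrm (of_int (k - int a) :: 'k) \<le> pp m" using nrm_of_int_le_iff by blast
  then have "nrm (x - of_nat a) \<le> pp m"
    using nrm_trans_le[of x "of_int k" "pp m" "of_nat a"] k by simp
  moreover have "int a < int (p ^ m)" unfolding a using pos by simp
  ultimately show ?thesis using that[of a] by simp
qed

lemma Zp_limit:
  assumes "\<And>e. e > 0 \<Longrightarrow> \<exists>y\<in>Zp. nrm (x - y :: 'k) \<le> e" shows "x \<in> (Zp::'k set)"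
proof -
  have "x \<in> closure Zp" unfolding closure_approachable
  proof (intro allI impI)
    fix e :: real assume "e > 0"
    then obtain y where "y \<in> Zp" "nrm (x - y) \<le> e / 2" using assms half_gt_zero by blast
    then show "\<exists>y\<in>Zp. dist y x < e" using \<open>e > 0\<close>
      unfolding dist_nrm[of _ x] nrm_minus_commute[of _ x] by (intro bexI[of _ y]) auto
  qed
  then show ?thesis unfolding Zp_def by simp
qed

lemma Zp_LIMSEQ:
  assumes "X \<longlonglongrightarrow> (x::'k)" "\<And>n. X n \<in> Zp" shows "x \<in> Zp"
  using assms(2) closed_sequentially[OF _ _ assms(1), of Zp] unfolding Zp_def by auto

lemma Zp_nrm_le: "x \<in> (Zp::'k set) \<Longrightarrow> nrm x \<le> 1"
proof -
  assume "x \<in> Zp"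
  then obtain a where "nrm (x - of_nat a) \<le> pp 0" using Zp_nat_approx by blast
  then show ?thesis using nrm_add_leI[of "x - of_nat a" 1 "of_nat a"] nrm_of_nat_le[of a] by simp
qed

text \<open>Conversely, approximability by natural numbers to every precision puts an element into
  the closure, which reduces the closure properties below to congruences.\<close>

lemma Zp_nat_limitI:
  assumes "\<And>m. \<exists>a::nat. nrm (x - of_nat a :: 'k) \<le> pp m" shows "x \<in> Zp"
  using assms pp_less Zp_of_nat by (intro Zp_limit) (meson less_imp_le order_trans)

lemma Zp_add [simp]: assumes "x \<in> (Zp::'k set)" "y \<in> Zp" shows "x + y \<in> Zp"
proof (rule Zp_nat_limitI)
  fix m
  obtain a where "nrm (x - of_nat a) \<le> pp m" using Zp_nat_approx assms by blast
  moreover obtain b where "nrm (y - of_nat b) \<le> pp m" using Zp_nat_approx assms by blast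
  ultimately have "nrm (x + y - of_nat (a + b)) \<le> pp m"
    using nrm_add_leI[of "x - of_nat a" _ "y - of_nat b"] by (simp add: algebra_simps)
  then show "\<exists>a. nrm (x + y - of_nat a) \<le> pp m" by blast
qed

lemma Zp_mult [simp]: assumes "x \<in> (Zp::'k set)" "y \<in> Zp" shows "x * y \<in> Zp"
proof (rule Zp_nat_limitI)
  fix m
  obtain a where a: "nrm (x - of_nat a) \<le> pp m" using Zp_nat_approx assms by blast
  obtain b where b: "nrm (y - of_nat b) \<le> pp m" using Zp_nat_approx assms by blast
  have e: "x * y - of_nat (a * b) = y * (x - of_nat a) + of_nat a * (y - of_nat b)"
    by (simp add: algebra_simps)
  have "nrm (x * y - of_nat (a * b)) \<le> pp m"
    unfolding e using a b by (intro nrm_add_leI nrm_mult_leI1 Zp_nrm_le assms nrm_of_nat_le)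
  then show "\<exists>a. nrm (x * y - of_nat a) \<le> pp m" by blast
qed

lemma Zp_minus [simp]: "x \<in> (Zp::'k set) \<Longrightarrow> - x \<in> Zp"
  using Zp_mult[OF Zp_of_int[of "-1"], of x] by simp

lemma Zp_diff [simp]: "x \<in> (Zp::'k set) \<Longrightarrow> y \<in> Zp \<Longrightarrow> x - y \<in> Zp"
  using Zp_add[of x "- y"] by simp

lemma Zp_power [simp]: "x \<in> (Zp::'k set) \<Longrightarrow> x ^ n \<in> Zp"
  by (induction n) auto

lemma Zp_sum: "(\<And>i. i \<in> A \<Longrightarrow> h i \<in> (Zp::'k set)) \<Longrightarrow> sum h A \<in> Zp"
  by (induction A rule: infinite_finite_induct) auto

text \<open>If \<open>a\<close> approximates \<open>x\<close> modulo \<open>p ^ m\<close>, then an inverse of \<open>a\<close> modulo \<open>p ^ m\<close>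
  approximates the inverse of \<open>x\<close> equally well.\<close>

lemma Zp_unit_inverse: assumes x: "x \<in> (Zp::'k set)" "nrm x = 1" shows "inverse x \<in> Zp"
proof (rule Zp_nat_limitI)
  fix m
  \<comment> \<open>One digit more than required, so that \<open>a\<close> is a unit also for \<open>m = 0\<close>.\<close>
  obtain a where a: "nrm (x - of_nat a) \<le> pp (Suc m)" using Zp_nat_approx x by blast
  have na: "nrm (of_nat a :: 'k) = 1"
    using nrm_eq_of_close[of "of_nat a" x] a x nrm_minus_commute[of x "of_nat a"] pp_Suc_less_1[of m]
    by linarith
  then have "coprime a p"
    using nrm_of_nat_unit_iff prime_p by (metis coprime_commute prime_imp_coprime)
  then have "coprime a (p ^ Suc m)" by (metis coprime_power_right_iff)
  from cong_solve_coprime_nat[OF this] obtain b where b: "[a * b = 1] (mod p ^ Suc m)"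
    by (metis One_nat_def)
  have nb: "nrm (of_nat a * of_nat b - 1 :: 'k) \<le> pp (Suc m)"
    using nrm_nat_diff_le_iff[of "a * b" 1 "Suc m"] b by simp
  have x0: "x \<noteq> 0" using x by auto
  have "inverse x - of_nat b = inverse x * (1 - x * of_nat b)" using x0 by (simp add: algebra_simps)
  also have "1 - x * of_nat b = (1 - of_nat a * of_nat b) - of_nat b * (x - of_nat a)"
    by (simp add: algebra_simps)
  finally have e: "inverse x - of_nat b =
    inverse x * ((1 - of_nat a * of_nat b) - of_nat b * (x - of_nat a))" .
  have "nrm (inverse x - of_nat b) \<le> pp (Suc m)"
    unfolding e
  proof (rule nrm_mult_leI1)
    have "nrm (1 - of_nat a * of_nat b :: 'k) \<le> pp (Suc m)"
      using nb nrm_minus_commute[of "of_nat a * of_nat b" 1] by simp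
    moreover have "nrm (of_nat b * (x - of_nat a)) \<le> pp (Suc m)"
      by (rule nrm_mult_leI1[OF nrm_of_nat_le a])
    ultimately show "nrm (1 - of_nat a * of_nat b - of_nat b * (x - of_nat a)) \<le> pp (Suc m)"
      by (rule nrm_diff_leI)
  qed (use x in \<open>simp add: nrm_inverse\<close>)
  also have "\<dots> \<le> pp m" by (rule pp_antimono) simp
  finally show "\<exists>a. nrm (inverse x - of_nat a) \<le> pp m" by blast
qed

lemma Gp_iff: "x \<in> (Gp::'k set) \<longleftrightarrow> x \<in> Zp \<and> nrm x = 1"
proof -
  have "nrm x = 1" if "x \<in> Zp" "x \<noteq> 0" "inverse x \<in> Zp"
    using that Zp_nrm_le[of x] Zp_nrm_le[of "inverse x"]
    by (metis nrm_inverse order_antisym inverse_le_1_iff zero_less_dist_iff not_less)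
  moreover have "x \<noteq> 0" if "nrm x = 1" using that by auto
  ultimately show ?thesis unfolding Gp_def using Zp_unit_inverse by blast
qed

lemma Zp_p_power_dvd:
  assumes x: "x \<in> (Zp::'k set)" "nrm x \<le> pp m" shows "\<exists>y\<in>Zp. x = of_nat p ^ m * y"
proof
  have p0: "(of_nat p :: 'k) \<noteq> 0" using p_gt_1 by simp
  show "x = of_nat p ^ m * (x / of_nat p ^ m)" using p0 by simp
  show "x / of_nat p ^ m \<in> Zp"
  proof (rule Zp_nat_limitI)
    fix n
    obtain a where a: "nrm (x - of_nat a) \<le> pp (m + n)" using Zp_nat_approx x by blast
    have "nrm (of_nat a :: 'k) \<le> pp m"
      using nrm_diff_leI[of x "pp m" "x - of_nat a"] x a pp_antimono[of m "m+n"] by simp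
    then have "p ^ m dvd a" using nrm_of_int_le_iff[of "int a" m]
      by (metis int_dvd_int_iff of_int_of_nat_eq of_nat_power)
    then obtain b where b: "a = p ^ m * b" by auto
    have "x / of_nat p ^ m - of_nat b = (x - of_nat a) / of_nat p ^ m"
      using p0 by (simp add: b field_simps)
    then have "nrm (x / of_nat p ^ m - of_nat b) = nrm (x - of_nat a) / pp m"
      by (simp add: nrm_divide nrm_p_power)
    also have "\<dots> \<le> pp n" using a pp_pos[of m] by (simp add: divide_le_eq power_add mult.commute)
    finally show "\<exists>a. nrm (x / of_nat p ^ m - of_nat a) \<le> pp n" by blast
  qed
qed

text \<open>Residue classes are balls, so the ultrametric inequality governs their geometry.\<close>

lemma disc_iff:
  assumes "a \<in> (Zp::'k set)"
  shows "y \<in> residue_disc p m a \<longleftrightarrow> y \<in> Zp \<and> nrm (y - a) \<le> pp m"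
proof
  assume "y \<in> residue_disc p m a"
  then obtain x where x: "x \<in> Zp" "y = a + of_nat p ^ m * x" unfolding residue_disc_def by auto
  then show "y \<in> Zp \<and> nrm (y - a) \<le> pp m"
    using assms Zp_nrm_le[of x] pp_pos[of m] by (simp add: nrm_mult nrm_p_power mult_left_le)
next
  assume y: "y \<in> Zp \<and> nrm (y - a) \<le> pp m"
  then obtain x where "x \<in> Zp" "y - a = of_nat p ^ m * x" using Zp_p_power_dvd[of "y - a" m] assms by auto
  then show "y \<in> residue_disc p m a" unfolding residue_disc_def
    by (auto intro!: exI[of _ x] simp: algebra_simps)
qed

section \<open>Open and closed sets as unions of residue classes\<close>

abbreviation disc :: "nat \<Rightarrow> nat \<Rightarrow> 'k set" where "disc m a \<equiv> residue_disc p m (of_nat a)"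

text \<open>The sets \<open>U\<close> that are unions of residue classes modulo \<open>p ^ m\<close>.\<close>

definition periodic :: "nat \<Rightarrow> 'k set \<Rightarrow> bool" where
  "periodic m U \<longleftrightarrow> U \<subseteq> Zp \<and> (\<forall>x\<in>U. \<forall>y\<in>Zp. nrm (y - x) \<le> pp m \<longrightarrow> y \<in> U)"

lemma periodicD: "periodic m U \<Longrightarrow> x \<in> U \<Longrightarrow> y \<in> Zp \<Longrightarrow> nrm (y - x) \<le> pp m \<Longrightarrow> y \<in> U"
  unfolding periodic_def by blast

lemma periodic_subset: "periodic m U \<Longrightarrow> U \<subseteq> Zp"
  unfolding periodic_def by blast

lemma periodic_mono: "periodic m U \<Longrightarrow> m \<le> n \<Longrightarrow> periodic n U"
  unfolding periodic_def using pp_antimono by (meson order_trans)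

lemma periodic_Zp: "periodic m Zp"
  unfolding periodic_def by blast

lemma periodic_empty: "periodic m {}"
  unfolding periodic_def by blast

lemma periodic_Un: "periodic m U \<Longrightarrow> periodic m V \<Longrightarrow> periodic m (U \<union> V)"
  unfolding periodic_def by blast

lemma periodic_Diff: "periodic m U \<Longrightarrow> periodic m V \<Longrightarrow> periodic m (U - V)"
  unfolding periodic_def
proof (intro conjI ballI impI; (elim conjE)?)
  fix x y assume a: "U \<subseteq> Zp" "\<forall>x\<in>U. \<forall>y\<in>Zp. nrm (y - x) \<le> pp m \<longrightarrow> y \<in> U"
    "\<forall>x\<in>V. \<forall>y\<in>Zp. nrm (y - x) \<le> pp m \<longrightarrow> y \<in> V" "x \<in> U - V" "y \<in> Zp" "nrm (y - x) \<le> pp m"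
  then have "nrm (x - y) \<le> pp m" "x \<in> Zp" using nrm_minus_commute[of x y] by auto
  then show "y \<in> U - V" using a by blast
qed blast

lemma periodic_Gp: "periodic (Suc 0) Gp"
  unfolding periodic_def
proof (intro conjI ballI impI)
  show "Gp \<subseteq> (Zp::'k set)" by (auto simp: Gp_iff)
  fix x y :: 'k assume x: "x \<in> Gp" "y \<in> Zp" "nrm (y - x) \<le> pp (Suc 0)"
  then have "nrm (y - x) < nrm x" using pp_Suc_less_1[of 0] unfolding Gp_iff by linarith
  then have "nrm y = nrm x" by (rule nrm_eq_of_close)
  then show "y \<in> Gp" using x by (simp add: Gp_iff)
qed

lemma periodic_disc: "periodic m (disc m a)"
  unfolding periodic_def disc_iff[OF Zp_of_nat] using nrm_trans_le disc_iff[OF Zp_of_nat] by blast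

lemma compact_Zp: "compact (Zp :: 'k set)"
  unfolding compact_eq_totally_bounded
proof (intro conjI allI impI)
  show "complete (Zp :: 'k set)" unfolding complete_eq_closed Zp_def by simp
  fix e :: real assume "e > 0"
  then obtain m where m: "pp m < e" using pp_less by blast
  have "Zp \<subseteq> (\<Union>x\<in>of_nat ` {..<p^m}. ball (x::'k) e)"
  proof
    fix x :: 'k assume "x \<in> Zp"
    then obtain a where "a < p ^ m" "nrm (x - of_nat a) \<le> pp m" using Zp_nat_approx by blast
    then show "x \<in> (\<Union>x\<in>of_nat ` {..<p^m}. ball x e)"
      using m by (auto intro!: bexI[of _ a] simp: dist_commute[of _ x] dist_nrm[of x])
  qed
  then show "\<exists>k. finite k \<and> Zp \<subseteq> (\<Union>x\<in>k. ball (x::'k) e)"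
    by (intro exI[of _ "of_nat ` {..<p^m}"]) auto
qed

lemma openin_periodic:
  assumes "periodic m U" "U \<subseteq> X" "X \<subseteq> Zp" shows "openin (top_of_set X) U"
  unfolding openin_euclidean_subtopology_iff
proof (intro conjI ballI)
  fix x assume "x \<in> U"
  then show "\<exists>e>0. \<forall>x'\<in>X. dist x' x < e \<longrightarrow> x' \<in> U"
    using assms periodicD[OF assms(1)] pp_pos[of m] dist_nrm[of _ x] by (intro exI[of _ "pp m"]) force
qed (rule assms)

text \<open>The indicator function of an open and closed set is continuous on the compact
  space \<open>\<int>\<^sub>p\<close>, hence uniformly continuous, so membership depends only on the class modulo some
  \<open>p ^ m\<close>. All measure theory below becomes finite through this lemma.\<close>

lemma clopen_iff_periodic:
  assumes X: "periodic n X" shows "clopen X U \<longleftrightarrow> U \<subseteq> X \<and> (\<exists>m. periodic m U)"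
proof
  assume "U \<subseteq> X \<and> (\<exists>m. periodic m U)"
  then obtain m where m: "U \<subseteq> X" "periodic m U" by blast
  have "periodic (max m n) (X - U)"
    using periodic_Diff[of "max m n" X U] periodic_mono[OF X] periodic_mono[OF m(2)] by simp
  then show "clopen X U" unfolding clopen_def closedin_def
    using openin_periodic[OF m(2,1)] openin_periodic[of _ "X - U" X] periodic_subset[OF X] m by auto
next
  assume c: "clopen X U"
  then have UX: "U \<subseteq> X" and o: "openin (top_of_set X) U" and c: "openin (top_of_set X) (X - U)"
    unfolding clopen_def closedin_def by auto
  let ?h = "indicator U :: 'k \<Rightarrow> real"
  have "continuous_on Zp ?h"
    unfolding continuous_on_iff
  proof (intro ballI allI impI)
    fix x :: 'k and e :: real assume x: "x \<in> Zp" and "e > 0"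
    have "\<exists>d>0. \<forall>x'\<in>Zp. dist x' x < d \<longrightarrow> (x' \<in> U \<longleftrightarrow> x \<in> U)"
    proof (cases "x \<in> X")
      case False
      have "x' \<notin> X" if "dist x' x < pp n" "x' \<in> Zp" for x'
        using that False periodicD[OF X, of x' x] x dist_nrm[of x' x] nrm_minus_commute[of x x'] by force
      then show ?thesis using pp_pos UX False by (intro exI[of _ "pp n"]) auto
    next
      case True
      obtain e where e: "e > 0" "\<forall>x'\<in>X. dist x' x < e \<longrightarrow> (x' \<in> U \<longleftrightarrow> x \<in> U)"
      proof (cases "x \<in> U")
        case True
        then obtain e where "e > 0" "\<forall>x'\<in>X. dist x' x < e \<longrightarrow> x' \<in> U"
          using o unfolding openin_euclidean_subtopology_iff by blast
        then show ?thesis using that True by blast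
      next
        case False
        then have "x \<in> X - U" using \<open>x \<in> X\<close> by blast
        then obtain e where "e > 0" "\<forall>x'\<in>X. dist x' x < e \<longrightarrow> x' \<in> X - U"
          using c unfolding openin_euclidean_subtopology_iff by blast
        then show ?thesis using that False by blast
      qed
      have "x' \<in> X" if "dist x' x < pp n" "x' \<in> Zp" for x'
        using that True periodicD[OF X, of x x'] dist_nrm[of x' x] by force
      then show ?thesis using pp_pos e by (intro exI[of _ "min e (pp n)"]) auto
    qed
    then obtain d where "d > 0" "\<forall>x'\<in>Zp. dist x' x < d \<longrightarrow> (x' \<in> U \<longleftrightarrow> x \<in> U)" by blast
    then show "\<exists>d>0. \<forall>x'\<in>Zp. dist x' x < d \<longrightarrow> dist (?h x') (?h x) < e"
      using \<open>e > 0\<close> by (intro exI[of _ d]) (auto simp: indicator_def)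
  qed
  then have "uniformly_continuous_on Zp ?h" using compact_uniformly_continuous compact_Zp by blast
  then obtain d where d: "d > 0" "\<And>x x'. x \<in> Zp \<Longrightarrow> x' \<in> Zp \<Longrightarrow> dist x' x < d \<Longrightarrow> dist (?h x') (?h x) < 1"
    unfolding uniformly_continuous_on_def by (metis zero_less_one)
  obtain m where m: "pp m < d" using d pp_less by blast
  have "U \<subseteq> Zp" using UX periodic_subset[OF X] by blast
  moreover have "y \<in> U" if "x \<in> U" "y \<in> Zp" "nrm (y - x) \<le> pp m" for x y
  proof -
    have "x \<in> Zp" "dist y x < d" using that m \<open>U \<subseteq> Zp\<close> dist_nrm[of y x] by auto
    then have "dist (?h y) (?h x) < 1" using d(2)[of x y] that by blast
    then show ?thesis using that by (cases "y \<in> U") (auto simp: dist_real_def)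
  qed
  ultimately have "periodic m U" unfolding periodic_def by blast
  then show "U \<subseteq> X \<and> (\<exists>m. periodic m U)" using UX by blast
qed

lemma clopen_periodicI: "periodic n X \<Longrightarrow> periodic m U \<Longrightarrow> U \<subseteq> X \<Longrightarrow> clopen X U"
  using clopen_iff_periodic by blast

lemma clopenE:
  assumes "clopen X U" "periodic n X" obtains m where "m \<ge> n" "periodic m U" "U \<subseteq> X"
  using assms clopen_iff_periodic periodic_mono by (metis max.cobounded1 max.cobounded2)

definition nat_residue :: "nat \<Rightarrow> 'k \<Rightarrow> nat" where
  "nat_residue m x = (SOME a. a < p ^ m \<and> nrm (x - of_nat a) \<le> pp m)"

lemma nat_residue:
  assumes "x \<in> Zp" shows "nat_residue m x < p ^ m" "nrm (x - of_nat (nat_residue m x)) \<le> pp m"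
proof -
  have "\<exists>a. a < p ^ m \<and> nrm (x - of_nat a) \<le> pp m" using Zp_nat_approx[OF assms] by blast
  from someI_ex[OF this] show "nat_residue m x < p ^ m" "nrm (x - of_nat (nat_residue m x)) \<le> pp m"
    unfolding nat_residue_def by auto
qed

lemma nat_residue_eq_iff: assumes "x \<in> Zp" "a < p ^ m" shows "nat_residue m x = a \<longleftrightarrow> nrm (x - of_nat a) \<le> pp m"
proof
  assume "nrm (x - of_nat a) \<le> pp m"
  then have "nrm (of_nat (nat_residue m x) - of_nat a :: 'k) \<le> pp m"
    using nat_residue(2)[OF assms(1), of m] nrm_trans_le[of "of_nat (nat_residue m x)" x] nrm_minus_commute by metis
  then show "nat_residue m x = a" using nat_residue(1)[OF assms(1), of m] assms(2)
    unfolding nrm_nat_diff_le_iff cong_def by simp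
qed (use nat_residue assms in auto)

lemma mem_disc_iff: "a < p ^ m \<Longrightarrow> x \<in> disc m a \<longleftrightarrow> x \<in> Zp \<and> nat_residue m x = a"
  using disc_iff nat_residue_eq_iff Zp_of_nat by metis

lemma p_power_pos: "0 < p ^ m" using p_gt_1 by simp

lemma nat_residue_of_nat: "nat_residue m (of_nat b) = b mod p ^ m"
  using nat_residue_eq_iff[of "of_nat b" "b mod p ^ m" m] nrm_nat_diff_le_iff[of b "b mod p^m" m] p_power_pos[of m]
  by (simp add: cong_def)

lemma mem_periodic_iff_nat_residue: "periodic m U \<Longrightarrow> x \<in> Zp \<Longrightarrow> of_nat (nat_residue m x) \<in> U \<longleftrightarrow> x \<in> U"
  using nat_residue(2)[of x m] nrm_minus_commute[of x "of_nat (nat_residue m x)"] periodicD[of m U] Zp_of_nat by metis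

lemma finite_reps [simp]: "finite (reps p m X)"
  unfolding reps_def by simp

lemma reps_iff: "a \<in> reps p m X \<longleftrightarrow> a < p ^ m \<and> of_nat a \<in> X"
  unfolding reps_def by simp

lemma nat_residue_in_reps: "periodic m U \<Longrightarrow> x \<in> U \<Longrightarrow> nat_residue m x \<in> reps p m U"
  unfolding reps_iff using nat_residue mem_periodic_iff_nat_residue periodic_subset by blast

lemma disc_subset: "periodic m U \<Longrightarrow> of_nat a \<in> U \<Longrightarrow> disc m a \<subseteq> U"
  unfolding subset_iff disc_iff[OF Zp_of_nat] using periodicD by blast

lemma periodic_eq_Union: "periodic m U \<Longrightarrow> U = (\<Union>a\<in>reps p m U. disc m a)"
proof (intro equalityI subsetI)
  fix x assume U: "periodic m U" and x: "x \<in> U"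
  then have "x \<in> Zp" using periodic_subset by blast
  then have "x \<in> disc m (nat_residue m x)" using mem_disc_iff[of "nat_residue m x" m x] nat_residue(1) by blast
  then show "x \<in> (\<Union>a\<in>reps p m U. disc m a)" using nat_residue_in_reps[OF U x] by blast
next
  fix x assume "periodic m U" "x \<in> (\<Union>a\<in>reps p m U. disc m a)"
  then show "x \<in> U" using disc_subset[of m U] by (fastforce simp: reps_iff subset_iff)
qed

lemma disc_disjoint: "a \<in> reps p m U \<Longrightarrow> b \<in> reps p m V \<Longrightarrow> a \<noteq> b \<Longrightarrow> disc m a \<inter> disc m b = {}"
  unfolding reps_iff by (auto simp: mem_disc_iff)

section \<open>Bounded measures and their integrals\<close>

lemma bmeas_additive:
  assumes "\<mu> \<in> bounded_measures X" "clopen X U" "clopen X V" "U \<inter> V = {}"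
  shows "\<mu> (U \<union> V) = \<mu> U + \<mu> V"
  using assms unfolding bounded_measures_def by blast

lemma bmeas_not_clopen: "\<mu> \<in> bounded_measures X \<Longrightarrow> \<not> clopen X U \<Longrightarrow> \<mu> U = 0"
  unfolding bounded_measures_def by blast

lemma bmeas_bound:
  fixes \<mu> :: "'k set \<Rightarrow> 'k"
  assumes "\<mu> \<in> bounded_measures X" obtains B where "B \<ge> 0" "\<And>U. nrm (\<mu> U) \<le> B"
proof -
  obtain B where "\<forall>U. nrm (\<mu> U) \<le> B" using assms unfolding bounded_measures_def by blast
  then show ?thesis using that[of B] zero_le_dist[of "\<mu> {}" 0] by (meson order_trans)
qed

lemma bmeas_empty:
  fixes \<mu> :: "'k set \<Rightarrow> 'k"
  assumes "\<mu> \<in> bounded_measures X" shows "\<mu> {} = 0"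
  using bmeas_additive[OF assms, of "{}" "{}"] bmeas_not_clopen[OF assms, of "{}"] by (cases "clopen X {}") auto

lemma bmeas_UN:
  fixes \<mu> :: "'k set \<Rightarrow> 'k"
  assumes \<mu>: "\<mu> \<in> bounded_measures X" and X: "periodic n X" and "finite A"
    and "\<And>a. a \<in> A \<Longrightarrow> periodic m (F a)" "\<And>a. a \<in> A \<Longrightarrow> F a \<subseteq> X"
    and "\<And>a b. a \<in> A \<Longrightarrow> b \<in> A \<Longrightarrow> a \<noteq> b \<Longrightarrow> F a \<inter> F b = {}"
  shows "\<mu> (\<Union>a\<in>A. F a) = (\<Sum>a\<in>A. \<mu> (F a))"
proof -
  have "periodic m (\<Union>a\<in>A. F a) \<and> \<mu> (\<Union>a\<in>A. F a) = (\<Sum>a\<in>A. \<mu> (F a))"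
    using assms(3-)
  proof (induction A rule: finite_induct)
    case empty then show ?case using bmeas_empty[OF \<mu>] periodic_empty by simp
  next
    case (insert x A)
    then have IH: "periodic m (\<Union>a\<in>A. F a)" "\<mu> (\<Union>a\<in>A. F a) = (\<Sum>a\<in>A. \<mu> (F a))" by auto
    have "\<mu> (F x \<union> (\<Union>a\<in>A. F a)) = \<mu> (F x) + \<mu> (\<Union>a\<in>A. F a)"
    proof (rule bmeas_additive[OF \<mu>])
      show "clopen X (F x)" using insert.prems by (intro clopen_periodicI[OF X]) auto
      show "clopen X (\<Union>a\<in>A. F a)" using insert.prems IH by (intro clopen_periodicI[OF X]) auto
      show "F x \<inter> (\<Union>a\<in>A. F a) = {}" using insert by blast
    qed
    then show ?case using IH insert periodic_Un[of m "F x"] by simp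
  qed
  then show ?thesis by blast
qed

text \<open>A measure is determined by its values on residue classes; sums over
  \<open>reps p m U\<close> are the only way in which values on general sets enter later.\<close>

lemma bmeas_decomp:
  fixes \<mu> :: "'k set \<Rightarrow> 'k"
  assumes "\<mu> \<in> bounded_measures X" "periodic n X" "periodic m U" "U \<subseteq> X"
  shows "\<mu> U = (\<Sum>a\<in>reps p m U. \<mu> (disc m a))"
proof -
  have "\<mu> (\<Union>a\<in>reps p m U. disc m a) = (\<Sum>a\<in>reps p m U. \<mu> (disc m a))"
    using assms disc_subset[of m U] disc_disjoint[of _ m U _ U]
    by (intro bmeas_UN[where m = m] periodic_disc) (auto simp: reps_iff)
  then show ?thesis using periodic_eq_Union[OF assms(3)] by simp
qed

lemma bmeas_eqI:
  fixes \<mu> :: "'k set \<Rightarrow> 'k"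
  assumes "\<mu> \<in> bounded_measures X" "\<nu> \<in> bounded_measures X" "periodic n X"
    and "\<And>m a. m \<ge> n \<Longrightarrow> a \<in> reps p m X \<Longrightarrow> \<mu> (disc m a) = \<nu> (disc m a)"
  shows "\<mu> = \<nu>"
proof
  fix U
  show "\<mu> U = \<nu> U"
  proof (cases "clopen X U")
    case True
    then obtain m where m: "m \<ge> n" "periodic m U" "U \<subseteq> X" using clopenE assms(3) by blast
    have "a \<in> reps p m X" if "a \<in> reps p m U" for a using that m by (auto simp: reps_iff)
    then show ?thesis using bmeas_decomp[OF assms(1,3) m(2,3)] bmeas_decomp[OF assms(2,3) m(2,3)] assms(4) m
      by simp
  next
    case False then show ?thesis using assms bmeas_not_clopen by metis
  qed
qed

lemma sum_reps_refine:
  assumes "m \<le> M" "periodic m U"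
  shows "(\<Sum>b\<in>reps p M U. \<phi> b :: 'k) = (\<Sum>a\<in>reps p m U. \<Sum>b\<in>reps p M (disc m a). \<phi> b)"
proof -
  have "of_nat b \<in> U \<longleftrightarrow> (\<exists>a\<in>reps p m U. of_nat b \<in> disc m a)" for b
    using periodic_eq_Union[OF assms(2)] by blast
  then have "reps p M U = (\<Union>a\<in>reps p m U. reps p M (disc m a))"
    unfolding set_eq_iff UN_iff reps_iff by blast
  then have "(\<Sum>b\<in>reps p M U. \<phi> b) = sum \<phi> (\<Union>a\<in>reps p m U. reps p M (disc m a))" by simp
  also have "\<dots> = (\<Sum>a\<in>reps p m U. \<Sum>b\<in>reps p M (disc m a). \<phi> b)"
  proof (rule sum.UNION_disjoint)
    have "reps p M (disc m a) \<inter> reps p M (disc m b) = {}"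
      if "a \<in> reps p m U" "b \<in> reps p m U" "a \<noteq> b" for a b
      using disc_disjoint[OF that] by (auto simp: reps_iff)
    then show "\<forall>i\<in>reps p m U. \<forall>j\<in>reps p m U. i \<noteq> j \<longrightarrow>
        reps p M (disc m i) \<inter> reps p M (disc m j) = {}" by blast
  qed simp_all
  finally show ?thesis .
qed

text \<open>Uniform continuity in terms of residue classes. It is only asked on \<open>X\<close>, because the
  integrands \<open>1/x\<close> and the Mellin kernel are meaningful on the units only.\<close>

definition ucont :: "'k set \<Rightarrow> ('k \<Rightarrow> 'k) \<Rightarrow> bool" where
  "ucont X h \<longleftrightarrow> (\<forall>e>0. \<exists>m0. \<forall>x\<in>X. \<forall>y\<in>X. nrm (x - y) \<le> pp m0 \<longrightarrow> nrm (h x - h y) \<le> e)"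

text \<open>The Riemann sum of the integral without the intersection with \<open>X\<close>, which changes nothing
  once \<open>m\<close> is so large that \<open>X\<close> is a union of residue classes (\<open>riemann_sum_eq\<close>). At small \<open>m\<close> the two
  differ: for the units, level \<open>0\<close> has the only representative \<open>0\<close>, which is not a unit.\<close>

definition riemann_sum :: "'k set \<Rightarrow> ('k \<Rightarrow> 'k) \<Rightarrow> ('k set \<Rightarrow> 'k) \<Rightarrow> nat \<Rightarrow> 'k" where
  "riemann_sum X h \<mu> m = (\<Sum>a\<in>reps p m X. h (of_nat a) * \<mu> (disc m a))"

lemma riemann_sum_eq:
  assumes "periodic n X" "m \<ge> n"
  shows "(\<Sum>a\<in>reps p m X. h (of_nat a) * \<mu> (X \<inter> residue_disc p m (of_nat a))) = riemann_sum X h \<mu> m"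
  unfolding riemann_sum_def
proof (rule sum.cong)
  fix a assume "a \<in> reps p m X"
  then have "X \<inter> disc m a = disc m a" using disc_subset[OF periodic_mono[OF assms]] by (auto simp: reps_iff)
  then show "h (of_nat a) * \<mu> (X \<inter> disc m a) = h (of_nat a) * \<mu> (disc m a)" by simp
qed simp

lemma padic_integral_eqI:
  assumes "periodic n X" "riemann_sum X h \<mu> \<longlonglongrightarrow> L" shows "padic_integral p X h \<mu> = L"
proof -
  have "(\<lambda>m. \<Sum>a\<in>reps p m X. h (of_nat a) * \<mu> (X \<inter> residue_disc p m (of_nat a))) \<longlonglongrightarrow> L"
    using assms(2)
  proof (rule Lim_transform_eventually)
    show "\<forall>\<^sub>F m in sequentially. riemann_sum X h \<mu> m =
        (\<Sum>a\<in>reps p m X. h (of_nat a) * \<mu> (X \<inter> residue_disc p m (of_nat a)))"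
      unfolding eventually_sequentially using riemann_sum_eq[OF assms(1)] by (intro exI[of _ n]) auto
  qed
  then show ?thesis unfolding padic_integral_def by (rule limI)
qed

text \<open>Splitting each class of the coarse sum into finer ones, the difference is a sum
  of terms (variation of the integrand on a class) times (a value of the measure), and the ultrametric
  inequality bounds a sum by its largest term.\<close>

lemma riemann_sum_diff_le:
  assumes "periodic n X" "\<mu> \<in> bounded_measures X" "\<And>U. nrm (\<mu> U) \<le> B" "B \<ge> 0" "n \<le> m" "m \<le> M" "e \<ge> 0"
    and "\<And>x y. x \<in> X \<Longrightarrow> y \<in> X \<Longrightarrow> nrm (x - y) \<le> pp m \<Longrightarrow> nrm (h x - h y) \<le> e"
  shows "nrm (riemann_sum X h \<mu> M - riemann_sum X h \<mu> m) \<le> e * B"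
proof -
  have Xm: "periodic m X" using periodic_mono assms by blast
  have "riemann_sum X h \<mu> m = (\<Sum>a\<in>reps p m X. \<Sum>b\<in>reps p M (disc m a). h (of_nat a) * \<mu> (disc M b))"
    unfolding riemann_sum_def sum_distrib_left[symmetric]
  proof (rule sum.cong)
    fix a assume "a \<in> reps p m X"
    then have "disc m a \<subseteq> X" using disc_subset[OF Xm] by (simp add: reps_iff)
    then have "\<mu> (disc m a) = (\<Sum>b\<in>reps p M (disc m a). \<mu> (disc M b))"
      using bmeas_decomp assms periodic_mono[OF periodic_disc] by blast
    then show "h (of_nat a) * \<mu> (disc m a) = h (of_nat a) * (\<Sum>b\<in>reps p M (disc m a). \<mu> (disc M b))" by simp
  qed simp
  then have "riemann_sum X h \<mu> M - riemann_sum X h \<mu> m =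
      (\<Sum>a\<in>reps p m X. \<Sum>b\<in>reps p M (disc m a). (h (of_nat b) - h (of_nat a)) * \<mu> (disc M b))"
    unfolding riemann_sum_def sum_reps_refine[OF assms(6) Xm]
    by (simp add: sum_subtractf[symmetric] algebra_simps)
  also have "nrm \<dots> \<le> e * B"
  proof (intro nrm_sum_le mult_nonneg_nonneg assms nrm_mult_leI)
    fix a b assume "a \<in> reps p m X" "b \<in> reps p M (disc m a)"
    then have ab: "of_nat a \<in> X" "of_nat b \<in> disc m a" by (auto simp: reps_iff)
    then show "of_nat b \<in> X" "of_nat a \<in> X" using disc_subset[OF Xm] by auto
    show "nrm (of_nat b - of_nat a :: 'k) \<le> pp m" using ab(2) unfolding disc_iff[OF Zp_of_nat] by blast
  qed
  finally show ?thesis .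
qed

lemma riemann_sum_LIMSEQ:
  assumes X: "periodic n X" and \<mu>: "\<mu> \<in> bounded_measures X" and h: "ucont X h"
  shows "riemann_sum X h \<mu> \<longlonglongrightarrow> padic_integral p X h \<mu>"
proof -
  obtain B where B: "B \<ge> 0" "\<And>U. nrm (\<mu> U) \<le> B" using bmeas_bound[OF \<mu>] by blast
  have "convergent (riemann_sum X h \<mu>)"
  proof (rule k_convergentI)
    fix e :: real assume "e > 0"
    then have e: "e / (B + 1) > 0" using B by simp
    then obtain m0 where "\<forall>x\<in>X. \<forall>y\<in>X. nrm (x - y) \<le> pp m0 \<longrightarrow> nrm (h x - h y) \<le> e / (B + 1)"
      using h unfolding ucont_def by blast
    then have m0: "nrm (h x - h y) \<le> e / (B + 1)" if "x \<in> X" "y \<in> X" "nrm (x - y) \<le> pp (max n m0)" for x y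
      using that pp_antimono[of m0 "max n m0"] by fastforce
    have "nrm (riemann_sum X h \<mu> m - riemann_sum X h \<mu> (max n m0)) \<le> e" if "m \<ge> max n m0" for m
    proof -
      have "nrm (riemann_sum X h \<mu> m - riemann_sum X h \<mu> (max n m0)) \<le> e / (B + 1) * B"
        by (rule riemann_sum_diff_le[OF X \<mu> B(2,1) _ that _ m0]) (use e in auto)
      also have "\<dots> \<le> e" using B \<open>e > 0\<close> by (simp add: field_simps)
      finally show ?thesis .
    qed
    then show "\<exists>m0. \<forall>m\<ge>m0. nrm (riemann_sum X h \<mu> m - riemann_sum X h \<mu> m0) \<le> e" by blast
  qed
  then obtain L where "riemann_sum X h \<mu> \<longlonglongrightarrow> L" unfolding convergent_def by blast
  then show ?thesis using padic_integral_eqI[OF X] by blast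
qed

text \<open>The converse of \<open>bmeas_decomp\<close>: on an open and closed set one sums the values of any level at
  which it is a union of classes, and compatibility makes the result independent of the level. The
  least such level serves as a canonical choice.\<close>

lemma measure_from_levels:
  fixes v :: "nat \<Rightarrow> nat \<Rightarrow> 'k"
  assumes step: "\<And>m a. a < p ^ m \<Longrightarrow> v m a = (\<Sum>b\<in>reps p (Suc m) (disc m a). v (Suc m) b)"
    and B: "\<And>m a. a < p ^ m \<Longrightarrow> nrm (v m a) \<le> B"
  shows "\<exists>\<mu>\<in>bounded_measures Zp. \<forall>m a. a < p ^ m \<longrightarrow> \<mu> (disc m a) = v m a"
proof -
  define lev where "lev U = (LEAST m. periodic m U)" for U
  define \<mu> where "\<mu> U = (if clopen Zp U then \<Sum>a\<in>reps p (lev U) U. v (lev U) a else 0)" for U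
  have lev_step: "(\<Sum>a\<in>reps p m U. v m a) = (\<Sum>a\<in>reps p (Suc m) U. v (Suc m) a)" if U: "periodic m U" for m U
    unfolding sum_reps_refine[OF le_SucI[OF order_refl] U]
    by (rule sum.cong[OF refl], rule step) (simp add: reps_iff)
  have lev_eq: "(\<Sum>a\<in>reps p m U. v m a) = (\<Sum>a\<in>reps p M U. v M a)" if "m \<le> M" "periodic m U" for m M U
    using that(1)
  proof (induction M rule: nat_induct_at_least)
    case (Suc n)
    then show ?case using lev_step[OF periodic_mono[OF that(2)], of n] by (simp only:)
  qed (rule refl)
  have \<mu>: "\<mu> U = (\<Sum>a\<in>reps p m U. v m a)" if "periodic m U" for U m
  proof -
    have "periodic (lev U) U" "lev U \<le> m" unfolding lev_def using that by (auto intro: LeastI Least_le)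
    then show ?thesis unfolding \<mu>_def using lev_eq clopen_periodicI[OF periodic_Zp that periodic_subset[OF that]] by auto
  qed
  have "B \<ge> 0" using order_trans[OF zero_le_dist B[OF p_power_pos]] .
  have "\<mu> \<in> bounded_measures Zp" unfolding bounded_measures_def
  proof (intro CollectI conjI allI impI exI[of _ B])
    fix U V :: "'k set" assume "clopen Zp U" "clopen Zp V" and d: "U \<inter> V = {}"
    then obtain m1 m2 where "periodic m1 U" "periodic m2 V" using clopenE[OF _ periodic_Zp] by metis
    then have U: "periodic (max m1 m2) U" and V: "periodic (max m1 m2) V"
      using periodic_mono max.cobounded1 max.cobounded2 by blast+
    have "reps p m (U \<union> V) = reps p m U \<union> reps p m V" "reps p m U \<inter> reps p m V = {}" for m
      using d by (auto simp: reps_iff)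
    then show "\<mu> (U \<union> V) = \<mu> U + \<mu> V"
      unfolding \<mu>[OF U] \<mu>[OF V] \<mu>[OF periodic_Un[OF U V]] by (simp add: sum.union_disjoint)
  next
    fix U show "nrm (\<mu> U) \<le> B" unfolding \<mu>_def using B \<open>B \<ge> 0\<close>
      by (auto intro!: nrm_sum_le simp: reps_iff)
  qed (simp add: \<mu>_def)
  moreover have "\<mu> (disc m a) = v m a" if "a < p ^ m" for m a
  proof -
    have "reps p m (disc m a) = {a}"
      using that by (auto simp: reps_iff mem_disc_iff nat_residue_of_nat)
    then show ?thesis unfolding \<mu>[OF periodic_disc] by simp
  qed
  ultimately show ?thesis by blast
qed

section \<open>The convolution algebra\<close>

text \<open>Abbreviations that fix the element type: where \<open>Gp\<close> or \<open>Zp\<close> occurs only inside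
  \<open>reps\<close>, the type of the field could not be inferred.\<close>

abbreviation GG :: "'k set" where "GG \<equiv> Gp"
abbreviation ZZ :: "'k set" where "ZZ \<equiv> Zp"

lemma Gp_Zp: "x \<in> Gp \<Longrightarrow> x \<in> (Zp::'k set)"
  by (simp add: Gp_iff)

lemma Gp_mult: "x \<in> Gp \<Longrightarrow> y \<in> Gp \<Longrightarrow> x * y \<in> (Gp::'k set)"
  by (simp add: Gp_iff nrm_mult)

lemma Gp_1 [simp]: "1 \<in> (Gp::'k set)"
  by (simp add: Gp_iff nrm_1)

lemma Gp_inverse: "x \<in> Gp \<Longrightarrow> inverse x \<in> (Gp::'k set)"
  by (simp add: Gp_iff nrm_inverse Zp_unit_inverse)

lemma of_nat_Gp_iff: "of_nat a \<in> (Gp::'k set) \<longleftrightarrow> \<not> p dvd a"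
  by (simp add: Gp_iff nrm_of_nat_unit_iff)

lemma of_nat_Gp: "coprime a p \<Longrightarrow> of_nat a \<in> (Gp::'k set)"
  unfolding of_nat_Gp_iff using coprime_common_divisor[of a p p] p_gt_1 by auto

lemma mult_close:
  assumes "x \<in> Zp" "y' \<in> Zp" "nrm (x - x') \<le> pp m" "nrm (y - y') \<le> pp m"
  shows "nrm (x * y - x' * y' :: 'k) \<le> pp m"
proof -
  have "x * y - x' * y' = x * (y - y') + y' * (x - x')" by (simp add: algebra_simps)
  moreover have "nrm (x * (y - y') + y' * (x - x')) \<le> pp m"
    by (intro nrm_add_leI nrm_mult_leI1 Zp_nrm_le assms)
  ultimately show ?thesis by simp
qed

lemma periodic_mult_iff:
  assumes "periodic m U" "x \<in> Zp" "y \<in> Zp" "x' \<in> Zp" "y' \<in> Zp" "nrm (x - x') \<le> pp m" "nrm (y - y') \<le> pp m"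
  shows "x * y \<in> U \<longleftrightarrow> x' * y' \<in> U"
proof -
  have "nrm (x * y - x' * y') \<le> pp m" using assms by (intro mult_close)
  then show ?thesis using periodicD[OF assms(1)] nrm_minus_commute[of "x * y"] assms(2-5) Zp_mult by metis
qed

text \<open>The product in the group ring of \<open>(\<int>/p\<^sup>m)\<^sup>\<times>\<close>, summed over the classes in \<open>U\<close>.\<close>

definition conv_level :: "nat \<Rightarrow> ('k set \<Rightarrow> 'k) \<Rightarrow> ('k set \<Rightarrow> 'k) \<Rightarrow> 'k set \<Rightarrow> 'k" where
  "conv_level m \<rho> \<sigma> U = (\<Sum>a\<in>reps p m GG. \<Sum>b\<in>reps p m GG.
     if of_nat a * of_nat b \<in> U then \<rho> (disc m a) * \<sigma> (disc m b) else 0)"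

lemma units_disc:
  assumes "m \<ge> 1" "a \<in> reps p m GG" shows "disc m a \<subseteq> Gp" "clopen Gp (disc m a)"
proof -
  have m: "periodic m Gp" using periodic_mono[OF periodic_Gp] assms by simp
  show "disc m a \<subseteq> Gp" using assms(2) disc_subset[OF m] by (simp add: reps_iff)
  then show "clopen Gp (disc m a)" by (rule clopen_periodicI[OF m periodic_disc])
qed

text \<open>Whether \<open>a b\<close> lies in \<open>U\<close> depends only on the classes of \<open>a\<close> and \<open>b\<close> modulo
  \<open>p ^ m\<close>, so refining the level just splits the two factors additively.\<close>

lemma conv_level_refine:
  assumes \<rho>: "\<rho> \<in> bounded_measures Gp" and \<sigma>: "\<sigma> \<in> bounded_measures Gp"
    and U: "periodic m U" and m: "1 \<le> m" "m \<le> M"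
  shows "conv_level M \<rho> \<sigma> U = conv_level m \<rho> \<sigma> U"
proof -
  have G: "periodic m Gp" using periodic_mono[OF periodic_Gp] m by simp
  let ?R = "reps p m GG" and ?D = "\<lambda>a. reps p M (disc m a)"
  let ?c = "\<lambda>a b. if of_nat a * of_nat b \<in> U then 1 else (0::'k)"
  have split: "\<tau> (disc m a) = (\<Sum>b\<in>?D a. \<tau> (disc M b))" if "\<tau> \<in> bounded_measures Gp" "a \<in> ?R"
    for \<tau> :: "'k set \<Rightarrow> 'k" and a
    using bmeas_decomp[OF that(1) periodic_Gp periodic_mono[OF periodic_disc m(2)]] units_disc[OF m(1) that(2)] by blast
  have inU: "?c a' b' = ?c a b" if "a' \<in> ?D a" "b' \<in> ?D b" for a b a' b'
  proof -
    have "nrm (of_nat a' - of_nat a :: 'k) \<le> pp m" "nrm (of_nat b' - of_nat b :: 'k) \<le> pp m"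
      using that unfolding reps_iff disc_iff[OF Zp_of_nat] by auto
    then show ?thesis using periodic_mult_iff[OF U] Zp_of_nat by metis
  qed
  have "conv_level M \<rho> \<sigma> U = (\<Sum>a\<in>?R. \<Sum>a'\<in>?D a. \<Sum>b\<in>?R. \<Sum>b'\<in>?D b. ?c a' b' * (\<rho> (disc M a') * \<sigma> (disc M b')))"
    unfolding conv_level_def sum_reps_refine[OF m(2) G] by (intro sum.cong refl) simp
  also have "\<dots> = (\<Sum>a\<in>?R. \<Sum>a'\<in>?D a. \<Sum>b\<in>?R. \<Sum>b'\<in>?D b. ?c a b * (\<rho> (disc M a') * \<sigma> (disc M b')))"
    by (intro sum.cong refl) (simp only: inU)
  also have "\<dots> = (\<Sum>a\<in>?R. \<Sum>b\<in>?R. \<Sum>a'\<in>?D a. \<Sum>b'\<in>?D b. ?c a b * (\<rho> (disc M a') * \<sigma> (disc M b')))"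
    by (intro sum.cong refl sum.swap)
  also have "\<dots> = (\<Sum>a\<in>?R. \<Sum>b\<in>?R. ?c a b * ((\<Sum>a'\<in>?D a. \<rho> (disc M a')) * (\<Sum>b'\<in>?D b. \<sigma> (disc M b'))))"
    unfolding sum_product by (simp only: sum_distrib_left)
  also have "\<dots> = (\<Sum>a\<in>?R. \<Sum>b\<in>?R. ?c a b * (\<rho> (disc m a) * \<sigma> (disc m b)))"
    by (intro sum.cong refl) (simp only: split[OF \<rho>] split[OF \<sigma>])
  also have "\<dots> = conv_level m \<rho> \<sigma> U"
    unfolding conv_level_def by (intro sum.cong refl) simp
  finally show ?thesis .
qed

lemma continuous_mult_Gp: "continuous_on (Gp \<times> Gp) (\<lambda>(x, y). x * y :: 'k)"
  unfolding continuous_on_iff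
proof (intro ballI allI impI)
  fix z :: "'k \<times> 'k" and e :: real assume z: "z \<in> Gp \<times> Gp" and "e > 0"
  obtain m where m: "pp m < e" using pp_less \<open>e > 0\<close> by blast
  have "dist (case w of (x, y) \<Rightarrow> x * y) (case z of (x, y) \<Rightarrow> x * y) < e"
    if "w \<in> Gp \<times> Gp" "dist w z < pp m" for w
  proof -
    obtain x y x' y' where e: "w = (x, y)" "z = (x', y')" by fastforce
    have "dist x x' < pp m" "dist y y' < pp m"
      using that(2) dist_fst_le[of w z] dist_snd_le[of w z] unfolding e by auto
    then have "nrm (x * y - x' * y') \<le> pp m"
      using that(1) z unfolding e dist_nrm[of x] dist_nrm[of y]
      by (intro mult_close) (auto simp: Gp_iff)
    then show ?thesis using m dist_nrm[of "x * y" "x' * y'"] unfolding e by simp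
  qed
  then show "\<exists>d>0. \<forall>x'\<in>Gp \<times> Gp. dist x' z < d \<longrightarrow>
      dist (case x' of (x, y) \<Rightarrow> x * y) (case z of (x, y) \<Rightarrow> x * y) < e"
    using pp_pos by blast
qed

text \<open>The limit in the definition of the product measure is that of an eventually constant
  sequence, and multiplication of units is continuous, so the preimage of \<open>U\<close> is open and closed.\<close>

lemma conv_eq_level:
  assumes \<rho>: "\<rho> \<in> bounded_measures Gp" and \<sigma>: "\<sigma> \<in> bounded_measures Gp"
    and U: "periodic m U" "U \<subseteq> Gp" and m: "1 \<le> m"
  shows "conv p \<rho> \<sigma> U = conv_level m \<rho> \<sigma> U"
proof -
  let ?W = "{z \<in> Gp \<times> Gp. (case z of (x, y) \<Rightarrow> x * y) \<in> U}"
  have U': "clopen Gp U" using clopen_periodicI[OF periodic_Gp U] .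
  have maps: "(\<lambda>(x, y). x * y) \<in> Gp \<times> Gp \<rightarrow> (Gp :: 'k set)" using Gp_mult by auto
  have pre: "openin (top_of_set (Gp \<times> Gp)) ((Gp \<times> Gp) \<inter> (\<lambda>(x, y). x * y :: 'k) -` V)"
    if "openin (top_of_set Gp) V" for V
    by (rule continuous_openin_preimage[OF continuous_mult_Gp _ that]) (use maps in auto)
  have "openin (top_of_set (Gp \<times> Gp)) ?W"
  proof -
    have "?W = (Gp \<times> Gp) \<inter> (\<lambda>(x, y). x * y) -` U" by auto
    then show ?thesis using pre[of U] U' unfolding clopen_def by simp
  qed
  moreover have "openin (top_of_set (Gp \<times> Gp)) (Gp \<times> Gp - ?W)"
  proof -
    have "Gp \<times> Gp - ?W = (Gp \<times> Gp) \<inter> (\<lambda>(x, y). x * y) -` (Gp - U)" using Gp_mult by auto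
    then show ?thesis using pre[of "Gp - U"] U' unfolding clopen_def closedin_def by simp
  qed
  ultimately have W: "clopen (Gp \<times> Gp) ?W" unfolding clopen_def closedin_def by auto
  let ?S = "\<lambda>M. \<Sum>a\<in>reps p M GG. \<Sum>b\<in>reps p M GG. if (of_nat a, of_nat b) \<in> ?W
     then \<rho> (Gp \<inter> disc M a) * \<sigma> (Gp \<inter> disc M b) else 0"
  have S: "?S M = conv_level m \<rho> \<sigma> U" if "M \<ge> m" for M
  proof -
    have "Gp \<inter> disc M a = disc M a" if "a \<in> reps p M GG" for a
      using units_disc(1)[OF _ that] m \<open>M \<ge> m\<close> by auto
    then have "?S M = conv_level M \<rho> \<sigma> U" unfolding conv_level_def
      by (intro sum.cong refl) (auto simp: reps_iff)
    then show ?thesis using conv_level_refine[OF \<rho> \<sigma> U(1) m that] by simp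
  qed
  have "?S \<longlonglongrightarrow> conv_level m \<rho> \<sigma> U"
    by (rule tendsto_eventually) (unfold eventually_sequentially, use S in blast)
  then have "lim ?S = conv_level m \<rho> \<sigma> U" by (rule limI)
  then show ?thesis unfolding conv_def pushforward_def prod_measure_def using U' W by simp
qed

lemma conv_not_clopen: "\<not> clopen Gp U \<Longrightarrow> conv p \<rho> \<sigma> U = (0::'k)"
  unfolding conv_def pushforward_def by simp

lemma clopen_GpE:
  assumes "clopen Gp U" obtains m where "1 \<le> m" "periodic m U" "U \<subseteq> Gp"
  using clopenE[OF assms periodic_Gp] by auto

lemma conv_bmeas:
  assumes \<rho>: "\<rho> \<in> bounded_measures Gp" and \<sigma>: "\<sigma> \<in> bounded_measures Gp"
  shows "conv p \<rho> \<sigma> \<in> bounded_measures (Gp::'k set)"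
proof -
  obtain A where A: "A \<ge> 0" "\<And>U. nrm (\<rho> U) \<le> A" using bmeas_bound[OF \<rho>] by blast
  obtain B where B: "B \<ge> 0" "\<And>U. nrm (\<sigma> U) \<le> B" using bmeas_bound[OF \<sigma>] by blast
  show ?thesis unfolding bounded_measures_def
  proof (intro CollectI conjI allI impI exI[of _ "A * B"])
    fix U V :: "'k set" assume "clopen Gp U" "clopen Gp V" and d: "U \<inter> V = {}"
    then obtain m1 m2 where "1 \<le> m1" "periodic m1 U" "1 \<le> m2" "periodic m2 V" and s: "U \<subseteq> Gp" "V \<subseteq> Gp"
      using clopen_GpE by metis
    then have m: "1 \<le> max m1 m2" and U: "periodic (max m1 m2) U" and V: "periodic (max m1 m2) V"
      using periodic_mono[OF _ max.cobounded1[of m1 m2]] periodic_mono[OF _ max.cobounded2[of m2 m1]]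
      by (simp_all add: le_max_iff_disj)
    have "U \<union> V \<subseteq> Gp" using s by blast
    note e = conv_eq_level[OF \<rho> \<sigma> U s(1) m] conv_eq_level[OF \<rho> \<sigma> V s(2) m]
      conv_eq_level[OF \<rho> \<sigma> periodic_Un[OF U V] this m]
    show "conv p \<rho> \<sigma> (U \<union> V) = conv p \<rho> \<sigma> U + conv p \<rho> \<sigma> V"
      unfolding e conv_level_def sum.distrib[symmetric] using d by (intro sum.cong refl) auto
  next
    fix U
    show "nrm (conv p \<rho> \<sigma> U) \<le> A * B"
    proof (cases "clopen Gp U")
      case True
      then obtain m where "1 \<le> m" "periodic m U" "U \<subseteq> Gp" using clopen_GpE by blast
      then have "conv p \<rho> \<sigma> U = conv_level m \<rho> \<sigma> U" by (intro conv_eq_level[OF \<rho> \<sigma>])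
      also have "nrm \<dots> \<le> A * B" unfolding conv_level_def
        using A B by (intro nrm_sum_le) (auto intro: nrm_mult_leI)
      finally show ?thesis .
    qed (use A B in \<open>simp add: conv_not_clopen\<close>)
  qed (rule conv_not_clopen)
qed

lemma conv_commute:
  assumes "\<rho> \<in> bounded_measures Gp" "\<sigma> \<in> bounded_measures Gp"
  shows "conv p \<rho> \<sigma> = conv p \<sigma> (\<rho> :: 'k set \<Rightarrow> 'k)"
proof
  fix U show "conv p \<rho> \<sigma> U = conv p \<sigma> \<rho> U"
  proof (cases "clopen Gp U")
    case True
    then obtain m where m: "1 \<le> m" "periodic m U" "U \<subseteq> Gp" using clopen_GpE by blast
    show ?thesis unfolding conv_eq_level[OF assms m(2,3,1)] conv_eq_level[OF assms(2,1) m(2,3,1)]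
      unfolding conv_level_def
      by (rule trans[OF sum.swap]) (intro sum.cong refl, simp add: mult.commute)
  qed (simp add: conv_not_clopen)
qed

lemma units_mod_nat_residue:
  assumes "m \<ge> 1" "a \<in> reps p m GG" "b \<in> reps p m GG"
  shows "(a * b) mod p ^ m \<in> reps p m GG"
proof -
  have "periodic m Gp" using periodic_mono[OF periodic_Gp] assms by simp
  from nat_residue_in_reps[OF this, of "of_nat a * of_nat b"] show ?thesis
    using assms nat_residue_of_nat[of m "a * b"] Gp_mult by (auto simp: reps_iff)
qed

text \<open>The rule for integrating against a convolution at a fixed level: the class of the
  product replaces the variable. Associativity and the multiplicativity of the Mellin transform both
  start from it.\<close>

lemma sum_conv_disc:
  assumes \<rho>: "\<rho> \<in> bounded_measures Gp" and \<sigma>: "\<sigma> \<in> bounded_measures Gp" and m: "1 \<le> m"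
  shows "(\<Sum>e\<in>reps p m GG. \<phi> e * conv p \<rho> \<sigma> (disc m e)) =
    (\<Sum>a\<in>reps p m GG. \<Sum>b\<in>reps p m GG. \<phi> ((a * b) mod p ^ m) * (\<rho> (disc m a) * \<sigma> (disc m b) :: 'k))"
proof -
  let ?R = "reps p m GG"
  let ?r = "\<lambda>a b. \<rho> (disc m a) * \<sigma> (disc m b)"
  have iff: "of_nat a * of_nat b \<in> disc m e \<longleftrightarrow> (a * b) mod p ^ m = e" if "e \<in> ?R" for a b e
    using mem_disc_iff[of e m "of_nat (a * b)"] nat_residue_of_nat[of m "a * b"] that by (simp add: reps_iff)
  have "(\<Sum>e\<in>?R. \<phi> e * conv p \<rho> \<sigma> (disc m e)) =
      (\<Sum>e\<in>?R. \<Sum>a\<in>?R. \<Sum>b\<in>?R. \<phi> e * (if (a * b) mod p ^ m = e then ?r a b else 0))"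
  proof (rule sum.cong[OF refl])
    fix e assume e: "e \<in> ?R"
    have "conv p \<rho> \<sigma> (disc m e) = (\<Sum>a\<in>?R. \<Sum>b\<in>?R. if (a * b) mod p ^ m = e then ?r a b else 0)"
      unfolding conv_eq_level[OF \<rho> \<sigma> periodic_disc units_disc(1)[OF m e] m] conv_level_def
      by (simp only: iff[OF e])
    then show "\<phi> e * conv p \<rho> \<sigma> (disc m e) =
      (\<Sum>a\<in>?R. \<Sum>b\<in>?R. \<phi> e * (if (a * b) mod p ^ m = e then ?r a b else 0))"
      by (simp only: sum_distrib_left)
  qed
  also have "\<dots> = (\<Sum>a\<in>?R. \<Sum>b\<in>?R. \<Sum>e\<in>?R. \<phi> e * (if (a * b) mod p ^ m = e then ?r a b else 0))"
    by (rule trans[OF sum.swap]) (intro sum.cong refl sum.swap)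
  also have "\<dots> = (\<Sum>a\<in>?R. \<Sum>b\<in>?R. \<phi> ((a * b) mod p ^ m) * ?r a b)"
  proof (intro sum.cong refl)
    fix a b assume "a \<in> ?R" "b \<in> ?R"
    then have in_R: "(a * b) mod p ^ m \<in> ?R" by (rule units_mod_nat_residue[OF m])
    have "(\<Sum>e\<in>?R. \<phi> e * (if (a * b) mod p ^ m = e then ?r a b else 0)) =
        (\<Sum>e\<in>?R. if e = (a * b) mod p ^ m then \<phi> e * ?r a b else 0)"
      by (intro sum.cong) auto
    then show "(\<Sum>e\<in>?R. \<phi> e * (if (a * b) mod p ^ m = e then ?r a b else 0)) =
        \<phi> ((a * b) mod p ^ m) * ?r a b"
      using in_R by (simp add: sum.delta)
  qed
  finally show ?thesis .
qed

text \<open>Both bracketings are the triple sum over \<open>(\<int>/p\<^sup>m)\<^sup>\<times>\<close> of the products whose total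
  product lies in \<open>U\<close>. One bracketing is computed, the other is reduced to it by commutativity.\<close>

lemma conv_assoc:
  assumes \<rho>: "\<rho> \<in> bounded_measures Gp" and \<sigma>: "\<sigma> \<in> bounded_measures Gp" and \<tau>: "\<tau> \<in> bounded_measures Gp"
  shows "conv p (conv p \<rho> \<sigma>) \<tau> = conv p \<rho> (conv p \<sigma> (\<tau> :: 'k set \<Rightarrow> 'k))"
proof
  fix U show "conv p (conv p \<rho> \<sigma>) \<tau> U = conv p \<rho> (conv p \<sigma> \<tau>) U"
  proof (cases "clopen Gp U")
    case True
    then obtain m where m: "1 \<le> m" "periodic m U" "U \<subseteq> Gp" using clopen_GpE by blast
    let ?R = "reps p m GG"
    have triple: "conv p (conv p \<alpha> \<beta>) \<gamma> U = (\<Sum>c\<in>?R. \<Sum>a\<in>?R. \<Sum>b\<in>?R.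
        if of_nat (a * b * c) \<in> U then \<alpha> (disc m a) * \<beta> (disc m b) * \<gamma> (disc m c) else 0)"
      if \<alpha>: "\<alpha> \<in> bounded_measures Gp" and \<beta>: "\<beta> \<in> bounded_measures Gp" and \<gamma>: "\<gamma> \<in> bounded_measures Gp"
      for \<alpha> \<beta> \<gamma> :: "'k set \<Rightarrow> 'k"
    proof -
      have "conv p (conv p \<alpha> \<beta>) \<gamma> U = (\<Sum>c\<in>?R. \<Sum>e\<in>?R.
          (if of_nat (e * c) \<in> U then \<gamma> (disc m c) else 0) * conv p \<alpha> \<beta> (disc m e))"
        unfolding conv_eq_level[OF conv_bmeas[OF \<alpha> \<beta>] \<gamma> m(2,3,1)] conv_level_def
        by (subst sum.swap) (auto intro!: sum.cong)
      also have "\<dots> = (\<Sum>c\<in>?R. \<Sum>a\<in>?R. \<Sum>b\<in>?R.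
        (if of_nat ((a * b) mod p ^ m * c) \<in> U then \<gamma> (disc m c) else 0) * (\<alpha> (disc m a) * \<beta> (disc m b)))"
        by (simp only: sum_conv_disc[OF \<alpha> \<beta> m(1)])
      also have "\<dots> = (\<Sum>c\<in>?R. \<Sum>a\<in>?R. \<Sum>b\<in>?R.
        if of_nat (a * b * c) \<in> U then \<alpha> (disc m a) * \<beta> (disc m b) * \<gamma> (disc m c) else 0)"
      proof (intro sum.cong refl)
        fix a b c
        have "of_nat ((a * b) mod p ^ m * c) \<in> U \<longleftrightarrow> of_nat (a * b * c) \<in> U"
          using mem_periodic_iff_nat_residue[OF m(2) Zp_of_nat, of "(a * b) mod p ^ m * c"]
            mem_periodic_iff_nat_residue[OF m(2) Zp_of_nat, of "a * b * c"]
          by (simp only: nat_residue_of_nat mod_mult_left_eq)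
        then show "(if of_nat ((a * b) mod p ^ m * c) \<in> U then \<gamma> (disc m c) else 0) * (\<alpha> (disc m a) * \<beta> (disc m b))
          = (if of_nat (a * b * c) \<in> U then \<alpha> (disc m a) * \<beta> (disc m b) * \<gamma> (disc m c) else 0)"
          by simp
      qed
      finally show ?thesis .
    qed
    have "conv p \<rho> (conv p \<sigma> \<tau>) U = (\<Sum>a\<in>?R. \<Sum>b\<in>?R. \<Sum>c\<in>?R.
        if of_nat (b * c * a) \<in> U then \<sigma> (disc m b) * \<tau> (disc m c) * \<rho> (disc m a) else 0)"
      unfolding conv_commute[OF \<rho> conv_bmeas[OF \<sigma> \<tau>]] by (rule triple[OF \<sigma> \<tau> \<rho>])
    also have "\<dots> = (\<Sum>a\<in>?R. \<Sum>c\<in>?R. \<Sum>b\<in>?R.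
        if of_nat (b * c * a) \<in> U then \<sigma> (disc m b) * \<tau> (disc m c) * \<rho> (disc m a) else 0)"
      by (intro sum.cong refl sum.swap)
    also have "\<dots> = (\<Sum>c\<in>?R. \<Sum>a\<in>?R. \<Sum>b\<in>?R.
        if of_nat (b * c * a) \<in> U then \<sigma> (disc m b) * \<tau> (disc m c) * \<rho> (disc m a) else 0)"
      by (rule sum.swap)
    also have "\<dots> = conv p (conv p \<rho> \<sigma>) \<tau> U"
      unfolding triple[OF \<rho> \<sigma> \<tau>]
      by (intro sum.cong refl) (simp add: mult_ac)
    finally show ?thesis by simp
  qed (simp add: conv_not_clopen)
qed

lemma dirac_bmeas: "dirac X x \<in> bounded_measures (X :: 'k set)"
  if "periodic n X"
  unfolding bounded_measures_def
proof (intro CollectI conjI allI impI exI[of _ 1])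
  fix U V :: "'k set" assume c: "clopen X U" "clopen X V" "U \<inter> V = {}"
  have "clopen X (U \<union> V)" using c unfolding clopen_def by (auto intro: closedin_Un)
  then show "dirac X x (U \<union> V) = dirac X x U + (dirac X x V :: 'k)" using c by (auto simp: dirac_def)
qed (auto simp: dirac_def nrm_1)

lemma periodic_mult_preimage:
  assumes U: "periodic m U" and m: "1 \<le> m" and x: "x \<in> Gp" shows "periodic m {y \<in> Gp. x * y \<in> U}"
  unfolding periodic_def
proof (intro conjI ballI impI)
  fix y z assume y: "y \<in> {y \<in> Gp. x * y \<in> U}" and z: "z \<in> Zp" "nrm (z - y) \<le> pp m"
  have zG: "z \<in> Gp" using periodicD[OF periodic_mono[OF periodic_Gp]] y z m by auto
  have "x * z \<in> U \<longleftrightarrow> x * y \<in> U"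
    using y z x pp_pos[of m] by (intro periodic_mult_iff[OF U]) (auto simp: Gp_Zp)
  then show "z \<in> {y \<in> Gp. x * y \<in> U}" using zG y by blast
qed (auto simp: Gp_Zp)

text \<open>Pushing forward along multiplication by \<open>x\<close> is convolution by the point mass at \<open>x\<close>, so that
  every statement on push-forwards becomes one on convolutions.\<close>

lemma conv_dirac:
  assumes \<rho>: "\<rho> \<in> bounded_measures Gp" and x: "x \<in> Gp"
  shows "conv p (dirac Gp x) \<rho> = pushforward Gp Gp (\<lambda>y. x * y) (\<rho> :: 'k set \<Rightarrow> 'k)"
proof
  fix U show "conv p (dirac Gp x) \<rho> U = pushforward Gp Gp (\<lambda>y. x * y) \<rho> U"
  proof (cases "clopen Gp U")
    case True
    then obtain m where m: "1 \<le> m" "periodic m U" "U \<subseteq> Gp" using clopen_GpE by blast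
    let ?R = "reps p m GG" and ?V = "{y \<in> Gp. x * y \<in> U}"
    have G: "periodic m Gp" using periodic_mono[OF periodic_Gp] m by simp
    have rx: "nat_residue m x \<in> ?R" using nat_residue_in_reps[OF G x] .
    note V = periodic_mult_preimage[OF m(2,1) x]
    have "conv p (dirac Gp x) \<rho> U = (\<Sum>b\<in>?R. \<Sum>a\<in>?R.
        if a = nat_residue m x then (if of_nat a * of_nat b \<in> U then \<rho> (disc m b) else 0) else 0)"
      unfolding conv_eq_level[OF dirac_bmeas[OF periodic_Gp] \<rho> m(2,3,1)] conv_level_def
    proof (subst sum.swap, intro sum.cong refl)
      fix a b assume "a \<in> ?R"
      then have "dirac Gp x (disc m a) = (if a = nat_residue m x then 1 else 0 :: 'k)"
        unfolding dirac_def using units_disc(2)[OF m(1)] mem_disc_iff[of a m x] Gp_Zp[OF x]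
        by (auto simp: reps_iff)
      then show "(if of_nat a * of_nat b \<in> U then dirac Gp x (disc m a) * \<rho> (disc m b) else 0) =
          (if a = nat_residue m x then (if of_nat a * of_nat b \<in> U then \<rho> (disc m b) else 0) else 0)"
        by (cases "a = nat_residue m x") simp_all
    qed
    also have "\<dots> = (\<Sum>b\<in>?R. if of_nat (nat_residue m x) * of_nat b \<in> U then \<rho> (disc m b) else 0)"
      using rx by (simp add: sum.delta)
    also have "\<dots> = (\<Sum>b\<in>?R. if of_nat b \<in> ?V then \<rho> (disc m b) else 0)"
    proof (intro sum.cong refl)
      fix b assume "b \<in> ?R"
      then have "of_nat b \<in> (Gp::'k set)" by (simp add: reps_iff)
      moreover have "of_nat (nat_residue m x) * of_nat b \<in> U \<longleftrightarrow> x * of_nat b \<in> U"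
        using nat_residue(2)[OF Gp_Zp[OF x], of m] pp_pos[of m] nrm_minus_commute[of x]
        by (intro periodic_mult_iff[OF m(2)]) (auto simp: Gp_Zp x)
      ultimately show "(if of_nat (nat_residue m x) * of_nat b \<in> U then \<rho> (disc m b) else 0) =
          (if of_nat b \<in> ?V then \<rho> (disc m b) else 0)" by simp
    qed
    also have "\<dots> = (\<Sum>b\<in>reps p m ?V. \<rho> (disc m b))"
      by (intro sum.mono_neutral_cong_right) (auto simp: reps_iff)
    also have "\<dots> = \<rho> ?V" using bmeas_decomp[OF \<rho> periodic_Gp V] by auto
    finally show ?thesis using True unfolding pushforward_def by simp
  next
    case False
    then show ?thesis by (simp add: conv_not_clopen pushforward_def)
  qed
qed

lemma conv_one:
  assumes \<rho>: "\<rho> \<in> bounded_measures Gp" shows "conv p (dirac Gp 1) \<rho> = (\<rho> :: 'k set \<Rightarrow> 'k)"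
proof
  fix U :: "'k set"
  have "clopen Gp U \<Longrightarrow> {y \<in> Gp. 1 * y \<in> U} = U" unfolding clopen_def
    by (auto dest: openin_imp_subset)
  then show "conv p (dirac Gp 1) \<rho> U = \<rho> U"
    unfolding conv_dirac[OF \<rho> Gp_1] pushforward_def using bmeas_not_clopen[OF \<rho>] by auto
qed

lemma bmeas_lincomb:
  fixes F :: "'i \<Rightarrow> 'k set \<Rightarrow> 'k"
  assumes "periodic n X" "finite I" "\<And>i. i \<in> I \<Longrightarrow> F i \<in> bounded_measures X"
  shows "(\<lambda>U. \<Sum>i\<in>I. c i * F i U) \<in> bounded_measures X"
proof -
  have "\<exists>B. \<forall>i\<in>I. \<forall>U. nrm (c i * F i U) \<le> B" using assms(2,3)
  proof (induction I)
    case (insert i I)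
    then obtain B where B: "\<forall>i\<in>I. \<forall>U. nrm (c i * F i U) \<le> B" by auto
    obtain A where A: "\<And>U. nrm (F i U) \<le> A" using bmeas_bound insert.prems by blast
    have "nrm (c i * F i U) \<le> nrm (c i) * A" for U
      unfolding nrm_mult using A by (intro mult_left_mono) auto
    then have "\<forall>j\<in>insert i I. \<forall>U. nrm (c j * F j U) \<le> max (nrm (c i) * A) B"
      using B by (auto simp: le_max_iff_disj)
    then show ?case by blast
  qed simp
  then obtain B where B: "\<And>i U. i \<in> I \<Longrightarrow> nrm (c i * F i U) \<le> B" by blast
  show ?thesis unfolding bounded_measures_def
  proof (intro CollectI conjI allI impI exI[of _ "max 0 B"])
    fix U show "nrm (\<Sum>i\<in>I. c i * F i U) \<le> max 0 B"
      using B by (intro nrm_sum_le) (auto simp: le_max_iff_disj)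
  next
    fix U V :: "'k set" assume "clopen X U" "clopen X V" "U \<inter> V = {}"
    then show "(\<Sum>i\<in>I. c i * F i (U \<union> V)) = (\<Sum>i\<in>I. c i * F i U) + (\<Sum>i\<in>I. c i * F i V)"
      using bmeas_additive[OF assms(3)] by (simp add: sum.distrib[symmetric] distrib_left)
  next
    fix U :: "'k set" assume "\<not> clopen X U"
    then show "(\<Sum>i\<in>I. c i * F i U) = 0" using bmeas_not_clopen[OF assms(3)] by simp
  qed
qed

lemma r_meas_bmeas: "(r_meas c :: 'k set \<Rightarrow> 'k) \<in> bounded_measures Gp"
proof -
  have "(\<lambda>U. \<Sum>i\<in>{0,1::nat}. (if i = 0 then 1 else - of_nat c) * (if i = 0 then dirac Gp 1 else dirac Gp (of_nat c)) U)
      \<in> bounded_measures (Gp::'k set)"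
    by (rule bmeas_lincomb[OF periodic_Gp]) (use dirac_bmeas[OF periodic_Gp] in auto)
  moreover have "(r_meas c :: 'k set \<Rightarrow> 'k) =
    (\<lambda>U. \<Sum>i\<in>{0,1::nat}. (if i = 0 then 1 else - of_nat c) * (if i = 0 then dirac Gp 1 else dirac Gp (of_nat c)) U)"
    by (auto simp: r_meas_def)
  ultimately show ?thesis by simp
qed

text \<open>Fractions are compared and multiplied through the convolution product, whose laws are
  recorded here in the form in which the lemmas on fractions expect them.\<close>

lemma Lambda_comm_monoid: "comm_monoid (Lambda p :: ('k set \<Rightarrow> 'k) ring)"
  by (rule comm_monoidI)
    (auto simp: Lambda_def conv_bmeas conv_assoc conv_one dirac_bmeas[OF periodic_Gp] intro: conv_commute)

lemma Sigma_r_bmeas: "\<rho> \<in> Sigma_r p \<Longrightarrow> \<rho> \<in> bounded_measures (Gp :: 'k set)"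
  by (induction rule: Sigma_r.induct) (auto intro: conv_bmeas r_meas_bmeas dirac_bmeas[OF periodic_Gp])

lemma Sigma_r_conv:
  "\<rho> \<in> Sigma_r p \<Longrightarrow> \<sigma> \<in> Sigma_r p \<Longrightarrow> conv p \<rho> \<sigma> \<in> (Sigma_r p :: ('k set \<Rightarrow> 'k) set)"
  by (induction rule: Sigma_r.induct)
    (auto simp: conv_one Sigma_r_bmeas conv_assoc r_meas_bmeas intro: Sigma_r.intros)

lemma r_meas_Sigma: "odd c \<Longrightarrow> 1 < c \<Longrightarrow> coprime c p \<Longrightarrow> r_meas c \<in> (Sigma_r p :: ('k set \<Rightarrow> 'k) set)"
proof -
  assume c: "odd c" "1 < c" "coprime c p"
  have "conv p (r_meas c) (dirac GG 1) \<in> (Sigma_r p :: ('k set \<Rightarrow> 'k) set)"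
    using Sigma_r.mult[OF Sigma_r.one c] .
  moreover have "conv p (r_meas c) (dirac GG 1) = (r_meas c :: 'k set \<Rightarrow> 'k)"
    using conv_commute[OF r_meas_bmeas dirac_bmeas[OF periodic_Gp]] conv_one[OF r_meas_bmeas] by metis
  ultimately show ?thesis by simp
qed

end

section \<open>Fractions\<close>

text \<open>Equality of fractions is transitive; the classes may be represented by any of their
  members.\<close>

lemma ring_frac_eqI:
  fixes R (structure)
  assumes "comm_monoid R" and S: "S \<subseteq> carrier R" "\<And>s t. s \<in> S \<Longrightarrow> t \<in> S \<Longrightarrow> s \<otimes> t \<in> S"
    and a: "a \<in> carrier R" "s \<in> S" and b: "(b, t) \<in> ring_frac R S a s"
  shows "ring_frac R S b t = ring_frac R S a s"
proof -
  interpret comm_monoid R by fact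
  have trans: "(e, u) \<in> ring_frac R S c v"
    if h: "(e, u) \<in> ring_frac R S d w" "(d, w) \<in> ring_frac R S c v" "c \<in> carrier R" "v \<in> S"
    for c v d w e u
  proof -
    obtain x y where x: "x \<in> S" "x \<otimes> (e \<otimes> w) = x \<otimes> (d \<otimes> u)" and y: "y \<in> S" "y \<otimes> (d \<otimes> v) = y \<otimes> (c \<otimes> w)"
      and c: "e \<in> carrier R" "u \<in> S" "d \<in> carrier R" "w \<in> S"
      using h unfolding ring_frac_def by blast
    note car = c h(3,4) x(1) y(1) subsetD[OF S(1)]
    have "(x \<otimes> y \<otimes> w) \<otimes> (e \<otimes> v) = (y \<otimes> v) \<otimes> (x \<otimes> (e \<otimes> w))" using car by (simp add: m_ac)
    also have "\<dots> = (x \<otimes> u) \<otimes> (y \<otimes> (d \<otimes> v))" unfolding x(2) using car by (simp add: m_ac)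
    also have "\<dots> = (x \<otimes> y \<otimes> w) \<otimes> (c \<otimes> u)" unfolding y(2) using car by (simp add: m_ac)
    finally have "\<exists>z\<in>S. z \<otimes> (e \<otimes> v) = z \<otimes> (c \<otimes> u)"
      using S(2)[OF S(2)[OF x(1) y(1)] c(4)] by (rule bexI)
    then show ?thesis unfolding ring_frac_def using c(1,2) by simp
  qed
  have sym: "(a, s) \<in> ring_frac R S b t"
    using b a unfolding ring_frac_def by (auto intro: sym)
  have "b \<in> carrier R" "t \<in> S" using b unfolding ring_frac_def by auto
  then have "x \<in> ring_frac R S b t \<longleftrightarrow> x \<in> ring_frac R S a s" for x
    using trans[OF _ b a, of "fst x" "snd x"] trans[OF _ sym, of "fst x" "snd x"] unfolding prod.collapse by blast
  then show ?thesis by blast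
qed

lemma ring_frac_self:
  fixes R (structure)
  assumes "comm_monoid R" "S \<subseteq> carrier R" "a \<in> carrier R" "s \<in> S"
  shows "(a, s) \<in> ring_frac R S a s"
  using assms unfolding ring_frac_def by auto

text \<open>The product of two classes is a union over all pairs of representatives, which
  collapses because every pair gives the same class.\<close>

lemma localization_mult:
  fixes R (structure)
  assumes R: "comm_monoid R" and S: "S \<subseteq> carrier R" "\<And>s t. s \<in> S \<Longrightarrow> t \<in> S \<Longrightarrow> s \<otimes> t \<in> S"
    and a: "a \<in> carrier R" "s \<in> S" and b: "b \<in> carrier R" "t \<in> S"
  shows "ring_frac R S a s \<otimes>\<^bsub>localization R S\<^esub> ring_frac R S b t = ring_frac R S (a \<otimes> b) (s \<otimes> t)"
proof -
  interpret comm_monoid R by fact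
  have eq: "ring_frac R S (a' \<otimes> b') (s' \<otimes> t') = ring_frac R S (a \<otimes> b) (s \<otimes> t)"
    if a': "(a', s') \<in> ring_frac R S a s" and b': "(b', t') \<in> ring_frac R S b t" for a' s' b' t'
  proof (rule ring_frac_eqI[OF R S])
    obtain x y where x: "x \<in> S" "x \<otimes> (a' \<otimes> s) = x \<otimes> (a \<otimes> s')" and y: "y \<in> S" "y \<otimes> (b' \<otimes> t) = y \<otimes> (b \<otimes> t')"
      and c: "a' \<in> carrier R" "s' \<in> S" "b' \<in> carrier R" "t' \<in> S"
      using a' b' unfolding ring_frac_def by blast
    note car = c a b x(1) y(1) subsetD[OF S(1)]
    have "(x \<otimes> y) \<otimes> ((a' \<otimes> b') \<otimes> (s \<otimes> t)) = (x \<otimes> (a' \<otimes> s)) \<otimes> (y \<otimes> (b' \<otimes> t))"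
      using car by (simp add: m_ac)
    also have "\<dots> = (x \<otimes> y) \<otimes> ((a \<otimes> b) \<otimes> (s' \<otimes> t'))"
      unfolding x(2) y(2) using car by (simp add: m_ac)
    finally have "\<exists>z\<in>S. z \<otimes> ((a' \<otimes> b') \<otimes> (s \<otimes> t)) = z \<otimes> ((a \<otimes> b) \<otimes> (s' \<otimes> t'))"
      using S(2)[OF x(1) y(1)] by (rule bexI)
    then show "(a' \<otimes> b', s' \<otimes> t') \<in> ring_frac R S (a \<otimes> b) (s \<otimes> t)"
      unfolding ring_frac_def using c S(2) by simp
  qed (use a b S in auto)
  have "ring_frac R S a s \<otimes>\<^bsub>localization R S\<^esub> ring_frac R S b t =
      (\<Union>x\<in>ring_frac R S a s. \<Union>y\<in>ring_frac R S b t. ring_frac R S (fst x \<otimes> fst y) (snd x \<otimes> snd y))"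
    by (simp add: localization_def case_prod_beta)
  also have "\<dots> = (\<Union>x\<in>ring_frac R S a s. \<Union>y\<in>ring_frac R S b t. ring_frac R S (a \<otimes> b) (s \<otimes> t))"
    by (intro SUP_cong refl eq) simp_all
  also have "\<dots> = ring_frac R S (a \<otimes> b) (s \<otimes> t)"
    using ring_frac_self[OF R S(1) a] ring_frac_self[OF R S(1) b] by blast
  finally show ?thesis .
qed

text \<open>If \<open>a/s = (l n)/r\<close> and \<open>b/t = l/r\<close>, then \<open>a/s = n b/t\<close>: the common denominator \<open>r\<close>
  can be cancelled before transforms are taken, which matters because its transform may vanish.\<close>

lemma ring_frac_cross:
  fixes R (structure)
  assumes R: "comm_monoid R" and S: "S \<subseteq> carrier R" "\<And>s t. s \<in> S \<Longrightarrow> t \<in> S \<Longrightarrow> s \<otimes> t \<in> S"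
    and car: "l \<in> carrier R" "n \<in> carrier R" "r \<in> S"
    and A: "(a, s) \<in> ring_frac R S (l \<otimes> n) r" and B: "(b, t) \<in> ring_frac R S l r"
  shows "\<exists>x\<in>S. x \<otimes> (a \<otimes> t) = x \<otimes> ((b \<otimes> n) \<otimes> s)"
proof -
  interpret comm_monoid R by fact
  obtain w where w: "w \<in> S" "w \<otimes> (a \<otimes> r) = w \<otimes> ((l \<otimes> n) \<otimes> s)" and as: "a \<in> carrier R" "s \<in> S"
    using A unfolding ring_frac_def by blast
  obtain v where v: "v \<in> S" "v \<otimes> (b \<otimes> r) = v \<otimes> (l \<otimes> t)" and bt: "b \<in> carrier R" "t \<in> S"
    using B unfolding ring_frac_def by blast
  note c = w(1) v(1) as bt car subsetD[OF S(1)]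
  have "(w \<otimes> v \<otimes> r) \<otimes> (a \<otimes> t) = (v \<otimes> t) \<otimes> (w \<otimes> (a \<otimes> r))" using c by (simp add: m_ac)
  also have "\<dots> = (w \<otimes> n \<otimes> s) \<otimes> (v \<otimes> (l \<otimes> t))" unfolding w(2) using c by (simp add: m_ac)
  also have "\<dots> = (w \<otimes> v \<otimes> r) \<otimes> ((b \<otimes> n) \<otimes> s)" unfolding v(2)[symmetric] using c by (simp add: m_ac)
  finally show ?thesis using S(2)[OF S(2)[OF w(1) v(1)] car(3)] by blast
qed

lemma ring_frac_mult_num:
  fixes R (structure)
  assumes R: "comm_monoid R" and S: "S \<subseteq> carrier R"
    and car: "l \<in> carrier R" "n \<in> carrier R" "r \<in> S" and B: "(b, t) \<in> ring_frac R S l r"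
  shows "(b \<otimes> n, t) \<in> ring_frac R S (l \<otimes> n) r"
proof -
  interpret comm_monoid R by fact
  obtain v where v: "v \<in> S" "v \<otimes> (b \<otimes> r) = v \<otimes> (l \<otimes> t)" and bt: "b \<in> carrier R" "t \<in> S"
    using B unfolding ring_frac_def by blast
  note c = v(1) bt car subsetD[OF S(1)]
  have "v \<otimes> ((b \<otimes> n) \<otimes> r) = n \<otimes> (v \<otimes> (b \<otimes> r))" using c by (simp add: m_ac)
  also have "\<dots> = v \<otimes> ((l \<otimes> n) \<otimes> t)" unfolding v(2) using c by (simp add: m_ac)
  finally have "\<exists>w\<in>S. w \<otimes> ((b \<otimes> n) \<otimes> r) = w \<otimes> ((l \<otimes> n) \<otimes> t)" using v(1) by (rule bexI)
  then show ?thesis unfolding ring_frac_def using bt car by simp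
qed

section \<open>Teichmueller representatives\<close>

context padic_ext begin

lemma power_diff_le:
  assumes x: "nrm x \<le> 1" and y: "nrm y \<le> 1" shows "nrm (x ^ n - y ^ n :: 'k) \<le> nrm (x - y)"
proof (induction n)
  case (Suc n)
  have e: "x ^ Suc n - y ^ Suc n = x * (x ^ n - y ^ n) + y ^ n * (x - y)"
    by (simp add: algebra_simps)
  have "nrm (y ^ n) \<le> 1" using y by (simp add: nrm_power power_le_one)
  then show ?case unfolding e by (intro nrm_add_leI nrm_mult_leI1 x Suc) simp_all
qed simp

text \<open>The sum is \<open>(x\<^sup>n - y\<^sup>n)/(x - y)\<close>, which is close to the derivative \<open>n y\<^bsup>n-1\<^esup>\<close> when \<open>x\<close>
  and \<open>y\<close> are close. The contraction of the \<open>p\<close>-th power, the uniqueness of Teichmueller representatives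
  and the value of \<open>\<bar>1 - z\<bar>\<close> for roots of unity all come from comparing it with \<open>n\<close>.\<close>

lemma power_quotient_close:
  assumes x: "nrm x \<le> 1" and y: "nrm y \<le> 1" and B: "nrm (x - y) \<le> B"
  shows "nrm ((\<Sum>i<n. y ^ (n - Suc i) * x ^ i) - of_nat n * y ^ (n - 1) :: 'k) \<le> B"
proof -
  have "of_nat n * y ^ (n - 1) = (\<Sum>i<n. y ^ (n - Suc i) * y ^ i)"
    by (simp add: power_add[symmetric])
  then have "(\<Sum>i<n. y ^ (n - Suc i) * x ^ i) - of_nat n * y ^ (n - 1)
      = (\<Sum>i<n. y ^ (n - Suc i) * (x ^ i - y ^ i))"
    by (simp add: sum_subtractf right_diff_distrib)
  also have "nrm \<dots> \<le> B"
  proof (intro nrm_sum_le nrm_mult_leI1)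
    show "nrm (y ^ (n - Suc i)) \<le> 1" for i using y by (simp add: nrm_power power_le_one)
    show "nrm (x ^ i - y ^ i) \<le> B" for i using power_diff_le[OF x y, of i] B by linarith
    show "0 \<le> B" using order_trans[OF zero_le_dist B] .
  qed
  finally show ?thesis .
qed

text \<open>Raising to the \<open>p\<close>-th power gains one digit of precision, since the quotient
  \<open>(x\<^sup>p - y\<^sup>p)/(x - y)\<close> is congruent to \<open>p y\<^bsup>p-1\<^esup>\<close> and hence divisible by \<open>p\<close>.\<close>

lemma power_p_close:
  assumes "x \<in> Zp" "y \<in> Zp" "nrm (x - y) \<le> pp (Suc k)"
  shows "nrm (x ^ p - y ^ p :: 'k) \<le> pp (Suc (Suc k))"
proof -
  let ?S = "\<Sum>i<p. y ^ (p - Suc i) * x ^ i"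
  have "nrm (x - y) \<le> pp 1" using assms(3) pp_antimono[of 1 "Suc k"] by linarith
  then have "nrm (?S - of_nat p * y ^ (p - 1)) \<le> pp 1" by (rule power_quotient_close[OF assms(1,2)[THEN Zp_nrm_le]])
  moreover have "nrm (of_nat p * y ^ (p - 1)) \<le> pp 1 * 1"
    using assms by (intro nrm_mult_leI Zp_nrm_le) (auto simp: nrm_p)
  ultimately have S: "nrm ?S \<le> pp 1"
    using nrm_add_leI[of "?S - of_nat p * y ^ (p - 1)" "pp 1" "of_nat p * y ^ (p - 1)"] by simp
  have "x ^ p - y ^ p = (x - y) * ?S" by (simp add: power_diff_sumr2)
  then have "nrm (x ^ p - y ^ p) \<le> pp (Suc k) * pp 1" using nrm_mult_leI[OF assms(3) S] by simp
  then show ?thesis by (simp add: mult.commute)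
qed

lemma power_p_power_close:
  assumes "x \<in> Zp" "y \<in> Zp" "nrm (x - y) \<le> pp (Suc k)"
  shows "nrm (x ^ (p ^ n) - y ^ (p ^ n) :: 'k) \<le> pp (Suc (n + k))"
proof (induction n)
  case (Suc n)
  have "nrm ((x ^ (p ^ n)) ^ p - (y ^ (p ^ n)) ^ p) \<le> pp (Suc (Suc (n + k)))"
    using Suc assms by (intro power_p_close) auto
  then show ?case by (simp add: power_mult[symmetric] mult.commute)
qed (use assms in simp)

lemma power_p_cong: assumes "x \<in> Zp" shows "nrm (x ^ p - x :: 'k) \<le> pp 1"
proof -
  obtain a where a: "nrm (x - of_nat a) \<le> pp 1" using Zp_nat_approx[OF assms] by blast
  have "[a ^ p = a] (mod p)"
  proof (cases "p dvd a")
    case True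
    then have "p dvd a ^ p" using p_gt_1 by (intro dvd_power_le[of p a 1, simplified]) auto
    then show ?thesis using True by (simp add: cong_def)
  next
    case False
    then have "[a * a ^ (p - 1) = a * 1] (mod p)"
      using fermat_theorem[OF prime_p] by (intro cong_scalar_left)
    then show ?thesis using p_gt_1 by (simp add: power_eq_if)
  qed
  then have "nrm (of_nat (a ^ p) - of_nat a :: 'k) \<le> pp 1"
    using nrm_nat_diff_le_iff[of "a ^ p" a 1] by simp
  moreover have "nrm (x ^ p - of_nat a ^ p) \<le> pp 1"
    using power_diff_le[OF assms[THEN Zp_nrm_le] nrm_of_nat_le, of p a] a by linarith
  ultimately have "nrm (x ^ p - of_nat a) \<le> pp 1" using nrm_trans_le by (metis of_nat_power)
  then show ?thesis using nrm_trans_le a nrm_minus_commute by metis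
qed

lemma root_unity_Gp: assumes "w \<in> Zp" "w ^ (p - 1) = 1" shows "w \<in> (Gp::'k set)"
proof -
  have "nrm w ^ (p - 1) = 1" using assms(2) nrm_power[of w "p - 1"] nrm_1 by simp
  then have "nrm w = 1" using p_gt_1 power_eq_1_iff[of "nrm w" "p - 1"] by simp
  then show ?thesis using assms by (simp add: Gp_iff)
qed

text \<open>If \<open>w\<close> and \<open>v\<close> are congruent, the quotient \<open>(w\<^bsup>p-1\<^esup> - v\<^bsup>p-1\<^esup>)/(w - v)\<close> is congruent to
  \<open>(p - 1) v\<^bsup>p-2\<^esup>\<close>, a unit, while its product with \<open>w - v\<close> is zero.\<close>

lemma root_unity_close_eq:
  assumes w: "w \<in> Zp" "w ^ (p - 1) = 1" and v: "v \<in> Zp" "v ^ (p - 1) = 1" and c: "nrm (w - v :: 'k) \<le> pp 1"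
  shows "w = v"
proof -
  let ?n = "p - 1"
  let ?S = "\<Sum>i<?n. v ^ (?n - Suc i) * w ^ i"
  have z: "(w - v) * ?S = 0" using w v power_diff_sumr2[of w ?n v] by simp
  have "nrm (of_nat ?n * v ^ (?n - 1)) = 1"
  proof -
    have "\<not> p dvd ?n" using p_gt_1 by (auto dest: dvd_imp_le)
    then show ?thesis using root_unity_Gp[OF v] nrm_of_nat_unit_iff[of ?n]
      unfolding nrm_mult nrm_power Gp_iff by simp
  qed
  moreover have "nrm (?S - of_nat ?n * v ^ (?n - 1)) \<le> pp 1" by (rule power_quotient_close[OF w(1)[THEN Zp_nrm_le] v(1)[THEN Zp_nrm_le] c])
  ultimately have "nrm ?S = 1"
    using nrm_eq_of_close[of ?S "of_nat ?n * v ^ (?n - 1)"] pp_Suc_less_1[of 0] by simp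
  then have "?S \<noteq> 0" by force
  then show ?thesis using z by simp
qed

text \<open>The Teichmueller representative is the limit of \<open>x ^ (p ^ n)\<close>. Consecutive terms agree
  to \<open>n + 1\<close> digits by Fermat's little theorem and the contraction of the \<open>p\<close>-th power, and the limit is
  fixed by the \<open>p\<close>-th power.\<close>

lemma teich_limit_exists:
  assumes x: "x \<in> (Gp::'k set)"
  shows "\<exists>w\<in>Zp. w ^ (p - 1) = 1 \<and> nrm (x - w) \<le> pp 1"
proof -
  note xZ = Gp_Zp[OF x]
  let ?X = "\<lambda>n. x ^ (p ^ n)"
  have step: "nrm (?X (Suc n) - ?X n) \<le> pp (Suc n)" for n
    using power_p_power_close[of "x ^ p" x 0 n] power_p_cong[OF xZ] xZ
    by (simp add: power_mult[symmetric] mult.commute)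
  have dist: "nrm (?X m - ?X n) \<le> pp (Suc n)" if "m \<ge> n" for m n
    using that
  proof (induction m rule: nat_induct_at_least)
    case (Suc m)
    then show ?case using nrm_trans_le[of "?X (Suc m)" "?X m" "pp (Suc n)" "?X n"] step[of m]
      pp_antimono[of "Suc n" "Suc m"] by linarith
  qed (use pp_pos[of "Suc n"] in simp)
  have "convergent ?X"
  proof (rule k_convergentI)
    fix e :: real assume "e > 0"
    then obtain n where "pp n < e" using pp_less by blast
    then have "\<forall>m\<ge>n. nrm (?X m - ?X n) \<le> e"
      using dist[of n] pp_antimono[of n "Suc n"] by (meson le_SucI less_imp_le order_refl order_trans)
    then show "\<exists>m0. \<forall>m\<ge>m0. nrm (?X m - ?X m0) \<le> e" by blast
  qed
  then obtain w where w: "?X \<longlonglongrightarrow> w" unfolding convergent_def by blast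
  have wZ: "w \<in> Zp" using Zp_LIMSEQ[OF w] xZ by simp
  have "(\<lambda>n. ?X n - x) \<longlonglongrightarrow> w - x" using k_tendsto_diff[OF w tendsto_const] .
  then have close: "nrm (w - x) \<le> pp 1"
    by (rule nrm_limit_le) (use dist[of 0] in simp)
  have "(\<lambda>n. ?X n ^ p) \<longlonglongrightarrow> w" using LIMSEQ_Suc[OF w] by (simp add: power_mult[symmetric] mult.commute)
  then have wp: "w ^ p = w" using LIMSEQ_unique k_tendsto_power[OF w] by blast
  have "nrm w = nrm x" using close nrm_eq_of_close[of w x] x pp_Suc_less_1[of 0] by (simp add: Gp_iff)
  then have "w \<noteq> 0" using x by (auto simp: Gp_iff)
  then have "w ^ (p - 1) = 1" using wp p_gt_1 by (simp add: power_eq_if[of w p])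
  then show ?thesis using wZ close nrm_minus_commute[of x w] by (intro bexI[of _ w]) auto
qed

lemma disc_1_div_iff:
  assumes "x \<in> Gp" "w \<in> Gp" shows "x / w \<in> residue_disc p 1 1 \<longleftrightarrow> nrm (x - w :: 'k) \<le> pp 1"
proof -
  have "w \<noteq> 0" using assms by (auto simp: Gp_iff)
  then have "x / w - 1 = (x - w) / w" by (simp add: field_simps)
  then have "nrm (x / w - 1) = nrm (x - w)" using assms by (simp add: nrm_divide Gp_iff)
  moreover have "x / w \<in> Zp" using assms Gp_inverse[of w] by (simp add: divide_inverse Gp_Zp)
  ultimately show ?thesis using disc_iff[OF Zp_1] by simp
qed

lemma teich_eqI:
  assumes x: "x \<in> (Gp::'k set)" and w: "w \<in> Zp" "w ^ (p - 1) = 1" "nrm (x - w) \<le> pp 1"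
  shows "teich p x = w"
  unfolding teich_def
proof (rule the_equality)
  show "w \<in> Zp \<and> w ^ (p - 1) = 1 \<and> x / w \<in> residue_disc p 1 1"
    using w disc_1_div_iff[OF x root_unity_Gp[OF w(1,2)]] by blast
  fix v assume v: "v \<in> Zp \<and> v ^ (p - 1) = 1 \<and> x / v \<in> residue_disc p 1 1"
  then have "nrm (x - v) \<le> pp 1" using disc_1_div_iff[OF x root_unity_Gp[of v]] by blast
  then have "nrm (v - w) \<le> pp 1" using nrm_trans_le[of v x] w(3) nrm_minus_commute[of x v] by simp
  then show "v = w" using root_unity_close_eq v w by blast
qed

lemma teich:
  assumes x: "x \<in> (Gp::'k set)"
  shows "teich p x \<in> Gp" "teich p x ^ (p - 1) = 1" "nrm (x - teich p x) \<le> pp 1"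
proof -
  obtain w where w: "w \<in> Zp" "w ^ (p - 1) = 1" "nrm (x - w) \<le> pp 1" using teich_limit_exists[OF x] by blast
  then show "teich p x \<in> Gp" "teich p x ^ (p - 1) = 1" "nrm (x - teich p x) \<le> pp 1"
    unfolding teich_eqI[OF x w] using root_unity_Gp by blast+
qed

lemma teich_mult:
  assumes "x \<in> Gp" "y \<in> (Gp::'k set)" shows "teich p (x * y) = teich p x * teich p y"
  using assms teich[of x] teich[of y]
  by (intro teich_eqI Gp_mult Zp_mult mult_close) (auto simp: power_mult_distrib Gp_Zp)

lemma teich_cong:
  assumes "x \<in> Gp" "y \<in> (Gp::'k set)" "nrm (x - y) \<le> pp 1" shows "teich p x = teich p y"
  using assms teich[of y] nrm_trans_le[OF assms(3), of "teich p y"]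
  by (intro teich_eqI) (auto simp: Gp_Zp)

lemma teich_nz: "x \<in> Gp \<Longrightarrow> teich p x \<noteq> (0::'k)"
  using teich(1)[of x] by (auto simp: Gp_iff)

definition principal_units :: "'k set" where "principal_units = {y \<in> Zp. nrm (y - 1) \<le> pp 1}"

lemma one_unit_principal: "x \<in> Gp \<Longrightarrow> one_unit p x \<in> principal_units"
  using disc_1_div_iff[of x "teich p x"] teich[of x] disc_iff[OF Zp_1, of "x / teich p x" 1]
  unfolding one_unit_def principal_units_def by simp

lemma one_unit_mult: "x \<in> Gp \<Longrightarrow> y \<in> Gp \<Longrightarrow> one_unit p (x * y) = one_unit p x * (one_unit p y :: 'k)"
  unfolding one_unit_def by (simp add: teich_mult)

text \<open>Congruent units have the same Teichmueller representative, which has absolute value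
  \<open>1\<close>; so dividing by it is an isometry on each residue class modulo \<open>p\<close>.\<close>

lemma one_unit_close:
  assumes "x \<in> Gp" "y \<in> Gp" "nrm (x - y :: 'k) \<le> pp 1" shows "nrm (one_unit p x - one_unit p y) = nrm (x - y)"
  using teich(1)[OF assms(2)] unfolding one_unit_def teich_cong[OF assms] diff_divide_distrib[symmetric]
  by (simp add: nrm_divide Gp_iff)

section \<open>p-adic powers of principal units\<close>

lemma k_tendsto_prod:
  "(\<And>i. i \<in> A \<Longrightarrow> (X i \<longlongrightarrow> (a i::'k)) F) \<Longrightarrow> ((\<lambda>n. \<Prod>i\<in>A. X i n) \<longlongrightarrow> (\<Prod>i\<in>A. a i)) F"
  by (induction A rule: infinite_finite_induct) (auto intro: k_tendsto_mult)

lemma k_tendsto_gbinomial: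
  assumes "(X \<longlongrightarrow> (a::'k)) F" shows "((\<lambda>m. X m gchoose n) \<longlongrightarrow> a gchoose n) F"
proof -
  have "((\<lambda>m. inverse (fact n) * (\<Prod>i\<in>{0..<n}. X m - of_nat i)) \<longlongrightarrow>
      inverse (fact n) * (\<Prod>i\<in>{0..<n}. a - of_nat i)) F"
    by (intro k_tendsto_cmult k_tendsto_prod k_tendsto_diff assms tendsto_const)
  then show ?thesis by (simp add: gbinomial_prod_rev divide_inverse mult.commute)
qed

lemma nat_residue_LIMSEQ: assumes "s \<in> Zp" shows "(\<lambda>m. of_nat (nat_residue m s)) \<longlonglongrightarrow> (s::'k)"
  by (rule k_tendsto_bound[OF _ pp_tendsto])
    (use nat_residue(2)[OF assms] nrm_minus_commute[of s] in auto)

lemma Zp_gbinomial: assumes "s \<in> (Zp::'k set)" shows "s gchoose n \<in> Zp"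
  by (rule Zp_LIMSEQ[OF k_tendsto_gbinomial[OF nat_residue_LIMSEQ[OF assms]]])
    (simp add: binomial_gbinomial[symmetric])

definition pow_part :: "'k \<Rightarrow> nat \<Rightarrow> 'k \<Rightarrow> 'k" where
  "pow_part y M s = (\<Sum>n<M. (s gchoose n) * (y - 1) ^ n)"

lemma principal_units_power_le: assumes "y \<in> principal_units" shows "nrm ((y - 1) ^ n) \<le> pp n"
proof -
  have "nrm (y - 1) \<le> 1 / real p" using assms unfolding principal_units_def by simp
  then show ?thesis unfolding nrm_power by (rule power_mono) simp
qed

lemma pow_part_term_le:
  assumes "y \<in> principal_units" "s \<in> Zp" shows "nrm ((s gchoose n) * (y - 1) ^ n) \<le> pp n"
  by (intro nrm_mult_leI1 Zp_nrm_le Zp_gbinomial assms principal_units_power_le)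

lemma padic_pow_sums:
  assumes y: "y \<in> principal_units" and s: "s \<in> Zp"
  shows "(\<lambda>M. pow_part y M s) \<longlonglongrightarrow> padic_pow y s"
proof -
  let ?t = "\<lambda>n. (s gchoose n) * (y - 1) ^ n"
  have L: "(\<lambda>M. \<Sum>n<M. ?t n) \<longlonglongrightarrow> lim (\<lambda>M. \<Sum>n<M. ?t n)"
    using pow_part_term_le[OF y s] pp_antimono pp_tendsto by (rule series_LIMSEQ)
  then have "padic_pow y s = lim (\<lambda>M. \<Sum>n<M. ?t n)"
    unfolding padic_pow_def using sums_unique[of ?t] by (simp add: sums_def)
  then show ?thesis using L unfolding pow_part_def by simp
qed

lemma padic_pow_part_close:
  assumes y: "y \<in> principal_units" and s: "s \<in> Zp" shows "nrm (padic_pow y s - pow_part y m s) \<le> pp m"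
  unfolding pow_part_def
  using pow_part_term_le[OF y s] pp_antimono padic_pow_sums[OF y s, unfolded pow_part_def]
  by (rule series_tail_le)

lemma pow_part_of_nat: assumes "k < M" shows "pow_part y M (of_nat k) = y ^ k"
proof -
  have "pow_part y M (of_nat k) = (\<Sum>n\<le>k. (of_nat k gchoose n) * (y - 1) ^ n)"
    unfolding pow_part_def using assms
    by (intro sum.mono_neutral_right) (auto simp: binomial_gbinomial[symmetric] binomial_eq_0)
  also have "\<dots> = ((y - 1) + 1) ^ k"
    unfolding binomial_ring by (simp add: binomial_gbinomial[symmetric])
  finally show ?thesis by simp
qed

lemma padic_pow_of_nat: assumes y: "y \<in> principal_units" shows "padic_pow y (of_nat k) = y ^ k"
proof (rule LIMSEQ_unique[OF padic_pow_sums[OF y Zp_of_nat]])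
  show "(\<lambda>M. pow_part y M (of_nat k)) \<longlonglongrightarrow> y ^ k"
    by (rule tendsto_eventually)
      (unfold eventually_sequentially, use pow_part_of_nat in \<open>auto intro!: exI[of _ "Suc k"]\<close>)
qed

text \<open>Powers with p-adic exponent are limits of powers with natural exponents: truncated
  binomial series are continuous in the exponent, and the truncation error is uniform. All algebraic
  properties of \<open>padic_pow\<close> are inherited from natural powers in this way.\<close>

lemma padic_pow_LIMSEQ:
  assumes y: "y \<in> principal_units" and s: "s \<in> Zp" and k: "(\<lambda>m. of_nat (k m)) \<longlonglongrightarrow> s"
  shows "(\<lambda>m. y ^ k m) \<longlonglongrightarrow> padic_pow y s"
  unfolding k_tendsto_eps
proof (intro allI impI)
  fix e :: real assume "e > 0"
  then obtain M where M: "pp M < e" using pp_less by blast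
  have "(\<lambda>m. pow_part y M (of_nat (k m))) \<longlonglongrightarrow> pow_part y M s"
    unfolding pow_part_def by (intro k_tendsto_sum k_tendsto_mult k_tendsto_gbinomial k tendsto_const)
  then obtain m0 where m0: "\<forall>m\<ge>m0. nrm (pow_part y M (of_nat (k m)) - pow_part y M s) \<le> e"
    unfolding k_tendsto_eps using \<open>e > 0\<close> by blast
  have "nrm (y ^ k m - padic_pow y s) \<le> e" if "m \<ge> m0" for m
  proof (rule nrm_trans_le)
    show "nrm (y ^ k m - pow_part y M s) \<le> e"
    proof (rule nrm_trans_le)
      show "nrm (y ^ k m - pow_part y M (of_nat (k m))) \<le> e"
        using padic_pow_part_close[OF y Zp_of_nat, of "k m" M] M unfolding padic_pow_of_nat[OF y] by linarith
    qed (use m0 that in blast)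
    show "nrm (pow_part y M s - padic_pow y s) \<le> e"
      using padic_pow_part_close[OF y s, of M] M unfolding nrm_minus_commute[of "padic_pow y s"] by linarith
  qed
  then show "\<exists>m0. \<forall>m\<ge>m0. nrm (y ^ k m - padic_pow y s) \<le> e" by blast
qed

lemmas padic_pow_nat_residue = padic_pow_LIMSEQ[OF _ _ nat_residue_LIMSEQ]

lemma principal_units_Gp: "y \<in> principal_units \<Longrightarrow> y \<in> Gp"
  using nrm_eq_of_close[of y 1] pp_Suc_less_1[of 0] unfolding principal_units_def Gp_iff nrm_1 by force

lemma principal_units_Zp: "y \<in> principal_units \<Longrightarrow> y \<in> Zp"
  unfolding principal_units_def by simp

lemma principal_units_mult: "x \<in> principal_units \<Longrightarrow> y \<in> principal_units \<Longrightarrow> x * y \<in> principal_units"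
  using mult_close[of x 1 1 1 y] unfolding principal_units_def by simp

lemma padic_pow_Zp: "y \<in> principal_units \<Longrightarrow> s \<in> Zp \<Longrightarrow> padic_pow y s \<in> Zp"
  by (rule Zp_LIMSEQ[OF padic_pow_nat_residue]) (auto simp: principal_units_Zp)

lemma padic_pow_mult:
  assumes x: "x \<in> principal_units" and y: "y \<in> principal_units" and s: "s \<in> Zp"
  shows "padic_pow (x * y) s = padic_pow x s * padic_pow y s"
proof (rule LIMSEQ_unique)
  show "(\<lambda>m. (x * y) ^ nat_residue m s) \<longlonglongrightarrow> padic_pow (x * y) s" by (rule padic_pow_nat_residue[OF principal_units_mult[OF x y] s s])
  show "(\<lambda>m. (x * y) ^ nat_residue m s) \<longlonglongrightarrow> padic_pow x s * padic_pow y s"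
    unfolding power_mult_distrib by (intro k_tendsto_mult padic_pow_nat_residue x y s)
qed

lemma padic_pow_close:
  assumes x: "x \<in> principal_units" and y: "y \<in> principal_units" and s: "s \<in> Zp"
  shows "nrm (padic_pow x s - padic_pow y s) \<le> nrm (x - y)"
  by (rule nrm_limit_le[OF k_tendsto_diff[OF padic_pow_nat_residue[OF x s s] padic_pow_nat_residue[OF y s s]]])
    (use power_diff_le[OF principal_units_Zp[OF x, THEN Zp_nrm_le] principal_units_Zp[OF y, THEN Zp_nrm_le]] in simp)

lemma padic_pow_add_nat:
  assumes y: "y \<in> principal_units" and s: "s \<in> Zp"
  shows "padic_pow y (s + of_nat n) = padic_pow y s * y ^ n"
proof (rule LIMSEQ_unique)
  have "(\<lambda>m. of_nat (nat_residue m s + n)) \<longlonglongrightarrow> s + of_nat n"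
    using k_tendsto_add[OF nat_residue_LIMSEQ[OF s] tendsto_const, of "of_nat n"] by simp
  then show "(\<lambda>m. y ^ (nat_residue m s + n)) \<longlonglongrightarrow> padic_pow y (s + of_nat n)"
    using s by (intro padic_pow_LIMSEQ y) auto
  show "(\<lambda>m. y ^ (nat_residue m s + n)) \<longlonglongrightarrow> padic_pow y s * y ^ n"
    unfolding power_add by (intro k_tendsto_mult padic_pow_nat_residue y s tendsto_const)
qed

section \<open>The Mellin transform\<close>

text \<open>The character \<open>\<omega>\<^sup>j \<langle>x\<rangle>\<^sup>s\<close> of the group of units.\<close>

definition mellin_kernel :: "int \<Rightarrow> 'k \<Rightarrow> 'k \<Rightarrow> 'k" where
  "mellin_kernel j s x = teich p x powi j * padic_pow (one_unit p x) s"

lemma mellin_eq_integral: "mellin p j \<rho> s = padic_integral p GG (mellin_kernel j s) \<rho>"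
  unfolding mellin_def mellin_kernel_def ..

lemma mellin_kernel_mult: "x \<in> Gp \<Longrightarrow> y \<in> Gp \<Longrightarrow> s \<in> Zp \<Longrightarrow> mellin_kernel j s (x * y) = mellin_kernel j s x * mellin_kernel j s y"
  unfolding mellin_kernel_def by (simp add: teich_mult one_unit_mult padic_pow_mult one_unit_principal power_int_mult_distrib)

lemma mellin_kernel_1: assumes "s \<in> Zp" shows "mellin_kernel j s 1 = 1"
proof -
  have 1: "(1::'k) \<in> principal_units" using pp_pos[of 1] unfolding principal_units_def by simp
  have "teich p 1 = (1::'k)" by (rule teich_eqI) (use pp_pos[of 1] in auto)
  moreover have "padic_pow 1 s = 1" using padic_pow_nat_residue[OF 1 assms assms] by (simp add: LIMSEQ_const_iff)
  ultimately show ?thesis unfolding mellin_kernel_def one_unit_def by simp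
qed

lemma nrm_teich_powi: "x \<in> Gp \<Longrightarrow> nrm (teich p x powi j :: 'k) = 1"
  using teich(1)[of x] unfolding Gp_iff power_int_def by (simp add: nrm_power nrm_inverse)

lemma mellin_kernel_le_1: "x \<in> Gp \<Longrightarrow> s \<in> Zp \<Longrightarrow> nrm (mellin_kernel j s x) \<le> 1"
  unfolding mellin_kernel_def using nrm_mult_leI1[of "teich p x powi j" "padic_pow (one_unit p x) s" 1]
    nrm_teich_powi Zp_nrm_le[OF padic_pow_Zp[OF one_unit_principal]] by simp

lemma mellin_kernel_close:
  assumes "x \<in> Gp" "y \<in> Gp" "s \<in> Zp" "nrm (x - y) \<le> pp 1" shows "nrm (mellin_kernel j s x - mellin_kernel j s y) \<le> nrm (x - y)"
proof -
  have "mellin_kernel j s x - mellin_kernel j s y = teich p x powi j * (padic_pow (one_unit p x) s - padic_pow (one_unit p y) s)"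
    unfolding mellin_kernel_def teich_cong[OF assms(1,2,4)] by (simp add: algebra_simps)
  also have "nrm \<dots> \<le> nrm (x - y)"
    using padic_pow_close[OF one_unit_principal one_unit_principal assms(3), OF assms(1,2)]
    unfolding one_unit_close[OF assms(1,2,4)] by (simp add: nrm_mult nrm_teich_powi assms)
  finally show ?thesis .
qed

lemma ucont_mellin_kernel: assumes "s \<in> Zp" shows "ucont GG (mellin_kernel j s)"
  unfolding ucont_def
proof (intro allI impI)
  fix e :: real assume "e > 0"
  then obtain m where m: "pp m < e" using pp_less by blast
  have "nrm (mellin_kernel j s x - mellin_kernel j s y) \<le> e" if "x \<in> GG" "y \<in> GG" "nrm (x - y) \<le> pp (Suc m)" for x y
  proof -
    have "nrm (x - y) \<le> pp 1" "nrm (x - y) \<le> pp m"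
      using that(3) pp_antimono[of 1 "Suc m"] pp_antimono[of m "Suc m"] by linarith+
    then show ?thesis using mellin_kernel_close[OF that(1,2) assms, of j] m by linarith
  qed
  then show "\<exists>m0. \<forall>x\<in>GG. \<forall>y\<in>GG. nrm (x - y) \<le> pp m0 \<longrightarrow> nrm (mellin_kernel j s x - mellin_kernel j s y) \<le> e" by blast
qed

lemma mellin_LIMSEQ:
  "\<rho> \<in> bounded_measures GG \<Longrightarrow> s \<in> Zp \<Longrightarrow> riemann_sum GG (mellin_kernel j s) \<rho> \<longlonglongrightarrow> mellin p j \<rho> s"
  unfolding mellin_eq_integral by (rule riemann_sum_LIMSEQ[OF periodic_Gp _ ucont_mellin_kernel])

text \<open>At level \<open>m\<close> the transform of a convolution evaluates the character at the representative of
  \<open>a b\<close> modulo \<open>p ^ m\<close>, the product of transforms at \<open>a\<close> and \<open>b\<close>; the character is multiplicative and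
  continuous, so the two Riemann sums differ by \<open>O(p\<^sup>-\<^sup>m)\<close>.\<close>

lemma mellin_conv:
  assumes \<rho>: "\<rho> \<in> bounded_measures GG" and \<sigma>: "\<sigma> \<in> bounded_measures GG" and s: "s \<in> Zp"
  shows "mellin p j (conv p \<rho> \<sigma>) s = mellin p j \<rho> s * mellin p j \<sigma> s"
proof -
  obtain A where A: "A \<ge> 0" "\<And>U. nrm (\<rho> U) \<le> A" using bmeas_bound[OF \<rho>] by blast
  obtain B where B: "B \<ge> 0" "\<And>U. nrm (\<sigma> U) \<le> B" using bmeas_bound[OF \<sigma>] by blast
  let ?k = "\<lambda>a. mellin_kernel j s (of_nat a)"
  have close: "nrm (riemann_sum GG (mellin_kernel j s) (conv p \<rho> \<sigma>) m - riemann_sum GG (mellin_kernel j s) \<rho> m * riemann_sum GG (mellin_kernel j s) \<sigma> m) \<le> pp m * (A * B)"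
    if m: "m \<ge> 1" for m
  proof -
    let ?R = "reps p m GG"
    have "riemann_sum GG (mellin_kernel j s) (conv p \<rho> \<sigma>) m - riemann_sum GG (mellin_kernel j s) \<rho> m * riemann_sum GG (mellin_kernel j s) \<sigma> m =
      (\<Sum>a\<in>?R. \<Sum>b\<in>?R. ?k ((a * b) mod p ^ m) * (\<rho> (disc m a) * \<sigma> (disc m b)) -
        (?k a * \<rho> (disc m a)) * (?k b * \<sigma> (disc m b)))"
      unfolding riemann_sum_def sum_conv_disc[OF \<rho> \<sigma> m] by (simp add: sum_product sum_subtractf)
    also have "nrm \<dots> \<le> pp m * (A * B)"
    proof (intro nrm_sum_le)
      fix a b assume ab: "a \<in> ?R" "b \<in> ?R"
      then have G: "of_nat a \<in> GG" "of_nat b \<in> GG" "of_nat ((a * b) mod p ^ m) \<in> GG"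
        using units_mod_nat_residue[OF m ab] by (auto simp: reps_iff)
      have "nrm (of_nat ((a * b) mod p ^ m) - of_nat a * of_nat b :: 'k) \<le> pp m"
        using nrm_nat_diff_le_iff[of "(a * b) mod p ^ m" "a * b" m] by (simp add: cong_def)
      moreover from this have "nrm (of_nat ((a * b) mod p ^ m) - of_nat a * of_nat b :: 'k) \<le> pp 1"
        using pp_antimono[OF m] by linarith
      ultimately have k: "nrm (?k ((a * b) mod p ^ m) - ?k a * ?k b) \<le> pp m"
        using mellin_kernel_close[OF G(3) Gp_mult[OF G(1,2)] s, of j] mellin_kernel_mult[OF G(1,2) s, of j] by simp
      have "?k ((a * b) mod p ^ m) * (\<rho> (disc m a) * \<sigma> (disc m b)) - (?k a * \<rho> (disc m a)) * (?k b * \<sigma> (disc m b))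
        = (?k ((a * b) mod p ^ m) - ?k a * ?k b) * (\<rho> (disc m a) * \<sigma> (disc m b))"
        by (simp add: algebra_simps)
      also have "nrm \<dots> \<le> pp m * (A * B)" by (intro nrm_mult_leI k A B)
      finally show "nrm (?k ((a * b) mod p ^ m) * (\<rho> (disc m a) * \<sigma> (disc m b)) - (?k a * \<rho> (disc m a)) * (?k b * \<sigma> (disc m b)))
        \<le> pp m * (A * B)" .
    qed (use A B pp_pos[of m] in simp_all)
    finally show ?thesis .
  qed
  have "(\<lambda>m. pp m * (A * B)) \<longlonglongrightarrow> 0" using tendsto_mult_left_zero[OF pp_tendsto] by simp
  then have "(\<lambda>m. (riemann_sum GG (mellin_kernel j s) (conv p \<rho> \<sigma>) m - riemann_sum GG (mellin_kernel j s) \<rho> m * riemann_sum GG (mellin_kernel j s) \<sigma> m)) \<longlonglongrightarrow> 0"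
    by (rule k_tendsto_bound[rotated]) (unfold eventually_sequentially, use close in auto)
  then have "riemann_sum GG (mellin_kernel j s) (conv p \<rho> \<sigma>) \<longlonglongrightarrow> mellin p j \<rho> s * mellin p j \<sigma> s"
    by (rule lim_eq_of_diff_null) (intro k_tendsto_mult mellin_LIMSEQ \<rho> \<sigma> s)
  then show ?thesis using LIMSEQ_unique mellin_LIMSEQ[OF conv_bmeas[OF \<rho> \<sigma>] s] by blast
qed

lemma mellin_lincomb:
  assumes "finite I" "\<And>i. i \<in> I \<Longrightarrow> F i \<in> bounded_measures GG" "s \<in> Zp"
  shows "mellin p j (\<lambda>U. \<Sum>i\<in>I. c i * F i U) s = (\<Sum>i\<in>I. c i * mellin p j (F i) s)"
proof (rule LIMSEQ_unique[OF mellin_LIMSEQ[OF bmeas_lincomb[OF periodic_Gp assms(1,2)] assms(3)]])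
  have eq: "riemann_sum GG (mellin_kernel j s) (\<lambda>U. \<Sum>i\<in>I. c i * F i U) = (\<lambda>m. \<Sum>i\<in>I. c i * riemann_sum GG (mellin_kernel j s) (F i) m)"
    unfolding riemann_sum_def sum_distrib_left by (intro ext) (subst sum.swap, simp add: mult_ac)
  show "riemann_sum GG (mellin_kernel j s) (\<lambda>U. \<Sum>i\<in>I. c i * F i U) \<longlonglongrightarrow> (\<Sum>i\<in>I. c i * mellin p j (F i) s)"
    unfolding eq by (intro k_tendsto_sum k_tendsto_cmult mellin_LIMSEQ assms)
qed

lemma mellin_dirac:
  assumes x: "x \<in> GG" and s: "s \<in> Zp" shows "mellin p j (dirac Gp x) s = mellin_kernel j s x"
proof (rule LIMSEQ_unique[OF mellin_LIMSEQ[OF dirac_bmeas[OF periodic_Gp] s]])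
  have "riemann_sum GG (mellin_kernel j s) (dirac Gp x) m = mellin_kernel j s (of_nat (nat_residue m x))" if m: "m \<ge> 1" for m
  proof -
    have "periodic m GG" using periodic_mono[OF periodic_Gp] m by simp
    then have rx: "nat_residue m x \<in> reps p m GG" using nat_residue_in_reps x by blast
    have "riemann_sum GG (mellin_kernel j s) (dirac Gp x) m = (\<Sum>a\<in>reps p m GG. if a = nat_residue m x then mellin_kernel j s (of_nat a) else 0)"
      unfolding riemann_sum_def
    proof (intro sum.cong refl)
      fix a assume "a \<in> reps p m GG"
      then have "dirac Gp x (disc m a) = (if a = nat_residue m x then 1 else 0 :: 'k)"
        unfolding dirac_def using units_disc(2)[OF m] mem_disc_iff[of a m x] Gp_Zp[OF x]
        by (auto simp: reps_iff)
      then show "mellin_kernel j s (of_nat a) * dirac Gp x (disc m a) = (if a = nat_residue m x then mellin_kernel j s (of_nat a) else 0)" by simp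
    qed
    then show ?thesis using rx by (simp add: sum.delta)
  qed
  moreover have "nrm (mellin_kernel j s (of_nat (nat_residue m x)) - mellin_kernel j s x) \<le> pp m" if m: "m \<ge> 1" for m
  proof -
    have "of_nat (nat_residue m x) \<in> GG" using nat_residue_in_reps[OF periodic_mono[OF periodic_Gp]] x m by (auto simp: reps_iff)
    moreover have "nrm (of_nat (nat_residue m x) - x) \<le> pp m" using nat_residue(2)[OF Gp_Zp[OF x], of m] nrm_minus_commute[of x] by simp
    ultimately show ?thesis using mellin_kernel_close[OF _ x s, of "of_nat (nat_residue m x)" j] pp_antimono[OF m] by linarith
  qed
  ultimately show "riemann_sum GG (mellin_kernel j s) (dirac Gp x) \<longlonglongrightarrow> mellin_kernel j s x"
    by (intro k_tendsto_bound[OF _ pp_tendsto]) (unfold eventually_sequentially, auto intro!: exI[of _ 1])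
qed

lemma mellin_pushforward:
  assumes "\<rho> \<in> bounded_measures GG" "x \<in> GG" "s \<in> Zp"
  shows "mellin p j (pushforward Gp Gp (\<lambda>y. x * y) \<rho>) s = mellin_kernel j s x * mellin p j \<rho> s"
  unfolding conv_dirac[OF assms(1,2), symmetric]
  using assms by (simp add: mellin_conv[OF dirac_bmeas[OF periodic_Gp]] mellin_dirac)

lemma mellin_r_meas:
  assumes "coprime c p" "s \<in> Zp"
  shows "mellin p j (r_meas c) s = 1 - of_nat c * mellin_kernel j s (of_nat c)"
proof -
  let ?F = "\<lambda>i::nat. if i = 0 then dirac GG 1 else dirac GG (of_nat c)"
  let ?c = "\<lambda>i::nat. if i = 0 then 1 else - of_nat c :: 'k"
  have "r_meas c = (\<lambda>U. \<Sum>i\<in>{0,1}. ?c i * ?F i U)" by (auto simp: r_meas_def)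
  then have "mellin p j (r_meas c) s = (\<Sum>i\<in>{0,1}. ?c i * mellin p j (?F i) s)"
    by (simp only:) (rule mellin_lincomb, use assms dirac_bmeas[OF periodic_Gp] in auto)
  then show ?thesis using assms by (simp add: mellin_dirac of_nat_Gp mellin_kernel_1)
qed

text \<open>A zero at \<open>s + p\<^sup>n\<close> is an equation \<open>c \<omega>(c)\<^sup>j \<langle>c\<rangle>\<^sup>s \<langle>c\<rangle>\<^bsup>p^n\<^esup> = 1\<close>. Two such \<open>n\<close> give
  \<open>\<langle>c\<rangle>\<^sup>d = 1\<close> with \<open>d > 0\<close>, hence \<open>c\<^bsup>d(p-1)\<^esup> = 1\<close>, which is absurd for an integer \<open>c > 1\<close> in
  characteristic zero.\<close>

lemma finite_zeros_r_meas:
  fixes s :: 'k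
  assumes c: "1 < c" "coprime c p" and s: "s \<in> Zp"
  shows "finite {n. mellin p j (r_meas c) (s + of_nat (p ^ n)) = 0}"
proof -
  let ?Z = "{n. mellin p j (r_meas c) (s + of_nat (p ^ n)) = 0}"
  let ?x = "of_nat c :: 'k" and ?k = "mellin_kernel j s (of_nat c)"
  let ?y = "one_unit p ?x"
  have xG: "?x \<in> Gp" by (rule of_nat_Gp[OF c(2)])
  have k: "mellin_kernel j (s + of_nat n) ?x = ?k * ?y ^ n" for n
    unfolding mellin_kernel_def using padic_pow_add_nat[OF one_unit_principal[OF xG] s] by simp
  have eq1: "?x * ?k * ?y ^ (p ^ n) = 1" if "n \<in> ?Z" for n
    using that mellin_r_meas[OF c(2), of "s + of_nat (p ^ n)" j] s k
    by (simp del: of_nat_power add: mult.assoc)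
  have False if n: "n \<in> ?Z" "m \<in> ?Z" "n < m" for n m
  proof -
    have nz: "?x * ?k \<noteq> 0" using eq1[OF n(1)] by (metis mult_zero_left zero_neq_one)
    have y0: "?y \<noteq> 0" using principal_units_Gp[OF one_unit_principal[OF xG]] by (auto simp: Gp_iff)
    have "?x * ?k * ?y ^ (p ^ n) = ?x * ?k * ?y ^ (p ^ m)" using eq1 n by metis
    then have e: "?y ^ (p ^ n) = ?y ^ (p ^ m)" using nz by simp
    have less: "p ^ n < p ^ m" using n(3) p_gt_1 by (rule power_strict_increasing)
    define d where "d = p ^ m - p ^ n"
    have "p ^ m = p ^ n + d" "d > 0" using less by (auto simp: d_def)
    then have "?y ^ d = 1" using e y0 by (simp add: power_add)
    then have "?x ^ d = teich p ?x ^ d" unfolding one_unit_def using teich_nz[OF xG] by (simp add: power_divide)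
    then have "(?x ^ d) ^ (p - 1) = (teich p ?x ^ (p - 1)) ^ d"
      by (simp add: power_mult[symmetric] mult.commute)
    then have "of_nat ((c ^ d) ^ (p - 1)) = (of_nat 1 :: 'k)" using teich(2)[OF xG] by simp
    then have "(c ^ d) ^ (p - 1) = 1" unfolding of_nat_eq_iff .
    moreover have "1 < c ^ d" using c(1) \<open>d > 0\<close> one_less_power by blast
    moreover have "p - 1 > 0" using p_gt_1 by simp
    ultimately show False using one_less_power[of "c ^ d" "p - 1"] by (metis less_irrefl)
  qed
  then have "\<And>n m. n \<in> ?Z \<Longrightarrow> m \<in> ?Z \<Longrightarrow> n = m" by (metis linorder_neqE_nat)
  then show ?thesis by (metis finite.emptyI finite.insertI finite_subset insertI1 subsetI)
qed

lemma finite_zeros_Sigma: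
  assumes w: "w \<in> Sigma_r p" and s: "s \<in> Zp"
  shows "finite {n. mellin p j w (s + of_nat (p ^ n)) = (0::'k)}"
  using w
proof (induction rule: Sigma_r.induct)
  case one
  have "mellin p j (dirac Gp 1) (s + of_nat (p ^ n)) = (1::'k)" for n
    using s by (simp add: mellin_dirac mellin_kernel_1)
  then show ?case by simp
next
  case (mult \<rho> c)
  have "mellin p j (conv p (r_meas c) \<rho>) (s + of_nat (p ^ n)) =
    mellin p j (r_meas c) (s + of_nat (p ^ n)) * mellin p j \<rho> (s + of_nat (p ^ n))" for n
    using s by (intro mellin_conv r_meas_bmeas Sigma_r_bmeas mult) auto
  then have "{n. mellin p j (conv p (r_meas c) \<rho>) (s + of_nat (p ^ n)) = 0} =
    {n. mellin p j (r_meas c) (s + of_nat (p ^ n)) = 0} \<union> {n. mellin p j \<rho> (s + of_nat (p ^ n)) = 0}"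
    by auto
  then show ?case using mult finite_zeros_r_meas[OF _ _ s, of c j] by simp
qed

text \<open>Shifting \<open>s\<close> by \<open>p ^ n\<close> multiplies the kernel by \<open>\<langle>x\<rangle>\<^bsup>p^n\<^esup>\<close>, which tends to \<open>1\<close>
  uniformly in \<open>x\<close>.\<close>

lemma mellin_shift_LIMSEQ:
  assumes \<rho>: "\<rho> \<in> bounded_measures GG" and s: "s \<in> Zp"
  shows "(\<lambda>n. mellin p j \<rho> (s + of_nat (p ^ n))) \<longlonglongrightarrow> mellin p j \<rho> s"
proof -
  obtain B where B: "B \<ge> 0" "\<And>U. nrm (\<rho> U) \<le> B" using bmeas_bound[OF \<rho>] by blast
  have "nrm (mellin p j \<rho> (s + of_nat (p ^ n)) - mellin p j \<rho> s) \<le> pp n * B" for n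
  proof (rule nrm_limit_le[OF k_tendsto_diff[OF mellin_LIMSEQ[OF \<rho>] mellin_LIMSEQ[OF \<rho> s]]])
    show "s + of_nat (p ^ n) \<in> Zp" using s by (intro Zp_add Zp_of_nat)
    have k: "nrm (mellin_kernel j (s + of_nat (p ^ n)) x - mellin_kernel j s x) \<le> pp n" if x: "x \<in> GG" for x
    proof -
      have "mellin_kernel j (s + of_nat (p ^ n)) x - mellin_kernel j s x = mellin_kernel j s x * (one_unit p x ^ (p ^ n) - 1 ^ (p ^ n))"
        unfolding mellin_kernel_def padic_pow_add_nat[OF one_unit_principal[OF x] s] by (simp add: algebra_simps)
      also have "nrm \<dots> \<le> pp (Suc (n + 0))"
        using one_unit_principal[OF x] by (intro nrm_mult_leI1 mellin_kernel_le_1 x s power_p_power_close) (auto simp: principal_units_def)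
      also have "\<dots> \<le> pp n" by (rule pp_antimono) simp
      finally show ?thesis .
    qed
    have "nrm (riemann_sum GG (mellin_kernel j (s + of_nat (p ^ n))) \<rho> m - riemann_sum GG (mellin_kernel j s) \<rho> m) \<le> pp n * B" for m
      unfolding riemann_sum_def sum_subtractf[symmetric] left_diff_distrib[symmetric]
      by (intro nrm_sum_le nrm_mult_leI k B mult_nonneg_nonneg) (use pp_pos[of n] B in \<open>auto simp: reps_iff\<close>)
    then show "\<forall>\<^sub>F m in sequentially. nrm (riemann_sum GG (mellin_kernel j (s + of_nat (p ^ n))) \<rho> m - riemann_sum GG (mellin_kernel j s) \<rho> m) \<le> pp n * B"
      by simp
  qed
  moreover have "(\<lambda>n. pp n * B) \<longlonglongrightarrow> 0" by (rule tendsto_mult_left_zero[OF pp_tendsto])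
  ultimately show ?thesis by (intro k_tendsto_bound) auto
qed

text \<open>Cancellation of a denominator at every point, including the zeros of its transform: the
  identity holds along a sequence converging to \<open>s\<close> on which the transform of \<open>w\<close> does not vanish. At
  \<open>s = -1\<close> and \<open>j = -1\<close>, for instance, the transforms of all \<open>r\<^sub>c\<close> vanish.\<close>

lemma mellin_cancel:
  assumes w: "w \<in> Sigma_r p" and \<rho>: "\<rho> \<in> bounded_measures GG" and \<sigma>: "\<sigma> \<in> bounded_measures GG"
    and eq: "conv p w \<rho> = conv p w \<sigma>" and s: "s \<in> Zp"
  shows "mellin p j \<rho> s = mellin p j \<sigma> s"
proof -
  let ?s = "\<lambda>n. s + of_nat (p ^ n)"
  have wb: "w \<in> bounded_measures GG" using Sigma_r_bmeas[OF w] .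
  have sZ: "?s n \<in> Zp" for n using s by (intro Zp_add Zp_of_nat)
  have "\<forall>\<^sub>F n in sequentially. mellin p j w (?s n) \<noteq> 0"
    using finite_zeros_Sigma[OF w s, of j] unfolding cofinite_eq_sequentially[symmetric] eventually_cofinite by simp
  then have "\<forall>\<^sub>F n in sequentially. mellin p j \<rho> (?s n) = mellin p j \<sigma> (?s n)"
  proof (rule eventually_mono)
    fix n assume n: "mellin p j w (?s n) \<noteq> 0"
    have "mellin p j w (?s n) * mellin p j \<rho> (?s n) = mellin p j w (?s n) * mellin p j \<sigma> (?s n)"
      using eq mellin_conv[OF wb \<rho> sZ] mellin_conv[OF wb \<sigma> sZ] by metis
    then show "mellin p j \<rho> (?s n) = mellin p j \<sigma> (?s n)" using n by simp
  qed
  then have "(\<lambda>n. mellin p j \<sigma> (?s n)) \<longlonglongrightarrow> mellin p j \<rho> s"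
    by (rule Lim_transform_eventually[OF mellin_shift_LIMSEQ[OF \<rho> s]])
  then show ?thesis using LIMSEQ_unique[OF _ mellin_shift_LIMSEQ[OF \<sigma> s]] by simp
qed

end

section \<open>Finite differences\<close>

definition fdiff :: "(nat \<Rightarrow> 'a::comm_ring_1) \<Rightarrow> nat \<Rightarrow> 'a" where
  "fdiff \<phi> x = \<phi> (Suc x) - \<phi> x"

lemma fdiff_zero: "(fdiff ^^ n) (\<lambda>x. 0) = (\<lambda>x. 0)"
  by (induction n) (simp_all add: fdiff_def fun_eq_iff)

lemma fdiff_lincomb: "(fdiff ^^ n) (\<lambda>x. \<Sum>i\<in>I. c i * \<phi> i x) x = (\<Sum>i\<in>I. c i * (fdiff ^^ n) (\<phi> i) x)"
  by (induction n arbitrary: x) (simp_all add: fdiff_def sum_subtractf right_diff_distrib)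

lemma fdiff_diff: "(fdiff ^^ n) (\<lambda>x. \<phi> x - \<psi> x) x = (fdiff ^^ n) \<phi> x - (fdiff ^^ n) \<psi> x"
  by (induction n arbitrary: x) (simp_all add: fdiff_def)

text \<open>Binomial coefficients are dual to iterated differences at \<open>0\<close>.\<close>

lemma fdiff_choose:
  "(fdiff ^^ n) (\<lambda>x. of_nat (x choose k)) 0 = (if n = k then 1 else (0 :: 'a::comm_ring_1))"
proof (induction n arbitrary: k)
  case 0 then show ?case by (cases k) simp_all
next
  case (Suc n)
  let ?f = "\<lambda>k x. of_nat (x choose k) :: 'a"
  have step: "(fdiff ^^ Suc n) (?f k) 0 = (fdiff ^^ n) (fdiff (?f k)) 0"
    by (simp only: funpow_Suc_right o_def)
  show ?case
  proof (cases k)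
    case 0
    then have "fdiff (?f k) = (\<lambda>x. 0)" by (simp add: fdiff_def fun_eq_iff)
    then show ?thesis unfolding step using 0 by (simp add: fdiff_zero)
  next
    case (Suc l)
    then have "fdiff (?f k) = ?f l" by (simp add: fdiff_def fun_eq_iff)
    then show ?thesis unfolding step using Suc.IH[of l] Suc by simp
  qed
qed

text \<open>Newton's forward formula. At \<open>x = 0\<close> it is the Mahler expansion of a function on the
  natural numbers; for a period \<open>n\<close> it expresses the \<open>n\<close>-th difference through lower ones.\<close>

lemma newton_forward: "\<phi> (x + n) = (\<Sum>j\<le>n. of_nat (n choose j) * (fdiff ^^ j) \<phi> x)"
proof (induction n arbitrary: \<phi>)
  case (Suc n)
  let ?d = "\<lambda>j. (fdiff ^^ j) \<phi> x"
  have "\<phi> (x + Suc n) = \<phi> (x + n) + fdiff \<phi> (x + n)" by (simp add: fdiff_def)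
  also have "\<dots> = (\<Sum>j\<le>n. of_nat (n choose j) * ?d j) + (\<Sum>j\<le>n. of_nat (n choose j) * ?d (Suc j))"
    using Suc.IH[of \<phi>] Suc.IH[of "fdiff \<phi>"] by (simp add: funpow_Suc_right del: funpow.simps(2))
  also have "(\<Sum>j\<le>n. of_nat (n choose j) * ?d j) = ?d 0 + (\<Sum>j\<le>n. of_nat (n choose Suc j) * ?d (Suc j))"
  proof -
    have "(\<Sum>j\<le>n. of_nat (n choose j) * ?d j) = (\<Sum>j\<le>Suc n. of_nat (n choose j) * ?d j)"
      by (simp add: binomial_eq_0)
    also have "\<dots> = ?d 0 + (\<Sum>j\<le>n. of_nat (n choose Suc j) * ?d (Suc j))"
      unfolding sum.atMost_Suc_shift by simp
    finally show ?thesis .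
  qed
  also have "?d 0 + (\<Sum>j\<le>n. of_nat (n choose Suc j) * ?d (Suc j)) + (\<Sum>j\<le>n. of_nat (n choose j) * ?d (Suc j))
    = (\<Sum>j\<le>Suc n. of_nat (Suc n choose j) * ?d j)"
    unfolding sum.atMost_Suc_shift by (simp add: sum.distrib algebra_simps)
  finally show ?case .
qed simp

context padic_ext begin

lemma fdiff_bound: "(\<And>x. nrm (\<phi> x :: 'k) \<le> B) \<Longrightarrow> nrm ((fdiff ^^ n) \<phi> x) \<le> B"
  by (induction n arbitrary: x) (auto simp: fdiff_def intro: nrm_diff_leI)

lemma fdiff_periodic: "(\<And>x. \<phi> (x + q) = \<phi> x) \<Longrightarrow> (fdiff ^^ n) \<phi> (x + q) = (fdiff ^^ n) \<phi> x"
  by (induction n arbitrary: x) (simp_all add: fdiff_def flip: add_Suc)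

text \<open>From \<open>j (p\<^sup>m choose j) = p\<^sup>m (p\<^sup>m - 1 choose j - 1)\<close>, since \<open>j\<close> is less divisible by \<open>p\<close>
  than \<open>p\<^sup>m\<close>.\<close>

lemma nrm_choose_p_power:
  assumes "0 < j" "j < p ^ m" shows "nrm (of_nat (p ^ m choose j) :: 'k) \<le> pp 1"
proof -
  obtain i where i: "j = Suc i" using assms(1) gr0_implies_Suc by blast
  have "Suc i * (p ^ m choose Suc i) = p ^ m * ((p ^ m - 1) choose i)"
    using times_binomial_minus1_eq[of "Suc i" "p ^ m"] by simp
  then have "of_nat j * of_nat (p ^ m choose j) = (of_nat (p ^ m) * of_nat ((p ^ m - 1) choose i) :: 'k)"
    unfolding i by (metis of_nat_mult)
  then have "nrm (of_nat j :: 'k) * nrm (of_nat (p ^ m choose j) :: 'k) \<le> pp m"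
    using nrm_mult_leI[of "of_nat (p ^ m) :: 'k" "pp m" "of_nat ((p ^ m - 1) choose i)" 1] nrm_of_nat_le
    by (simp add: nrm_mult[symmetric] nrm_p_power)
  moreover have "nrm (of_nat j :: 'k) > pp m"
  proof -
    have "\<not> nrm (of_nat j - of_nat 0 :: 'k) \<le> pp m"
      unfolding nrm_nat_diff_le_iff using assms by (simp add: cong_def)
    then show ?thesis by simp
  qed
  ultimately have "nrm (of_nat (p ^ m choose j) :: 'k) \<noteq> 1" by force
  then have "p dvd (p ^ m choose j)" using nrm_of_nat_unit_iff by blast
  then have "[p ^ m choose j = 0] (mod p ^ 1)" by (simp add: cong_0_iff)
  then show ?thesis using nrm_nat_diff_le_iff[of "p ^ m choose j" 0 1] by simp
qed

text \<open>For a function of period \<open>p ^ m\<close> the outer terms of Newton's formula for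
  \<open>\<phi> (x + p ^ m) = \<phi> x\<close> leave the difference of order \<open>p ^ m\<close> as a combination of lower ones whose
  coefficients are divisible by \<open>p\<close>.\<close>

lemma fdiff_p_power:
  assumes periodic: "\<And>x. \<phi> (x + p ^ m) = \<phi> x" and B: "\<And>x. nrm (\<phi> x :: 'k) \<le> B"
  shows "nrm ((fdiff ^^ (p ^ m)) \<phi> x) \<le> pp 1 * B"
proof -
  let ?q = "p ^ m" and ?d = "\<lambda>j. (fdiff ^^ j) \<phi> x"
  have "{..?q} = insert 0 (insert ?q {0<..<?q})" using p_power_pos[of m] by auto
  then have "\<phi> (x + ?q) = ?d 0 + (?d ?q + (\<Sum>j\<in>{0<..<?q}. of_nat (?q choose j) * ?d j))"
    unfolding newton_forward[of \<phi> x ?q] using p_power_pos[of m] by simp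
  then have e: "?d ?q = - (\<Sum>j\<in>{0<..<?q}. of_nat (?q choose j) * ?d j)"
    unfolding periodic by (simp add: eq_neg_iff_add_eq_0)
  have "0 \<le> B" using order_trans[OF zero_le_dist B] .
  then have "nrm (\<Sum>j\<in>{0<..<?q}. of_nat (?q choose j) * ?d j) \<le> pp 1 * B"
    using pp_pos[of 1] by (intro nrm_sum_le nrm_mult_leI nrm_choose_p_power fdiff_bound B mult_nonneg_nonneg) auto
  then show ?thesis unfolding e nrm_minus .
qed

text \<open>Mahler's theorem for locally constant functions, with an explicit rate: the coefficients of
  the Mahler expansion of a function of period \<open>p ^ m\<close> tend to zero.\<close>

lemma fdiff_decay:
  assumes "\<And>x. \<phi> (x + p ^ m) = \<phi> x" "\<And>x. nrm (\<phi> x :: 'k) \<le> B"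
  shows "nrm ((fdiff ^^ n) \<phi> x) \<le> pp (n div p ^ m) * B"
proof -
  have "nrm ((fdiff ^^ (e * p ^ m + r)) \<phi> x) \<le> pp e * B" for e r x
    using assms
  proof (induction e arbitrary: \<phi> B x)
    case (Suc e)
    have "(fdiff ^^ (Suc e * p ^ m + r)) \<phi> x = (fdiff ^^ (e * p ^ m + r)) ((fdiff ^^ (p ^ m)) \<phi>) x"
      by (simp add: funpow_add[symmetric, THEN fun_cong, unfolded o_def] ac_simps)
    also have "nrm \<dots> \<le> pp e * (pp 1 * B)"
      by (rule Suc.IH) (use Suc.prems fdiff_periodic fdiff_p_power in blast)+
    finally show ?case by (simp add: mult_ac)
  next
    case 0
    then show ?case using fdiff_bound[OF 0(2), where n = r and x = x] by simp
  qed
  from this[of "n div p ^ m" "n mod p ^ m" x] show ?thesis unfolding div_mult_mod_eq .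
qed

lemma pp_div_tendsto: assumes "q > 0" shows "(\<lambda>n. pp (n div q) * B) \<longlonglongrightarrow> 0"
proof -
  have "filterlim (\<lambda>n. n div q) sequentially sequentially"
    unfolding filterlim_at_top eventually_sequentially
  proof
    fix Z show "\<exists>N. \<forall>n\<ge>N. Z \<le> n div q"
      using assms by (intro exI[of _ "Z * q"]) (auto simp: less_eq_div_iff_mult_less_eq)
  qed
  then show ?thesis using tendsto_mult_left_zero[OF filterlim_compose[OF pp_tendsto]] by blast
qed

section \<open>The Amice transform\<close>

definition class_indicator :: "nat \<Rightarrow> nat \<Rightarrow> nat \<Rightarrow> 'k" where
  "class_indicator m a x = (if x mod p ^ m = a then 1 else 0)"

lemma class_indicator_decay: "nrm ((fdiff ^^ n) (class_indicator m a) x) \<le> pp (n div p ^ m)"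
  using fdiff_decay[of "class_indicator m a" m 1 n x] by (simp add: class_indicator_def nrm_1)

lemma reps_Zp: "reps p m (Zp :: 'k set) = {..<p ^ m}"
  by (auto simp: reps_iff)

lemma class_indicator_in_disc: "a < p ^ m \<Longrightarrow> class_indicator m a x = (if of_nat x \<in> disc m a then 1 else 0)"
  using mem_disc_iff[of a m "of_nat x"] by (simp add: class_indicator_def nat_residue_of_nat)

lemma pp_div_antimono: "m \<le> n \<Longrightarrow> 0 \<le> B \<Longrightarrow> pp (n div q) * B \<le> pp (m div q) * B"
  by (intro mult_right_mono pp_antimono div_le_mono)

text \<open>The falling factorial is a product of integral factors and hence a contraction; the
  denominator \<open>n!\<close> only costs a constant.\<close>

lemma gbinomial_close:
  assumes "x \<in> Zp" "y \<in> Zp"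
  shows "nrm ((x gchoose n) - (y gchoose n) :: 'k) \<le> nrm (x - y) / nrm (fact n :: 'k)"
proof -
  have "nrm ((\<Prod>i\<in>I. x - of_nat i) - (\<Prod>i\<in>I. y - of_nat i) :: 'k) \<le> nrm (x - y) \<and> (\<Prod>i\<in>I. y - of_nat i) \<in> Zp" for I
  proof (induction I rule: infinite_finite_induct)
    case (insert i I)
    have e: "(x - of_nat i) * P - (y - of_nat i) * Q = (x - of_nat i) * (P - Q) + Q * (x - y)" for P Q :: 'k
      by (simp add: algebra_simps)
    show ?case using insert assms unfolding prod.insert[OF insert.hyps] e
      by (intro conjI nrm_add_leI nrm_mult_leI1 Zp_nrm_le) auto
  qed auto
  then show ?thesis unfolding gbinomial_prod_rev diff_divide_distrib[symmetric]
    by (simp add: nrm_divide divide_right_mono diff_divide_distrib[symmetric])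
qed

lemma ucont_gbinomial: "ucont Zp (\<lambda>x. x gchoose n)"
  unfolding ucont_def
proof (intro allI impI)
  fix e :: real assume "e > 0"
  have f: "nrm (fact n :: 'k) > 0" by simp
  then obtain m where m: "pp m < e * nrm (fact n :: 'k)" using pp_less[of "e * nrm (fact n :: 'k)"] \<open>e > 0\<close> by auto
  have "nrm ((x gchoose n) - (y gchoose n)) \<le> e" if "x \<in> Zp" "y \<in> Zp" "nrm (x - y) \<le> pp m" for x y :: 'k
  proof -
    have "nrm (x - y) / nrm (fact n :: 'k) \<le> e" using that(3) m f by (simp add: divide_le_eq)
    then show ?thesis using gbinomial_close[OF that(1,2), of n] by linarith
  qed
  then show "\<exists>m0. \<forall>x\<in>Zp. \<forall>y\<in>Zp. nrm (x - y) \<le> pp m0 \<longrightarrow> nrm ((x gchoose n) - (y gchoose n) :: 'k) \<le> e" by blast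
qed

lemma amice_LIMSEQ:
  assumes "\<mu> \<in> bounded_measures Zp"
  shows "riemann_sum Zp (\<lambda>x. x gchoose n) \<mu> \<longlonglongrightarrow> fps_nth (amice p \<mu>) n"
  unfolding amice_def fps_nth_Abs_fps by (rule riemann_sum_LIMSEQ[OF periodic_Zp[of 0] assms ucont_gbinomial])

text \<open>Integrating the Mahler expansion of the indicator of a residue class term by term. The
  expansion converges uniformly by \<open>class_indicator_decay\<close>, and for each natural number \<open>b\<close> it is a finite
  sum.\<close>

lemma amice_disc:
  assumes \<mu>: "\<mu> \<in> bounded_measures Zp" and a: "a < p ^ m"
  shows "(\<lambda>M. \<Sum>n<M. fps_nth (amice p \<mu>) n * (fdiff ^^ n) (class_indicator m a) 0) \<longlonglongrightarrow> \<mu> (disc m a)"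
proof -
  obtain B where B: "B \<ge> 0" "\<And>U. nrm (\<mu> U) \<le> B" using bmeas_bound[OF \<mu>] by blast
  let ?d = "\<lambda>n. (fdiff ^^ n) (class_indicator m a) 0"
  have "nrm ((\<Sum>n<M. fps_nth (amice p \<mu>) n * ?d n) - \<mu> (disc m a)) \<le> pp (M div p ^ m) * B" for M
  proof (rule nrm_limit_le)
    show "(\<lambda>k. (\<Sum>n<M. riemann_sum Zp (\<lambda>x. x gchoose n) \<mu> k * ?d n) - \<mu> (disc m a)) \<longlonglongrightarrow>
        (\<Sum>n<M. fps_nth (amice p \<mu>) n * ?d n) - \<mu> (disc m a)"
      by (intro k_tendsto_diff k_tendsto_sum k_tendsto_mult amice_LIMSEQ \<mu> tendsto_const)
    have "nrm ((\<Sum>n<M. riemann_sum Zp (\<lambda>x. x gchoose n) \<mu> k * ?d n) - \<mu> (disc m a)) \<le> pp (M div p ^ m) * B"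
      if k: "k \<ge> m" for k
    proof -
      have "\<mu> (disc m a) = (\<Sum>b\<in>reps p k (disc m a). \<mu> (disc k b))"
        by (rule bmeas_decomp[OF \<mu> periodic_Zp[of 0] periodic_mono[OF periodic_disc k] periodic_subset[OF periodic_disc]])
      also have "\<dots> = (\<Sum>b\<in>reps p k ZZ. class_indicator m a b * \<mu> (disc k b))"
        by (rule sum.mono_neutral_cong_left) (auto simp: reps_iff class_indicator_in_disc[OF a])
      finally have \<mu>a: "\<mu> (disc m a) = (\<Sum>b\<in>reps p k ZZ. class_indicator m a b * \<mu> (disc k b))" .
      have "(\<Sum>n<M. riemann_sum Zp (\<lambda>x. x gchoose n) \<mu> k * ?d n) =
          (\<Sum>b\<in>reps p k ZZ. (\<Sum>n<M. of_nat (b choose n) * ?d n) * \<mu> (disc k b))"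
        unfolding riemann_sum_def sum_distrib_right
        by (subst sum.swap) (intro sum.cong refl, simp add: binomial_gbinomial mult_ac)
      then have "(\<Sum>n<M. riemann_sum Zp (\<lambda>x. x gchoose n) \<mu> k * ?d n) - \<mu> (disc m a) =
        (\<Sum>b\<in>reps p k ZZ. ((\<Sum>n<M. of_nat (b choose n) * ?d n) - class_indicator m a b) * \<mu> (disc k b))"
        unfolding \<mu>a by (simp only: left_diff_distrib sum_subtractf)
      also have "nrm \<dots> \<le> pp (M div p ^ m) * B"
      proof (intro nrm_sum_le nrm_mult_leI B mult_nonneg_nonneg)
        fix b
        have "class_indicator m a b = (\<Sum>n\<le>b. of_nat (b choose n) * ?d n)" using newton_forward[where \<phi> = "class_indicator m a" and x = 0 and n = b] by simp
        also have "\<dots> = (\<Sum>n<max M (Suc b). of_nat (b choose n) * ?d n)"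
          by (rule sum.mono_neutral_left) (auto simp: binomial_eq_0)
        finally have "class_indicator m a b - (\<Sum>n<M. of_nat (b choose n) * ?d n) = (\<Sum>n\<in>{M..<max M (Suc b)}. of_nat (b choose n) * ?d n)"
          unfolding lessThan_atLeast0 by (simp only: sum_diff_nat_ivl zero_le max.cobounded1)
        also have "nrm \<dots> \<le> pp (M div p ^ m)"
        proof (intro nrm_sum_le nrm_mult_leI1 nrm_of_nat_le)
          fix n assume "n \<in> {M..<max M (Suc b)}"
          then have "pp (n div p ^ m) \<le> pp (M div p ^ m)" by (intro pp_antimono div_le_mono) simp
          then show "nrm (?d n) \<le> pp (M div p ^ m)" using class_indicator_decay[of n m a 0] by linarith
        qed (use pp_pos[of "M div p ^ m"] in simp)
        finally show "nrm ((\<Sum>n<M. of_nat (b choose n) * ?d n) - class_indicator m a b) \<le> pp (M div p ^ m)"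
          using nrm_minus_commute[of "class_indicator m a b"] by simp
      qed (use pp_pos[of "M div p ^ m"] in simp)
      finally show ?thesis .
    qed
    then show "\<forall>\<^sub>F k in sequentially.
        nrm ((\<Sum>n<M. riemann_sum Zp (\<lambda>x. x gchoose n) \<mu> k * ?d n) - \<mu> (disc m a)) \<le> pp (M div p ^ m) * B"
      unfolding eventually_sequentially by blast
  qed
  then show ?thesis using pp_div_tendsto[OF p_power_pos]
    by (intro k_tendsto_bound[where g = "\<lambda>M. pp (M div p ^ m) * B"] always_eventually allI)
qed

lemma amice_inject:
  assumes "\<mu> \<in> bounded_measures Zp" "\<nu> \<in> bounded_measures Zp" "amice p \<mu> = (amice p \<nu> :: 'k fps)"
  shows "\<mu> = \<nu>"
proof (rule bmeas_eqI[OF assms(1,2) periodic_Zp[of 0]])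
  fix m a assume "a \<in> reps p m (Zp::'k set)"
  then have a: "a < p ^ m" by (simp add: reps_iff)
  show "\<mu> (disc m a) = \<nu> (disc m a)"
    using LIMSEQ_unique[OF amice_disc[OF assms(1) a] amice_disc[OF assms(2) a, folded assms(3)]] .
qed

text \<open>The formula of \<open>amice_disc\<close> is taken as the definition of the measure on residue classes.
  Its transform is the given series: at level \<open>m\<close>, the function \<open>x choose k\<close> gets replaced by the periodic
  function \<open>(x mod p\<^sup>m) choose k\<close>, which is uniformly close to it, and for \<open>x choose k\<close> itself the formula
  returns the \<open>k\<close>-th coefficient by \<open>fdiff_choose\<close>.\<close>

lemma amice_surj:
  fixes F :: "'k fps"
  assumes F: "\<And>n. nrm (fps_nth F n) \<le> B"
  shows "\<exists>\<mu>\<in>bounded_measures Zp. amice p \<mu> = F"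
proof -
  have B0: "0 \<le> B" using order_trans[OF zero_le_dist F] .
  define t where "t m a n = fps_nth F n * (fdiff ^^ n) (class_indicator m a) 0" for m a n
  define v where "v m a = lim (\<lambda>M. \<Sum>n<M. t m a n)" for m a
  have tb: "nrm (t m a n) \<le> pp (n div p ^ m) * B" for m a n
    unfolding t_def mult.commute[of _ B] by (intro nrm_mult_leI F class_indicator_decay)
  have v: "(\<lambda>M. \<Sum>n<M. t m a n) \<longlonglongrightarrow> v m a" for m a
    unfolding v_def using pp_div_antimono[OF _ B0] pp_div_tendsto[OF p_power_pos] tb
    by (intro series_LIMSEQ[where g = "\<lambda>n. pp (n div p ^ m) * B"])
  have "\<exists>\<mu>\<in>bounded_measures Zp. \<forall>m a. a < p ^ m \<longrightarrow> \<mu> (disc m a) = v m a"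
  proof (rule measure_from_levels)
    fix m a assume a: "a < p ^ m"
    let ?I = "reps p (Suc m) (disc m a)"
    have "class_indicator m a = (\<lambda>x. \<Sum>b\<in>?I. 1 * class_indicator (Suc m) b x)"
    proof
      fix x
      have "(x mod p ^ Suc m) mod p ^ m = x mod p ^ m" by (simp add: mod_mod_cancel)
      then have "x mod p ^ Suc m \<in> ?I \<longleftrightarrow> x mod p ^ m = a"
        using a mem_disc_iff[OF a, of "of_nat (x mod p ^ Suc m)"] p_power_pos[of "Suc m"]
        by (simp add: reps_iff nat_residue_of_nat)
      then show "class_indicator m a x = (\<Sum>b\<in>?I. 1 * class_indicator (Suc m) b x)" unfolding class_indicator_def by (simp add: sum.delta)
    qed
    then have "t m a n = (\<Sum>b\<in>?I. t (Suc m) b n)" for n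
      unfolding t_def sum_distrib_left[symmetric] using fdiff_lincomb[of n "\<lambda>_. 1" "\<lambda>b. class_indicator (Suc m) b" ?I 0] by simp
    then have e: "(\<Sum>n<M. t m a n) = (\<Sum>b\<in>?I. \<Sum>n<M. t (Suc m) b n)" for M
      by (simp only: sum.swap[of _ ?I])
    show "v m a = (\<Sum>b\<in>?I. v (Suc m) b)"
      using v[of m a] k_tendsto_sum[of ?I "\<lambda>b M. \<Sum>n<M. t (Suc m) b n", OF v] unfolding e by (rule LIMSEQ_unique)
  next
    fix m a
    have "nrm (t m a n) \<le> B" for n
      using nrm_mult_leI[OF F class_indicator_decay, of n n m a 0] mult_left_mono[OF pp_le_1 B0, of "n div p ^ m"]
      unfolding t_def by linarith
    then show "nrm (v m a) \<le> B"
      by (intro nrm_limit_le[OF v] always_eventually allI nrm_sum_le B0)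
  qed
  then obtain \<mu> where \<mu>: "\<mu> \<in> bounded_measures Zp" "\<And>m a. a < p ^ m \<Longrightarrow> \<mu> (disc m a) = v m a" by blast
  have "fps_nth (amice p \<mu>) k = fps_nth F k" for k
  proof (rule LIMSEQ_unique[OF amice_LIMSEQ[OF \<mu>(1)]])
    show "riemann_sum Zp (\<lambda>x. x gchoose k) \<mu> \<longlonglongrightarrow> fps_nth F k"
      unfolding k_tendsto_eps
    proof (intro allI impI)
      fix e :: real assume "e > 0"
      \<comment> \<open>The bound \<open>B\<close> may be \<open>0\<close>, hence the \<open>+ 1\<close>.\<close>
      then have "e / (B + 1) > 0" using B0 by simp
      then obtain m0 where m0: "\<And>x y :: 'k. x \<in> Zp \<Longrightarrow> y \<in> Zp \<Longrightarrow> nrm (x - y) \<le> pp m0 \<Longrightarrow>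
          nrm ((x gchoose k) - (y gchoose k)) \<le> e / (B + 1)"
        using ucont_gbinomial[of k] unfolding ucont_def by blast
      have "nrm (riemann_sum Zp (\<lambda>x. x gchoose k) \<mu> m - fps_nth F k) \<le> e" if m: "m \<ge> m0" for m
      proof (rule nrm_limit_le)
        \<comment> \<open>\<open>?\<psi> x\<close> is the binomial coefficient at the representative of \<open>x\<close> below \<open>p ^ m\<close>.\<close>
        let ?\<psi> = "\<lambda>x. \<Sum>a<p ^ m. of_nat (a choose k) * class_indicator m a x"
        let ?C = "\<lambda>x. of_nat (x choose k) :: 'k"
        show "(\<lambda>M. (\<Sum>a<p ^ m. of_nat (a choose k) * (\<Sum>n<M. t m a n)) - fps_nth F k) \<longlonglongrightarrow>
            riemann_sum Zp (\<lambda>x. x gchoose k) \<mu> m - fps_nth F k"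
          unfolding riemann_sum_def reps_Zp binomial_gbinomial[symmetric]
          by (intro k_tendsto_diff k_tendsto_sum tendsto_const k_tendsto_cmult) (simp add: \<mu>(2) v)
        have \<psi>: "?\<psi> x = of_nat ((x mod p ^ m) choose k)" for x
          unfolding class_indicator_def using p_power_pos[of m] by (simp add: sum.delta if_distrib cong: if_cong)
        have close: "nrm (?\<psi> x - ?C x) \<le> e / (B + 1)" for x
        proof -
          have "nrm (of_nat (x mod p ^ m) - of_nat x :: 'k) \<le> pp m0"
            using nrm_nat_diff_le_iff[of "x mod p ^ m" x m] pp_antimono[OF m] by (simp add: cong_def)
          then show ?thesis unfolding \<psi> using m0[OF Zp_of_nat Zp_of_nat] by (simp add: binomial_gbinomial)
        qed
        have "nrm ((\<Sum>a<p ^ m. of_nat (a choose k) * (\<Sum>n<M. t m a n)) - fps_nth F k) \<le> e" if M: "M > k" for M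
        proof -
          have "(\<Sum>a<p ^ m. of_nat (a choose k) * (\<Sum>n<M. t m a n)) = (\<Sum>n<M. fps_nth F n * (fdiff ^^ n) ?\<psi> 0)"
            unfolding t_def fdiff_lincomb sum_distrib_left
            by (subst sum.swap) (intro sum.cong refl, simp add: mult_ac)
          moreover have "fps_nth F k = (\<Sum>n<M. fps_nth F n * (fdiff ^^ n) ?C 0)"
            unfolding fdiff_choose using M by (simp add: if_distrib sum.delta cong: if_cong)
          ultimately have "(\<Sum>a<p ^ m. of_nat (a choose k) * (\<Sum>n<M. t m a n)) - fps_nth F k =
              (\<Sum>n<M. fps_nth F n * (fdiff ^^ n) (\<lambda>x. ?\<psi> x - ?C x) 0)"
            unfolding fdiff_diff by (simp only: sum_subtractf right_diff_distrib)
          also have "nrm \<dots> \<le> B * (e / (B + 1))"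
            using B0 \<open>e > 0\<close> by (intro nrm_sum_le nrm_mult_leI F fdiff_bound close) auto
          also have "\<dots> \<le> e" using B0 \<open>e > 0\<close> by (simp add: field_simps)
          finally show ?thesis .
        qed
        then show "\<forall>\<^sub>F M in sequentially.
            nrm ((\<Sum>a<p ^ m. of_nat (a choose k) * (\<Sum>n<M. t m a n)) - fps_nth F k) \<le> e"
          unfolding eventually_sequentially by (intro exI[of _ "Suc k"]) auto
      qed
      then show "\<exists>m0. \<forall>m\<ge>m0. nrm (riemann_sum Zp (\<lambda>x. x gchoose k) \<mu> m - fps_nth F k) \<le> e" by blast
    qed
  qed
  then have "amice p \<mu> = F" by (simp add: fps_eq_iff)
  then show ?thesis using \<mu>(1) by blast
qed

section \<open>The half-shifted zeta measure\<close>

definition integral_fps :: "'k fps \<Rightarrow> bool" where "integral_fps F \<longleftrightarrow> (\<forall>n. fps_nth F n \<in> Zp)"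

lemma integral_fps_mult: "integral_fps F \<Longrightarrow> integral_fps G \<Longrightarrow> integral_fps (F * G)"
  unfolding integral_fps_def fps_mult_nth by (auto intro: Zp_sum)

lemma integral_fps_add: "integral_fps F \<Longrightarrow> integral_fps G \<Longrightarrow> integral_fps (F + G)"
  unfolding integral_fps_def by simp

lemma integral_fps_diff: "integral_fps F \<Longrightarrow> integral_fps G \<Longrightarrow> integral_fps (F - G)"
  unfolding integral_fps_def by simp

lemma integral_fps_of_nat: "integral_fps (of_nat n)"
  unfolding integral_fps_def fps_of_nat[symmetric] by simp

lemma integral_fps_one: "integral_fps 1"
  unfolding integral_fps_def by simp

lemma integral_fps_X: "integral_fps fps_X"
  unfolding integral_fps_def fps_X_def by simp

lemma integral_fps_power: "integral_fps F \<Longrightarrow> integral_fps (F ^ n)"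
  by (induction n) (auto intro: integral_fps_mult integral_fps_one)

lemma integral_fps_sum: "(\<And>i. i \<in> A \<Longrightarrow> integral_fps (F i)) \<Longrightarrow> integral_fps (sum F A)"
  unfolding integral_fps_def fps_sum_nth by (auto intro: Zp_sum)

text \<open>The recursion for the coefficients of the inverse divides by the constant term only.\<close>

lemma integral_fps_inverse:
  assumes F: "integral_fps F" and 0: "fps_nth F 0 \<in> Gp" shows "integral_fps (inverse F)"
proof -
  have f0: "fps_nth F 0 \<noteq> 0" using 0 by (auto simp: Gp_iff)
  then have inv: "F * inverse F = 1" using inverse_mult_eq_1[of F] by (simp add: mult.commute)
  have "fps_nth (inverse F) n \<in> Zp" for n
  proof (induction n rule: less_induct)
    case (less n)
    have "fps_nth 1 n = (\<Sum>i=0..n. fps_nth F i * fps_nth (inverse F) (n - i))"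
      unfolding inv[symmetric] fps_mult_nth ..
    also have "\<dots> = fps_nth F 0 * fps_nth (inverse F) n + (\<Sum>i\<in>{0<..n}. fps_nth F i * fps_nth (inverse F) (n - i))"
      by (simp add: sum.head)
    finally have "fps_nth (inverse F) n =
        inverse (fps_nth F 0) * (fps_nth 1 n - (\<Sum>i\<in>{0<..n}. fps_nth F i * fps_nth (inverse F) (n - i)))"
      using f0 by (simp add: field_simps)
    moreover have "\<dots> \<in> Zp" using F less Gp_inverse[OF 0]
      by (intro Zp_mult Zp_diff Zp_sum) (auto simp: integral_fps_def Gp_Zp fps_one_nth)
    ultimately show ?case by simp
  qed
  then show ?thesis unfolding integral_fps_def by blast
qed

text \<open>With \<open>q = 1 + T\<close>, \<open>c = 2 h + 1\<close> and \<open>D = 1 + q + \<dots> + q\<^bsup>c-1\<^esup>\<close>, the defining expression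
  equals \<open>q\<^bsup>1/2\<^esup> (D - c q\<^sup>h) / (T D)\<close>. The numerator vanishes at \<open>T = 0\<close>, and \<open>D\<close> has the unit \<open>c\<close> as its
  constant term, so both poles disappear and the coefficients are integral. That \<open>p\<close> is odd
  enters through the integrality of the binomial series of exponent \<open>1/2\<close>.\<close>

lemma lambda_half_series:
  assumes p: "odd p" and c: "odd c" "coprime c p"
  obtains F :: "'k fps" where "integral_fps F"
    "fps_to_fls F = fps_to_fls (fps_binomial (1 / 2)) / fls_X
       - of_nat c * (fps_to_fls (fps_binomial (of_nat c / 2)) / fps_to_fls ((1 + fps_X) ^ c - 1))"
proof -
  define h where "h = (c - 1) div 2"
  have ch: "c = 2 * h + 1" using c(1) by (auto simp: h_def elim: oddE)
  let ?q = "1 + fps_X :: 'k fps"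
  define b :: "'k fps" where "b = fps_binomial (1 / 2)"
  define D where "D = (\<Sum>i<c. ?q ^ i)"
  define A where "A = fps_shift 1 (D - of_nat c * ?q ^ h)"
  have q: "integral_fps ?q" by (intro integral_fps_add integral_fps_one integral_fps_X)
  have D: "integral_fps D" unfolding D_def by (intro integral_fps_sum integral_fps_power q)
  have q0: "fps_nth (?q ^ i) 0 = 1" for i by (simp add: fps_nth_power_0)
  have D0: "fps_nth D 0 = of_nat c" unfolding D_def fps_sum_nth q0 by simp
  have D0': "fps_nth D 0 \<in> Gp" unfolding D0 by (rule of_nat_Gp[OF c(2)])
  have b: "integral_fps b" unfolding integral_fps_def b_def
  proof
    fix n
    have "coprime 2 p" using p by simp
    from Gp_Zp[OF Gp_inverse[OF of_nat_Gp[OF this]]] have "(1 / 2 :: 'k) \<in> Zp"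
      by (simp add: inverse_eq_divide)
    then show "fps_nth (fps_binomial (1 / 2)) n \<in> (Zp::'k set)" by (simp add: Zp_gbinomial)
  qed
  have A: "integral_fps A" using integral_fps_diff[OF D integral_fps_mult[OF integral_fps_of_nat integral_fps_power[OF q]]]
    unfolding A_def integral_fps_def by simp
  have "fps_nth (D - of_nat c * ?q ^ h) 0 = 0" using D0 q0[of h] by (simp add: fps_mult_nth fps_of_nat[symmetric])
  then have XA: "fps_X * A = D - of_nat c * ?q ^ h"
  proof -
    have "fps_X * fps_shift 1 G = G" if "fps_nth G 0 = 0" for G :: "'k fps"
      using that by (auto simp: fps_eq_iff fps_X_mult_nth)
    then show ?thesis unfolding A_def using \<open>fps_nth (D - of_nat c * ?q ^ h) 0 = 0\<close> by blast
  qed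
  have XD: "?q ^ c - 1 = fps_X * D"
    unfolding D_def using power_diff_1_eq[of ?q c] by simp
  have bin: "fps_binomial (of_nat c / 2) = b * ?q ^ h"
  proof -
    have "of_nat c / 2 = (1 / 2 + of_nat h :: 'k)" unfolding ch by (simp add: field_simps)
    then show ?thesis unfolding b_def by (simp only: fps_binomial_add_mult fps_binomial_of_nat)
  qed
  have D_nz: "D \<noteq> 0" using D0' by (auto simp: Gp_iff)
  have Dinv: "inverse D * D = 1" using D0' by (intro inverse_mult_eq_1) (auto simp: Gp_iff)
  let ?t = "fps_to_fls :: 'k fps \<Rightarrow> 'k fls"
  have tD: "?t D \<noteq> 0" using D_nz by simp
  have X: "?t fps_X = fls_X" by simp
  have Xn: "(fls_X :: 'k fls) \<noteq> 0" by simp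
  have tinv: "?t (inverse D) = inverse (?t D)"
    using arg_cong[OF Dinv, of ?t] tD by (simp add: fls_times_fps_to_fls field_simps)
  have tA: "fls_X * ?t A = ?t D - of_nat c * ?t (?q ^ h)"
    using arg_cong[OF XA, of ?t] by (simp add: fls_times_fps_to_fls X fps_to_fls_of_nat)
  have "?t (b * A * inverse D) = ?t b / fls_X - of_nat c * (?t (b * ?q ^ h) / ?t (fps_X * D))"
  proof -
    have "fls_X * ?t D * (?t b / fls_X - of_nat c * (?t (b * ?q ^ h) / ?t (fps_X * D)))
      = ?t b * (?t D - of_nat c * ?t (?q ^ h))"
    proof -
      have "x * d * (b / x - c * (b * q / (x * d))) = b * (d - c * q)"
        if "x \<noteq> 0" "d \<noteq> 0" for x d b c q :: "'k fls"
        using that by (simp add: field_simps)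
      from this[OF Xn tD] show ?thesis unfolding fls_times_fps_to_fls X .
    qed
    also have "\<dots> = fls_X * ?t D * (?t (b * A * inverse D))"
      unfolding tA[symmetric] using tD by (simp add: fls_times_fps_to_fls tinv field_simps)
    finally show ?thesis using tD Xn by simp
  qed
  then show ?thesis
    using that[of "b * A * inverse D"] integral_fps_mult[OF integral_fps_mult[OF b A] integral_fps_inverse[OF D D0']]
    unfolding bin XD b_def by blast
qed

lemma lambda_half_bmeas:
  assumes "odd p" "odd c" "coprime c p" shows "lambda_half p c \<in> bounded_measures (Zp::'k set)"
proof -
  obtain F :: "'k fps" where F: "integral_fps F"
    "fps_to_fls F = fps_to_fls (fps_binomial (1 / 2)) / fls_X
       - of_nat c * (fps_to_fls (fps_binomial (of_nat c / 2)) / fps_to_fls ((1 + fps_X) ^ c - 1))"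
    using lambda_half_series[OF assms] by blast
  obtain \<mu> where \<mu>: "\<mu> \<in> bounded_measures Zp" "amice p \<mu> = F"
    using amice_surj[of F 1] F(1) Zp_nrm_le unfolding integral_fps_def by blast
  have "lambda_half p c = \<mu>" unfolding lambda_half_def F(2)[symmetric]
    by (rule the_equality) (use \<mu> amice_inject in auto)
  then show ?thesis using \<mu>(1) by simp
qed

lemma restrict_measure_bmeas:
  assumes "\<mu> \<in> bounded_measures (Zp::'k set)" "periodic n X" shows "restrict_measure X \<mu> \<in> bounded_measures X"
proof -
  obtain B where B: "B \<ge> 0" "\<And>U. nrm (\<mu> U) \<le> B" using bmeas_bound[OF assms(1)] by blast
  have Zp: "clopen Zp U" if "clopen X U" for U
    using clopenE[OF that assms(2)] clopen_periodicI[OF periodic_Zp[of 0]] periodic_subset by metis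
  show ?thesis unfolding bounded_measures_def restrict_measure_def
  proof (intro CollectI conjI allI impI exI[of _ B])
    fix U V assume c: "clopen X U" "clopen X V" "U \<inter> V = {}"
    then have "clopen X (U \<union> V)" unfolding clopen_def by (auto intro: closedin_Un)
    then show "(if clopen X (U \<union> V) then \<mu> (U \<union> V) else 0) =
        (if clopen X U then \<mu> U else 0) + (if clopen X V then \<mu> V else 0)"
      using bmeas_additive[OF assms(1) Zp Zp, OF c] c by simp
  qed (use B in auto)
qed

lemma lambda_half_G_bmeas:
  assumes "odd p" "odd c" "coprime c p" shows "lambda_half_G p c \<in> bounded_measures GG"
  unfolding lambda_half_G_def by (rule restrict_measure_bmeas[OF lambda_half_bmeas[OF assms] periodic_Gp])

end

section \<open>Roots of unity\<close>

lemma root_power_cong: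
  fixes z :: "'a::monoid_mult"
  assumes "z ^ n = 1" "[a = b] (mod n)" shows "z ^ a = z ^ b"
proof -
  have "z ^ k = z ^ (k mod n)" for k
  proof -
    have "z ^ k = z ^ (n * (k div n) + k mod n)" by simp
    also have "\<dots> = z ^ (k mod n)" unfolding power_add power_mult assms(1) by simp
    finally show ?thesis .
  qed
  then show ?thesis using assms(2) unfolding cong_def by metis
qed

lemma primitive_root_power_eq_1_iff:
  assumes "primitive_root_of_unity n z" shows "z ^ a = 1 \<longleftrightarrow> n dvd a"
proof
  assume "z ^ a = 1"
  moreover have "z ^ a = z ^ (a mod n)"
    using assms by (intro root_power_cong[of z n]) (auto simp: primitive_root_of_unity_def cong_def)
  ultimately have "\<not> 0 < a mod n"
    using assms mod_less_divisor[of n a] unfolding primitive_root_of_unity_def by auto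
  then show "n dvd a" by (simp add: dvd_eq_mod_eq_0)
next
  assume "n dvd a"
  then show "z ^ a = 1" using assms by (auto simp: primitive_root_of_unity_def power_mult elim!: dvdE)
qed

lemma primitive_root_power:
  assumes "primitive_root_of_unity (d * n) z" shows "primitive_root_of_unity n (z ^ d)"
proof -
  have "d * n > 0" using assms by (simp add: primitive_root_of_unity_def)
  then have d: "d > 0" "n > 0" by auto
  have "(z ^ d) ^ k = 1 \<longleftrightarrow> n dvd k" for k
    using primitive_root_power_eq_1_iff[OF assms, of "d * k"] d by (simp add: power_mult)
  then show ?thesis using d unfolding primitive_root_of_unity_def by (auto dest: dvd_imp_le)
qed

lemma sum_primitive_root:
  fixes z :: "'a::field"
  assumes "primitive_root_of_unity n z"
  shows "(\<Sum>k<n. (z ^ a) ^ k) = (if n dvd a then of_nat n else 0)"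
proof (cases "n dvd a")
  case True
  then have "z ^ a = 1" using primitive_root_power_eq_1_iff[OF assms] by blast
  then show ?thesis using True by simp
next
  case False
  then have "z ^ a \<noteq> 1" using primitive_root_power_eq_1_iff[OF assms] by simp
  moreover have "(z ^ a) ^ n = 1"
    using assms by (simp add: primitive_root_of_unity_def power_mult[symmetric] mult.commute[of a] power_mult)
  ultimately show ?thesis using False one_diff_power_eq[of "z ^ a" n] by simp
qed

lemma sum_mod_mult:
  fixes b n :: nat
  assumes "coprime b n" "\<And>k. F (k mod n) = F k" "n > 0"
  shows "(\<Sum>a<n. F (b * a)) = (\<Sum>a<n. F a :: 'a::comm_monoid_add)"
proof -
  let ?h = "\<lambda>a. (b * a) mod n"
  have "inj_on ?h {..<n}"
  proof (rule inj_onI)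
    fix x y assume "x \<in> {..<n}" "y \<in> {..<n}" "?h x = ?h y"
    then show "x = y" using cong_mult_lcancel_nat[OF assms(1), of x y] by (simp add: cong_def)
  qed
  moreover have "?h ` {..<n} \<subseteq> {..<n}" using assms(3) by auto
  ultimately have "bij_betw ?h {..<n} {..<n}" by (simp add: bij_betw_def endo_inj_surj)
  then have "(\<Sum>a<n. F (?h a)) = (\<Sum>a<n. F a)" by (rule sum.reindex_bij_betw)
  then show ?thesis unfolding assms(2) .
qed

context padic_ext begin

text \<open>For these \<open>z\<close> all denominators \<open>1 - z ^ (p ^ m)\<close> of \<open>\<mu>\<^sub>z\<close> are units, which makes the measure
  bounded.\<close>

definition tame_root :: "'k \<Rightarrow> bool" where
  "tame_root z \<longleftrightarrow> z \<noteq> 1 \<and> (\<exists>n. coprime n p \<and> z ^ n = 1)"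

lemma tame_root_power: assumes "tame_root z" shows "tame_root (z ^ (p ^ m))"
proof -
  obtain n where n: "coprime n p" "z ^ n = 1" "z \<noteq> 1" using assms unfolding tame_root_def by blast
  have "coprime (p ^ m) n" using n(1) by (simp add: coprime_commute)
  from cong_solve_coprime_nat[OF this] obtain a where "[p ^ m * a = 1] (mod n)" by (metis One_nat_def)
  then have "(z ^ (p ^ m)) ^ a = z" using root_power_cong[OF n(2)] by (metis power_mult power_one_right)
  then have "z ^ (p ^ m) \<noteq> 1" using n(3) by auto
  moreover have "(z ^ (p ^ m)) ^ n = 1" using n(2) by (metis mult.commute power_mult power_one)
  ultimately show ?thesis unfolding tame_root_def using n(1) by blast
qed

lemma nrm_root: assumes "z ^ n = 1" "n > 0" shows "nrm (z :: 'k) = 1"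
  using assms power_eq_1_iff[of "nrm z" n] nrm_power[of z n] nrm_1 by simp

text \<open>If \<open>z\<close> were congruent to \<open>1\<close>, then \<open>(z\<^sup>n - 1)/(z - 1)\<close> would be congruent to the unit \<open>n\<close>
  and so could not vanish.\<close>

lemma tame_root_nrm: assumes "tame_root z" shows "nrm z = 1" "nrm (1 - z) = 1"
proof -
  obtain n where n: "coprime n p" "z ^ n = 1" "z \<noteq> 1" using assms unfolding tame_root_def by blast
  have n0: "n > 0" using n(1) p_gt_1 by (cases n) auto
  show z: "nrm z = 1" by (rule nrm_root[OF n(2) n0])
  show "nrm (1 - z) = 1"
  proof (rule ccontr)
    assume a: "nrm (1 - z) \<noteq> 1"
    have "nrm (1 - z) \<le> 1" by (rule nrm_diff_leI) (simp_all add: nrm_1 z)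
    then have less: "nrm (z - 1) < 1" using a nrm_minus_commute[of 1 z] by linarith
    let ?S = "\<Sum>i<n. 1 ^ (n - Suc i) * z ^ i"
    have "nrm (?S - of_nat n * 1 ^ (n - 1)) \<le> nrm (z - 1)"
      by (rule power_quotient_close) (simp_all add: z nrm_1)
    moreover have "nrm (of_nat n :: 'k) = 1" using of_nat_Gp[OF n(1)] by (simp add: Gp_iff)
    ultimately have "nrm ?S = 1" using nrm_eq_of_close[of ?S "of_nat n"] less by simp
    then have "?S \<noteq> 0" by force
    then show False using power_diff_1_eq[of z n] n by simp
  qed
qed

section \<open>The measures of roots of unity and their densities\<close>

text \<open>Compatibility of the levels is the geometric sum \<open>\<Sum>\<^bsub>i<p\<^esub> Z\<^sup>i = (1 - Z\<^sup>p)/(1 - Z)\<close> with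
  \<open>Z = z ^ (p ^ m)\<close>.\<close>

lemma mu_z:
  assumes z: "tame_root z"
  shows "mu_z p z \<in> bounded_measures Zp"
    and "a < p ^ m \<Longrightarrow> mu_z p z (disc m a) = z ^ a / (1 - z ^ (p ^ m))"
proof -
  let ?v = "\<lambda>m a. z ^ a / (1 - z ^ (p ^ m))"
  have nz: "1 - z ^ (p ^ m) \<noteq> 0" for m
    using tame_root_power[OF z] unfolding tame_root_def by simp
  have ex: "\<exists>\<mu>\<in>bounded_measures Zp. \<forall>m a. a < p ^ m \<longrightarrow> \<mu> (disc m a) = ?v m a"
  proof (rule measure_from_levels[where B = 1])
    fix m a assume a: "a < p ^ m"
    let ?q = "p ^ m" let ?Z = "z ^ ?q"
    \<comment> \<open>The class of \<open>a\<close> modulo \<open>p ^ m\<close> splits into the classes of \<open>a + i p ^ m\<close> with \<open>i < p\<close>.\<close>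
    have "reps p (Suc m) (disc m a) = (\<lambda>i. a + i * ?q) ` {..<p}"
    proof (intro equalityI subsetI)
      fix b assume "b \<in> reps p (Suc m) (disc m a)"
      then have b: "b < p * ?q" "b mod ?q = a"
        using mem_disc_iff[OF a, of "of_nat b"] by (auto simp: reps_iff nat_residue_of_nat)
      then have "b = a + (b div ?q) * ?q" "b div ?q < p"
        using div_mult_mod_eq[of b ?q] less_mult_imp_div_less[of b p ?q] by auto
      then show "b \<in> (\<lambda>i. a + i * ?q) ` {..<p}" by blast
    next
      fix b assume "b \<in> (\<lambda>i. a + i * ?q) ` {..<p}"
      then obtain i where i: "b = a + i * ?q" "i < p" by auto
      then have "Suc i * ?q \<le> p * ?q" by (intro mult_right_mono) auto
      then have "b < p ^ Suc m" "b mod ?q = a" using i a by auto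
      then show "b \<in> reps p (Suc m) (disc m a)"
        using mem_disc_iff[OF a, of "of_nat b"] by (simp add: reps_iff nat_residue_of_nat)
    qed
    moreover have "inj_on (\<lambda>i. a + i * ?q) {..<p}" using p_power_pos[of m] by (auto simp: inj_on_def)
    ultimately have "(\<Sum>b\<in>reps p (Suc m) (disc m a). ?v (Suc m) b) = (\<Sum>i<p. z ^ (a + i * ?q) / (1 - z ^ (p ^ Suc m)))"
      by (simp add: sum.reindex)
    also have "\<dots> = z ^ a * (\<Sum>i<p. ?Z ^ i) / (1 - ?Z ^ p)"
      by (simp add: sum_distrib_left sum_divide_distrib power_add power_mult[symmetric] mult.commute)
    also have "\<dots> = ?v m a"
    proof -
      have "1 - ?Z ^ p \<noteq> 0" using nz[of "Suc m"] by (simp add: power_mult[symmetric] mult.commute)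
      then have "(\<Sum>i<p. ?Z ^ i) \<noteq> 0" unfolding one_diff_power_eq by auto
      then show ?thesis unfolding one_diff_power_eq by simp
    qed
    finally show "?v m a = (\<Sum>b\<in>reps p (Suc m) (disc m a). ?v (Suc m) b)" by simp
  next
    fix m a show "nrm (?v m a) \<le> 1"
      using tame_root_nrm[OF z] tame_root_nrm[OF tame_root_power[OF z]] by (simp add: nrm_divide nrm_power)
  qed
  have "\<exists>!\<mu>. \<mu> \<in> bounded_measures Zp \<and> (\<forall>m a. a < p ^ m \<longrightarrow> \<mu> (disc m a) = ?v m a)"
  proof (rule ex_ex1I)
    fix \<mu> \<nu> assume "\<mu> \<in> bounded_measures Zp \<and> (\<forall>m a. a < p ^ m \<longrightarrow> \<mu> (disc m a) = ?v m a)"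
      "\<nu> \<in> bounded_measures Zp \<and> (\<forall>m a. a < p ^ m \<longrightarrow> \<nu> (disc m a) = ?v m a)"
    then show "\<mu> = \<nu>" by (intro bmeas_eqI[OF _ _ periodic_Zp[of 0]]) (auto simp: reps_iff)
  qed (use ex in blast)
  from theI'[OF this, folded mu_z_def] show "mu_z p z \<in> bounded_measures Zp"
    "a < p ^ m \<Longrightarrow> mu_z p z (disc m a) = z ^ a / (1 - z ^ (p ^ m))" by blast+
qed

text \<open>The integrand that computes the measure of \<open>U\<close> with density \<open>h\<close>.\<close>

definition cutoff :: "('k \<Rightarrow> 'k) \<Rightarrow> 'k set \<Rightarrow> 'k \<Rightarrow> 'k" where
  "cutoff h U x = (if x \<in> U then h x else 0)"

lemma ucont_cutoff:
  assumes h: "ucont X h" and X: "X \<subseteq> Zp" and U: "periodic m U" shows "ucont X (cutoff h U)"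
  unfolding ucont_def
proof (intro allI impI)
  fix e :: real assume "e > 0"
  then obtain k where k: "\<forall>x\<in>X. \<forall>y\<in>X. nrm (x - y) \<le> pp k \<longrightarrow> nrm (h x - h y) \<le> e"
    using h unfolding ucont_def by blast
  have "nrm (cutoff h U x - cutoff h U y) \<le> e" if "x \<in> X" "y \<in> X" "nrm (x - y) \<le> pp (max k m)" for x y
  proof -
    have c: "nrm (x - y) \<le> pp k" "nrm (x - y) \<le> pp m" "nrm (y - x) \<le> pp m"
      using that(3) pp_antimono[of k "max k m"] pp_antimono[of m "max k m"] nrm_minus_commute[of x y] by auto
    have "x \<in> U \<longleftrightarrow> y \<in> U" using periodicD[OF U, of x y] periodicD[OF U, of y x] c that X by blast
    then show ?thesis using k c that \<open>e > 0\<close> by (auto simp: cutoff_def)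
  qed
  then show "\<exists>m0. \<forall>x\<in>X. \<forall>y\<in>X. nrm (x - y) \<le> pp m0 \<longrightarrow> nrm (cutoff h U x - cutoff h U y) \<le> e" by blast
qed

lemma density_LIMSEQ:
  assumes \<mu>: "\<mu> \<in> bounded_measures GG" and h: "ucont GG h" and U: "clopen Gp U"
  shows "riemann_sum GG (cutoff h U) \<mu> \<longlonglongrightarrow> density_measure p Gp h \<mu> U"
proof -
  obtain m where m: "periodic m U" using clopen_GpE[OF U] by blast
  have "(\<lambda>x. if x \<in> U then h x else 0) = cutoff h U" by (simp add: cutoff_def fun_eq_iff)
  then show ?thesis unfolding density_measure_def
    using U riemann_sum_LIMSEQ[OF periodic_Gp \<mu> ucont_cutoff[OF h _ m]] by (simp add: subsetI Gp_Zp)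
qed

lemma density_bmeas:
  assumes \<mu>: "\<mu> \<in> bounded_measures GG" and h: "ucont GG h" and h1: "\<And>x. x \<in> GG \<Longrightarrow> nrm (h x) \<le> 1"
  shows "density_measure p Gp h \<mu> \<in> bounded_measures GG"
proof -
  obtain B where B: "B \<ge> 0" "\<And>U. nrm (\<mu> U) \<le> B" using bmeas_bound[OF \<mu>] by blast
  note lims = density_LIMSEQ[OF \<mu> h]
  show ?thesis unfolding bounded_measures_def
  proof (intro CollectI conjI allI impI exI[of _ B])
    fix U V :: "'k set" assume c: "clopen Gp U" "clopen Gp V" "U \<inter> V = {}"
    then have "clopen Gp (U \<union> V)" unfolding clopen_def by (auto intro: closedin_Un)
    moreover have "riemann_sum GG (cutoff h (U \<union> V)) \<mu> = (\<lambda>m. riemann_sum GG (cutoff h U) \<mu> m + riemann_sum GG (cutoff h V) \<mu> m)"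
      unfolding riemann_sum_def sum.distrib[symmetric] using c(3) by (intro ext sum.cong refl) (auto simp: cutoff_def)
    ultimately show "density_measure p Gp h \<mu> (U \<union> V) = density_measure p Gp h \<mu> U + density_measure p Gp h \<mu> V"
      using LIMSEQ_unique[OF lims[of "U \<union> V"]] k_tendsto_add[OF lims[OF c(1)] lims[OF c(2)]] by simp
  next
    fix U :: "'k set"
    show "nrm (density_measure p Gp h \<mu> U) \<le> B"
    proof (cases "clopen Gp U")
      case True
      have "nrm (riemann_sum GG (cutoff h U) \<mu> m) \<le> B" for m
        unfolding riemann_sum_def using h1 B by (intro nrm_sum_le nrm_mult_leI1) (auto simp: cutoff_def reps_iff)
      then show ?thesis by (intro nrm_limit_le[OF lims[OF True]]) simp
    qed (use B in \<open>simp add: density_measure_def\<close>)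
  qed (simp add: density_measure_def)
qed

lemma Gp_nonzero: "x \<in> Gp \<Longrightarrow> x \<noteq> (0::'k)"
  by (auto simp: Gp_iff)

lemma inverse_close: assumes "x \<in> Gp" "y \<in> Gp" shows "nrm (inverse x - inverse y :: 'k) = nrm (x - y)"
proof -
  have "x \<noteq> 0" "y \<noteq> 0" using assms by (auto simp: Gp_iff)
  then have "inverse x - inverse y = (y - x) * (inverse x * inverse y)" by (simp add: field_simps)
  then show ?thesis using assms nrm_minus_commute[of x y] by (simp add: nrm_mult nrm_inverse Gp_iff)
qed

lemma ucont_inverse: "ucont GG inverse"
  unfolding ucont_def
proof (intro allI impI)
  fix e :: real assume "e > 0"
  then obtain m where "pp m < e" using pp_less by blast
  then show "\<exists>m0. \<forall>x\<in>GG. \<forall>y\<in>GG. nrm (x - y) \<le> pp m0 \<longrightarrow> nrm (inverse x - inverse y) \<le> e"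
    using inverse_close by (intro exI[of _ m]) auto
qed

lemma nu_z_bmeas: assumes "tame_root z" shows "nu_z p z \<in> bounded_measures GG"
  unfolding nu_z_def
  by (rule density_bmeas[OF restrict_measure_bmeas[OF mu_z(1)[OF assms] periodic_Gp] ucont_inverse])
    (simp add: nrm_inverse Gp_iff)

lemma nu_z_LIMSEQ:
  assumes z: "tame_root z" and U: "clopen Gp U"
  shows "(\<lambda>m. \<Sum>a\<in>reps p m GG. cutoff inverse U (of_nat a) * (z ^ a / (1 - z ^ (p ^ m)))) \<longlonglongrightarrow> nu_z p z U"
proof (rule Lim_transform_eventually)
  let ?\<mu> = "restrict_measure Gp (mu_z p z)"
  show "riemann_sum GG (cutoff inverse U) ?\<mu> \<longlonglongrightarrow> nu_z p z U"
    unfolding nu_z_def by (rule density_LIMSEQ[OF restrict_measure_bmeas[OF mu_z(1)[OF z] periodic_Gp] ucont_inverse U])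
  have "riemann_sum GG (cutoff inverse U) ?\<mu> m = (\<Sum>a\<in>reps p m GG. cutoff inverse U (of_nat a) * (z ^ a / (1 - z ^ (p ^ m))))"
    if m: "m \<ge> 1" for m
    unfolding riemann_sum_def
  proof (intro sum.cong refl)
    fix a assume a: "a \<in> reps p m GG"
    then have "?\<mu> (disc m a) = z ^ a / (1 - z ^ (p ^ m))"
      using units_disc(2)[OF m a] mu_z(2)[OF z, of a m] by (simp add: restrict_measure_def reps_iff)
    then show "cutoff inverse U (of_nat a) * ?\<mu> (disc m a) = cutoff inverse U (of_nat a) * (z ^ a / (1 - z ^ (p ^ m)))"
      by simp
  qed
  then show "\<forall>\<^sub>F m in sequentially. riemann_sum GG (cutoff inverse U) ?\<mu> m =
      (\<Sum>a\<in>reps p m GG. cutoff inverse U (of_nat a) * (z ^ a / (1 - z ^ (p ^ m))))"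
    unfolding eventually_sequentially by blast
qed

section \<open>The distribution relation\<close>

text \<open>Expanding \<open>1/(1 - w\<^sup>q) = (\<Sum>\<^bsub>i<u\<^esub> w\<^bsup>q i\<^esup>)/(1 - y\<^sup>q)\<close> for each \<open>u\<close>-th root \<open>w\<close> of \<open>y\<close>, the sum
  over \<open>w\<close> keeps the exponents \<open>c + q i\<close> divisible by \<open>u\<close>. As \<open>u\<close> is prime to \<open>q\<close> there is exactly one
  such \<open>i\<close>, and \<open>c\<close> was chosen so that this exponent is \<open>u a\<close>.\<close>

lemma distribution_level:
  fixes b \<zeta> :: 'k
  assumes \<zeta>: "primitive_root_of_unity u \<zeta>" and u: "coprime u p" and b: "tame_root (b ^ u)" and a: "a < p ^ m"
  defines "c \<equiv> (u * a) mod p ^ m"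
  shows "(\<Sum>k<u. (b * \<zeta> ^ k) ^ c / (1 - (b * \<zeta> ^ k) ^ (p ^ m))) = of_nat u * ((b ^ u) ^ a / (1 - (b ^ u) ^ (p ^ m)))"
proof -
  let ?q = "p ^ m" let ?y = "b ^ u"
  have u0: "u > 0" using \<zeta> by (simp add: primitive_root_of_unity_def)
  have y: "1 - ?y ^ ?q \<noteq> 0" using tame_root_power[OF b] by (simp add: tame_root_def)
  have wu: "(b * \<zeta> ^ k) ^ u = ?y" for k
  proof -
    have "(\<zeta> ^ k) ^ u = 1"
      using primitive_root_power_eq_1_iff[OF \<zeta>, of "k * u"] by (simp add: power_mult)
    then show ?thesis by (simp add: power_mult_distrib)
  qed
  have expand: "(b * \<zeta> ^ k) ^ c / (1 - (b * \<zeta> ^ k) ^ ?q) = (\<Sum>i<u. (b * \<zeta> ^ k) ^ (c + ?q * i)) / (1 - ?y ^ ?q)" for k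
  proof -
    let ?w = "b * \<zeta> ^ k"
    have e: "1 - ?y ^ ?q = (1 - ?w ^ ?q) * (\<Sum>i<u. (?w ^ ?q) ^ i)"
      unfolding one_diff_power_eq[symmetric] wu[of k, symmetric] by (simp add: power_mult[symmetric] mult.commute)
    then have "1 - ?w ^ ?q \<noteq> 0" using y by auto
    then have "?w ^ c / (1 - ?w ^ ?q) = ?w ^ c * (\<Sum>i<u. (?w ^ ?q) ^ i) / (1 - ?y ^ ?q)"
      using y unfolding e by (simp add: field_simps)
    then show ?thesis by (simp add: sum_distrib_left power_add power_mult)
  qed
  have orth: "(\<Sum>k<u. (b * \<zeta> ^ k) ^ t) = (if u dvd t then of_nat u * b ^ t else 0)" for t
  proof -
    have "(\<Sum>k<u. (b * \<zeta> ^ k) ^ t) = b ^ t * (\<Sum>k<u. (\<zeta> ^ t) ^ k)"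
      by (simp add: sum_distrib_left power_mult_distrib power_mult[symmetric] mult.commute)
    then show ?thesis using sum_primitive_root[OF \<zeta>, of t] by simp
  qed
  \<comment> \<open>The index of the only surviving exponent: \<open>u a = c + q i\<close> is division with remainder.\<close>
  define i where "i = (u * a) div ?q"
  have ua: "c + ?q * i = u * a" unfolding c_def i_def by simp
  have "u * a < u * ?q" using a u0 by simp
  then have iu: "i < u" unfolding i_def using p_power_pos[of m] by (simp add: less_mult_imp_div_less)
  have iff: "u dvd c + ?q * i' \<longleftrightarrow> i' = i" if "i' < u" for i'
  proof
    assume "u dvd c + ?q * i'"
    then have "[c + ?q * i' = c + ?q * i] (mod u)" unfolding ua by (simp add: cong_def mod_eq_0_iff_dvd)
    then have "[?q * i' = ?q * i] (mod u)" by (simp add: cong_add_lcancel_nat)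
    moreover have "coprime ?q u" using u by (simp add: coprime_commute)
    ultimately have "[i' = i] (mod u)" using cong_mult_lcancel_nat by blast
    then show "i' = i" using that iu by (simp add: cong_def)
  qed (simp add: ua)
  have "(\<Sum>k<u. (b * \<zeta> ^ k) ^ c / (1 - (b * \<zeta> ^ k) ^ ?q))
      = (\<Sum>i'<u. \<Sum>k<u. (b * \<zeta> ^ k) ^ (c + ?q * i')) / (1 - ?y ^ ?q)"
    unfolding expand sum_divide_distrib[symmetric] by (subst sum.swap) simp
  also have "(\<Sum>i'<u. \<Sum>k<u. (b * \<zeta> ^ k) ^ (c + ?q * i')) = (\<Sum>i'<u. if i' = i then of_nat u * b ^ (u * a) else 0)"
    unfolding orth by (intro sum.cong refl) (auto simp: iff ua)
  also have "\<dots> = of_nat u * ?y ^ a" using iu by (simp add: sum.delta power_mult)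
  finally show ?thesis by simp
qed

text \<open>Multiplication by a unit permutes the unit classes.\<close>

lemma sum_units_mult:
  assumes u: "coprime u p" and m: "m \<ge> 1"
  shows "(\<Sum>a\<in>reps p m GG. F ((u * a) mod p ^ m)) = (\<Sum>a\<in>reps p m GG. F a :: 'k)"
proof -
  let ?h = "\<lambda>a. (u * a) mod p ^ m"
  have cop: "coprime u (p ^ m)" using u by simp
  have "inj_on ?h (reps p m GG)"
  proof (rule inj_onI)
    fix x y assume "x \<in> reps p m GG" "y \<in> reps p m GG" "?h x = ?h y"
    then show "x = y" using cong_mult_lcancel_nat[OF cop, of x y] by (simp add: cong_def reps_iff)
  qed
  moreover have "?h ` reps p m GG \<subseteq> reps p m GG"
  proof (rule image_subsetI)
    fix a assume "a \<in> reps p m GG"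
    moreover have "periodic m GG" using periodic_mono[OF periodic_Gp] m by simp
    ultimately show "?h a \<in> reps p m GG"
      using nat_residue_in_reps[of m GG "of_nat (u * a)"] of_nat_Gp[OF u] Gp_mult[of "of_nat u" "of_nat a"]
      by (simp add: nat_residue_of_nat reps_iff del: of_nat_mult) simp
  qed
  ultimately have "bij_betw ?h (reps p m GG) (reps p m GG)" by (simp add: bij_betw_def endo_inj_surj)
  then show ?thesis by (rule sum.reindex_bij_betw)
qed

text \<open>At level \<open>m\<close> the classes are related by \<open>c \<equiv> u a\<close>; the factor \<open>u\<close> from
  \<open>distribution_level\<close> combines with the density \<open>1/c\<close> to \<open>u/c\<close>, which differs from \<open>1/a\<close> by at most
  \<open>p\<^sup>-\<^sup>m\<close>. So the two sides are limits of sequences with the same limit.\<close>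

lemma nu_z_distribution:
  fixes b \<zeta> :: 'k
  assumes \<zeta>: "primitive_root_of_unity u \<zeta>" and u: "coprime u p" and b: "tame_root (b ^ u)"
  shows "(\<Sum>k<u. nu_z p (b * \<zeta> ^ k) U) = pushforward Gp Gp (\<lambda>x. of_nat u * x) (nu_z p (b ^ u)) U"
proof (cases "clopen Gp U")
  case False
  then show ?thesis by (simp add: nu_z_def density_measure_def pushforward_def)
next
  case True
  let ?y = "b ^ u" and ?u = "of_nat u :: 'k"
  let ?V = "{x \<in> GG. ?u * x \<in> U}"
  obtain m0 where m0: "1 \<le> m0" "periodic m0 U" "U \<subseteq> Gp" using clopen_GpE[OF True] by blast
  have uG: "?u \<in> Gp" by (rule of_nat_Gp[OF u])
  have V: "clopen Gp ?V"
    by (rule clopen_periodicI[OF periodic_Gp periodic_mult_preimage[OF m0(2,1) uG]]) blast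
  have tame: "tame_root (b * \<zeta> ^ k)" for k
  proof -
    obtain n where n: "coprime n p" "?y ^ n = 1" "?y \<noteq> 1" using b unfolding tame_root_def by blast
    have "(\<zeta> ^ k) ^ u = 1" using primitive_root_power_eq_1_iff[OF \<zeta>, of "k * u"] by (simp add: power_mult)
    then have w: "(b * \<zeta> ^ k) ^ u = ?y" by (simp add: power_mult_distrib)
    then have "(b * \<zeta> ^ k) ^ (u * n) = 1" "b * \<zeta> ^ k \<noteq> 1" using n by (auto simp: power_mult)
    then show ?thesis unfolding tame_root_def using n(1) u by (metis coprime_mult_left_iff)
  qed
  let ?c = "\<lambda>m a. (u * a) mod p ^ m" and ?w = "\<lambda>k. b * \<zeta> ^ k"
  let ?t = "\<lambda>m a. ?y ^ a / (1 - ?y ^ (p ^ m))"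
  let ?S = "\<lambda>m. \<Sum>k<u. \<Sum>a\<in>reps p m GG. cutoff inverse U (of_nat a) * (?w k ^ a / (1 - ?w k ^ (p ^ m)))"
  let ?T = "\<lambda>m. \<Sum>a\<in>reps p m GG. cutoff inverse ?V (of_nat a) * ?t m a"
  have L: "?S \<longlonglongrightarrow> (\<Sum>k<u. nu_z p (?w k) U)"
    by (intro k_tendsto_sum nu_z_LIMSEQ tame True)
  have R: "?T \<longlonglongrightarrow> nu_z p ?y ?V"
    by (rule nu_z_LIMSEQ[OF b V])
  have eq: "?S m = (\<Sum>a\<in>reps p m GG. cutoff inverse U (of_nat (?c m a)) * (?u * ?t m a))" if m: "m \<ge> 1" for m
  proof -
    have "?S m = (\<Sum>a\<in>reps p m GG. cutoff inverse U (of_nat a) * (\<Sum>k<u. ?w k ^ a / (1 - ?w k ^ (p ^ m))))"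
      unfolding sum_distrib_left by (rule sum.swap)
    also have "\<dots> = (\<Sum>a\<in>reps p m GG. cutoff inverse U (of_nat (?c m a)) *
        (\<Sum>k<u. ?w k ^ ?c m a / (1 - ?w k ^ (p ^ m))))"
      by (rule sum_units_mult[OF u m, symmetric])
    also have "\<dots> = (\<Sum>a\<in>reps p m GG. cutoff inverse U (of_nat (?c m a)) * (?u * ?t m a))"
      by (rule sum.cong[OF refl]) (simp add: distribution_level[OF \<zeta> u b] reps_iff)
    finally show ?thesis .
  qed
  have close: "nrm (?S m - ?T m) \<le> pp m" if m: "m \<ge> m0" for m
  proof -
    have m1: "m \<ge> 1" using m m0 by simp
    have "nrm (\<Sum>a\<in>reps p m GG. (cutoff inverse U (of_nat (?c m a)) * ?u - cutoff inverse ?V (of_nat a)) * ?t m a) \<le> pp m"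
    proof (intro nrm_sum_le)
      fix a assume a: "a \<in> reps p m GG"
      have aG: "of_nat a \<in> GG" using a by (simp add: reps_iff)
      have uaG: "of_nat (u * a) \<in> GG" using Gp_mult[OF uG aG] by simp
      have cl: "nrm (of_nat (?c m a) - of_nat (u * a) :: 'k) \<le> pp m"
        using nrm_nat_diff_le_iff[of "?c m a" "u * a" m] by (simp add: cong_def)
      have cG: "of_nat (?c m a) \<in> GG"
        using periodicD[OF periodic_mono[OF periodic_Gp] uaG Zp_of_nat cl] m1 by simp
      have inU: "of_nat (?c m a) \<in> U \<longleftrightarrow> of_nat (u * a) \<in> U"
        using mem_periodic_iff_nat_residue[OF periodic_mono[OF m0(2) m] Zp_of_nat, of "u * a"] by (simp only: nat_residue_of_nat)
      have "nrm (cutoff inverse U (of_nat (?c m a)) * ?u - cutoff inverse ?V (of_nat a)) \<le> pp m"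
      proof (cases "of_nat (u * a) \<in> U")
        case True
        have "?u \<noteq> 0" "of_nat a \<noteq> (0::'k)" using Gp_nonzero[OF uG] Gp_nonzero[OF aG] by blast+
        then have "cutoff inverse U (of_nat (?c m a)) * ?u - cutoff inverse ?V (of_nat a) =
            ?u * (inverse (of_nat (?c m a)) - inverse (of_nat (u * a)))"
          using True inU aG by (simp add: cutoff_def field_simps)
        also have "nrm \<dots> \<le> pp m"
          using inverse_close[OF cG uaG] cl by (intro nrm_mult_leI1) (auto simp: nrm_of_nat_le)
        finally show ?thesis .
      next
        case False
        then show ?thesis using inU pp_pos[of m] by (simp add: cutoff_def)
      qed
      moreover have "nrm (?t m a) \<le> 1"
        using tame_root_nrm[OF b] tame_root_nrm[OF tame_root_power[OF b, of m]] by (simp add: nrm_divide nrm_power)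
      ultimately show "nrm ((cutoff inverse U (of_nat (?c m a)) * ?u - cutoff inverse ?V (of_nat a)) * ?t m a) \<le> pp m"
        using nrm_mult_leI[of _ "pp m" "?t m a" 1] by simp
    qed (use pp_pos[of m] in simp)
    then show ?thesis unfolding eq[OF m1] by (simp only: sum_subtractf left_diff_distrib mult.assoc)
  qed
  have "?S \<longlonglongrightarrow> nu_z p ?y ?V"
    by (rule lim_eq_of_diff_null[OF k_tendsto_bound[OF _ pp_tendsto] R])
      (unfold eventually_sequentially, use close in auto)
  then have "(\<Sum>k<u. nu_z p (?w k) U) = nu_z p ?y ?V" by (rule LIMSEQ_unique[OF L])
  then show ?thesis using True by (simp add: pushforward_def)
qed

end

section \<open>Moebius inversion\<close>

text \<open>A prime \<open>q\<close> dividing \<open>n\<close> pairs the squarefree divisors prime to \<open>q\<close> with the others by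
  \<open>d \<mapsto> q d\<close>, and the two members of a pair have opposite signs.\<close>

lemma sum_moebius: assumes "n > 0" shows "(\<Sum>d | d dvd n. moebius_mu d) = (if n = 1 then 1 else 0)"
proof (cases "n = 1")
  case False
  then obtain q where q: "prime q" "q dvd n" using prime_factor_nat by blast
  let ?D = "{d. d dvd n \<and> squarefree d}"
  let ?A = "{d \<in> ?D. \<not> q dvd d}" and ?B = "{d \<in> ?D. q dvd d}"
  have fin: "finite {d. d dvd n}" using assms by simp
  have "(\<Sum>d | d dvd n. moebius_mu d) = (\<Sum>d\<in>?D. moebius_mu d)"
    using fin by (intro sum.mono_neutral_right) (auto simp: moebius_mu_def)
  also have "?D = ?A \<union> ?B" by blast
  also have "sum moebius_mu (?A \<union> ?B) = sum moebius_mu ?A + sum moebius_mu ?B"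
    using fin by (intro sum.union_disjoint) auto
  also have "sum moebius_mu ?B = (\<Sum>d\<in>?A. moebius_mu (q * d))"
  proof (rule sum.reindex_bij_betw[symmetric, of "\<lambda>d. q * d"], rule bij_betwI[where g = "\<lambda>d. d div q"])
    show "(\<lambda>d. q * d) \<in> ?A \<rightarrow> ?B"
    proof
      fix d assume d: "d \<in> ?A"
      then have "coprime q d" using q(1) prime_imp_coprime by blast
      then show "q * d \<in> ?B" using d q by (auto simp: divides_mult squarefree_mult_coprime squarefree_prime)
    qed
    show "(\<lambda>d. d div q) \<in> ?B \<rightarrow> ?A"
    proof
      fix d assume "d \<in> ?B"
      then obtain e where e: "d = q * e" and d: "d dvd n" "squarefree d" by auto
      have "\<not> q dvd e"
      proof
        assume "q dvd e"
        then have "q\<^sup>2 dvd d" unfolding e power2_eq_square by simp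
        then show False using d(2) q(1) squarefreeD[of d q] by (auto simp: not_prime_unit)
      qed
      moreover have "squarefree e" "e dvd n" using d unfolding e by (auto intro: squarefree_multD dvd_mult_right)
      ultimately show "d div q \<in> ?A" using q(1) e by (auto simp: prime_gt_0_nat)
    qed
  qed (use q(1) in \<open>auto simp: prime_gt_0_nat\<close>)
  also have "(\<Sum>d\<in>?A. moebius_mu (q * d)) = (\<Sum>d\<in>?A. - moebius_mu d)"
  proof (intro sum.cong refl)
    fix d assume d: "d \<in> ?A"
    then have d0: "d \<noteq> 0" using assms by auto
    have "coprime q d" using d q(1) prime_imp_coprime by blast
    then have "squarefree (q * d)" using d q(1) by (simp add: squarefree_mult_coprime squarefree_prime)
    moreover have "prime_factors (q * d) = insert q (prime_factors d)"
      using q(1) d0 by (simp add: prime_factors_product prime_prime_factors prime_gt_0_nat)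
    moreover have "q \<notin> prime_factors d" using d by (auto simp: in_prime_factors_iff)
    ultimately show "moebius_mu (q * d) = - moebius_mu d" using d by (simp add: moebius_mu_def)
  qed
  finally show ?thesis using False by (simp add: sum_negf)
qed (simp add: moebius_mu_def)

lemma moebius_coprime:
  assumes "g > 0" shows "(\<Sum>d | d dvd g. if d dvd a then moebius_mu d else 0) = (if coprime a g then 1 else 0)"
proof -
  have "(\<Sum>d | d dvd g. if d dvd a then moebius_mu d else 0) = (\<Sum>d | d dvd gcd a g. moebius_mu d)"
    using assms by (intro sum.mono_neutral_cong_right) auto
  also have "\<dots> = (if gcd a g = 1 then 1 else 0)" by (rule sum_moebius) (use assms in simp)
  finally show ?thesis unfolding coprime_iff_gcd_eq_1 .
qed

text \<open>On the support of the character, being prime to \<open>f g\<close> means being prime to \<open>g\<close>, which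
  Moebius inversion detects by the divisors \<open>d\<close> of \<open>g\<close>; writing \<open>a = d b\<close> extracts the value at \<open>d\<close>, which
  is zero unless \<open>d\<close> is prime to \<open>f\<close>.\<close>

lemma moebius_packet:
  fixes \<psi> \<Phi> :: "nat \<Rightarrow> 'a::comm_ring_1"
  assumes N: "f * g > 0" and mult: "\<And>a b. \<psi> (a * b) = \<psi> a * \<psi> b" and zero: "\<And>a. \<not> coprime a f \<Longrightarrow> \<psi> a = 0"
  shows "(\<Sum>a<f * g. if coprime a (f * g) then \<psi> a * \<Phi> a else 0) =
    (\<Sum>d | d dvd g \<and> coprime d f. of_int (moebius_mu d) * \<psi> d * (\<Sum>b<f * (g div d). \<psi> b * \<Phi> (d * b)))"
proof -
  have g: "g > 0" using N by simp
  have fin: "finite {d. d dvd g}" using g by simp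
  have "(\<Sum>a<f * g. if coprime a (f * g) then \<psi> a * \<Phi> a else 0) =
    (\<Sum>a<f * g. \<Sum>d | d dvd g. if d dvd a then of_int (moebius_mu d) * (\<psi> a * \<Phi> a) else 0)"
  proof (intro sum.cong refl)
    fix a
    have "(\<Sum>d | d dvd g. if d dvd a then of_int (moebius_mu d) * (\<psi> a * \<Phi> a) else 0) =
        of_int (\<Sum>d | d dvd g. if d dvd a then moebius_mu d else 0) * (\<psi> a * \<Phi> a)"
      by (simp add: sum_distrib_right if_distrib[of of_int] if_distrib[of "\<lambda>x. x * _"] cong: if_cong)
    also have "\<dots> = (if coprime a (f * g) then \<psi> a * \<Phi> a else 0)"
      unfolding moebius_coprime[OF g] using zero[of a] by (cases "coprime a f") auto
    finally show "(if coprime a (f * g) then \<psi> a * \<Phi> a else 0) =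
        (\<Sum>d | d dvd g. if d dvd a then of_int (moebius_mu d) * (\<psi> a * \<Phi> a) else 0)" by simp
  qed
  also have "\<dots> = (\<Sum>d | d dvd g. \<Sum>a<f * g. if d dvd a then of_int (moebius_mu d) * (\<psi> a * \<Phi> a) else 0)"
    by (rule sum.swap)
  also have "\<dots> = (\<Sum>d | d dvd g. of_int (moebius_mu d) * \<psi> d * (\<Sum>b<f * (g div d). \<psi> b * \<Phi> (d * b)))"
  proof (intro sum.cong refl)
    fix d assume "d \<in> {d. d dvd g}"
    then obtain u where u: "g = d * u" by auto
    then have d0: "d > 0" using g by simp
    have "(\<Sum>a<f * g. if d dvd a then of_int (moebius_mu d) * (\<psi> a * \<Phi> a) else 0) =
        (\<Sum>a\<in>(\<lambda>b. d * b) ` {..<f * u}. of_int (moebius_mu d) * (\<psi> a * \<Phi> a))"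
    proof (rule sum.mono_neutral_cong_right)
      show "(\<lambda>b. d * b) ` {..<f * u} \<subseteq> {..<f * g}" using d0 unfolding u by (auto simp: mult.left_commute)
      show "\<forall>a\<in>{..<f * g} - (\<lambda>b. d * b) ` {..<f * u}. (if d dvd a then of_int (moebius_mu d) * (\<psi> a * \<Phi> a) else 0) = 0"
        using d0 unfolding u by (auto simp: mult.left_commute[of f d] elim!: dvdE)
    qed auto
    also have "\<dots> = (\<Sum>b<f * u. of_int (moebius_mu d) * (\<psi> (d * b) * \<Phi> (d * b)))"
      using d0 by (subst sum.reindex) (auto simp: inj_on_def)
    also have "\<dots> = of_int (moebius_mu d) * \<psi> d * (\<Sum>b<f * (g div d). \<psi> b * \<Phi> (d * b))"
      unfolding mult u using d0 by (simp add: sum_distrib_left mult_ac)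
    finally show "(\<Sum>a<f * g. if d dvd a then of_int (moebius_mu d) * (\<psi> a * \<Phi> a) else 0) =
      of_int (moebius_mu d) * \<psi> d * (\<Sum>b<f * (g div d). \<psi> b * \<Phi> (d * b))" .
  qed
  also have "\<dots> = (\<Sum>d | d dvd g \<and> coprime d f. of_int (moebius_mu d) * \<psi> d * (\<Sum>b<f * (g div d). \<psi> b * \<Phi> (d * b)))"
    using fin zero by (intro sum.mono_neutral_right) auto
  finally show ?thesis .
qed

section \<open>Dirichlet characters and Gauss sums\<close>

lemma dirichlet_char_cong:
  assumes d: "dirichlet_char M \<psi>" and ab: "[a = b] (mod int M)" shows "\<psi> a = \<psi> b"
proof -
  have shift: "\<psi> (x + int M * int t) = \<psi> x" for x t
  proof (induction t)
    case (Suc t)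
    have "\<psi> (x + int M * int (Suc t)) = \<psi> ((x + int M * int t) + int M)" by (simp add: algebra_simps)
    then show ?case using Suc d unfolding dirichlet_char_def by metis
  qed simp
  obtain k where k: "b = a + int M * k" using ab unfolding cong_iff_lin by blast
  show ?thesis
  proof (cases "k \<ge> 0")
    case True
    then show ?thesis using shift[of a "nat k"] k by simp
  next
    case False
    then show ?thesis using shift[of b "nat (- k)"] k by simp
  qed
qed

lemma dirichlet_char_mod: "dirichlet_char M \<psi> \<Longrightarrow> \<psi> (int (k mod M)) = \<psi> (int k)"
  by (rule dirichlet_char_cong) (auto simp: cong_def zmod_int)

lemma dirichlet_char_nat:
  assumes "dirichlet_char M \<psi>"
  shows "\<psi> (int (a * b)) = \<psi> (int a) * \<psi> (int b)" "\<psi> (int a) = 0 \<longleftrightarrow> \<not> coprime a M" "\<psi> (int 1) = 1" "M > 0"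
  using assms unfolding dirichlet_char_def by (simp_all del: int_ops(1,2,3))

lemma sum_totatives:
  assumes "n > 1" shows "(\<Sum>a\<in>totatives n. F a) = (\<Sum>a<n. if coprime a n then F a else (0::'a::comm_monoid_add))"
proof -
  have "totatives n \<subseteq> {..<n}"
  proof
    fix a assume a: "a \<in> totatives n"
    then have "a \<noteq> n" using assms by (auto simp: totatives_def)
    then show "a \<in> {..<n}" using a by (auto simp: totatives_def)
  qed
  moreover have "a \<in> totatives n" if "coprime a n" "a < n" for a
    using that assms by (cases "a = 0") (auto simp: totatives_def)
  ultimately show ?thesis by (intro sum.mono_neutral_cong_left) (auto simp: totatives_def)
qed

lemma sum_lessThan_mult:
  fixes F :: "nat \<Rightarrow> 'a::comm_monoid_add"
  shows "(\<Sum>b<f * u. F b) = (\<Sum>k<u. \<Sum>b<f. F (b + f * k))"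
proof -
  have "sum F {k * f..<k * f + f} = (\<Sum>b<f. F (b + f * k))" for k
    using sum.shift_bounds_nat_ivl[of F 0 "f * k" f] by (simp add: lessThan_atLeast0 add.commute mult.commute)
  then show ?thesis using sum.nat_group[of F f u] by (simp add: mult.commute)
qed

text \<open>The twisted sums \<open>T b = \<Sum>\<^sub>a \<chi>(a) z\<^bsup>a b\<^esup>\<close> satisfy \<open>\<chi>(c) T(c b) = T b\<close> for units \<open>c\<close>. For \<open>b\<close>
  prime to \<open>f\<close> this makes \<open>T b\<close> a multiple of the Gauss sum \<open>T 1\<close>; for other \<open>b\<close> primitivity provides a
  unit \<open>c\<close> with \<open>c b \<equiv> b\<close> and \<open>\<chi>(c) \<noteq> 1\<close>, so \<open>T b = 0\<close>. If the Gauss sum vanished, all \<open>T b\<close> would, but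
  Fourier inversion of \<open>T\<close> at \<open>1\<close> gives \<open>f\<close>.\<close>

lemma gauss_sum_nonzero:
  fixes \<psi> :: "int \<Rightarrow> 'a::field_char_0"
  assumes prim: "primitive_char f \<psi>" and f: "f > 1" and z: "primitive_root_of_unity f z"
  shows "gauss_sum f \<psi> z \<noteq> 0"
proof
  assume G0: "gauss_sum f \<psi> z = 0"
  have d: "dirichlet_char f \<psi>" using prim by (simp add: primitive_char_def)
  let ?X = "\<lambda>a. \<psi> (int a)"
  note X = dirichlet_char_nat[OF d] and Xmod = dirichlet_char_mod[OF d]
  define T where "T b = (\<Sum>a<f. ?X a * z ^ (a * b))" for b
  have zf: "z ^ f = 1" using z by (simp add: primitive_root_of_unity_def)
  have periodic: "?X (k mod f) * z ^ ((k mod f) * b) = ?X k * z ^ (k * b)" for k b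
  proof -
    have "[(k mod f) * b = k * b] (mod f)" by (simp add: cong_def mod_mult_left_eq)
    then show ?thesis unfolding Xmod using root_power_cong[OF zf] by metis
  qed
  have shift: "?X c * T (c * b) = T b" if "coprime c f" for b c
  proof -
    have "?X c * T (c * b) = (\<Sum>a<f. ?X (c * a) * z ^ ((c * a) * b))"
      unfolding T_def X(1) by (simp add: sum_distrib_left mult_ac)
    also have "\<dots> = T b" unfolding T_def
      by (rule sum_mod_mult[OF that, of "\<lambda>a. ?X a * z ^ (a * b)"]) (use periodic X in auto)
    finally show ?thesis .
  qed
  have "T 1 = gauss_sum f \<psi> z"
    unfolding T_def gauss_sum_def sum_totatives[OF f] using X(2) by (intro sum.cong refl) auto
  then have T1: "T 1 = 0" using G0 by simp
  have T0: "T b = 0" for b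
  proof (cases "coprime b f")
    case True
    then show ?thesis using shift[OF True, of 1] T1 X(2)[of b] by simp
  next
    case False
    define e where "e = gcd b f"
    have e: "e > 1" using False X(4) gcd_pos_nat[of b f] unfolding e_def coprime_iff_gcd_eq_1 by linarith
    have ef: "e dvd f" "e dvd b" unfolding e_def by simp_all
    then obtain k where k: "f = e * k" by blast
    then have "k dvd f \<and> k < f" using e X(4) by auto
    then obtain a where a: "coprime a (int f)" "[a = 1] (mod int k)" "\<psi> a \<noteq> 1"
      using prim unfolding primitive_char_def by blast
    \<comment> \<open>A natural number congruent to the integer that primitivity provides.\<close>
    define c where "c = nat (a mod int f)"
    have c: "int c = a mod int f" unfolding c_def using X(4) by simp
    have "coprime (int c) (int f)" unfolding c using a(1) X(4) by (simp add: coprime_mod_left_iff)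
    then have cf: "coprime c f" by simp
    have "[int c = 1] (mod int k)"
    proof -
      have "(a mod int f) mod int k = a mod int k" by (rule mod_mod_cancel) (simp add: k)
      then show ?thesis using a(2) unfolding c cong_def by simp
    qed
    then have "[c = 1] (mod k)" using cong_int_iff[of c 1 k] by simp
    then have "[c * e = 1 * e] (mod k * e)" by (rule cong_cmult_rightI)
    then have "[c * e = e] (mod f)" by (simp add: k mult.commute)
    moreover obtain b' where "b = e * b'" using ef by blast
    ultimately have cb: "[c * b = b] (mod f)" using cong_mult[of "c * e" e f b' b'] by (simp add: mult.assoc)
    have "z ^ (a' * (c * b)) = z ^ (a' * b)" for a'
      by (rule root_power_cong[OF zf]) (rule cong_scalar_left[OF cb])
    then have "T (c * b) = T b" unfolding T_def by simp
    moreover have "?X c \<noteq> 1"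
    proof -
      have "\<psi> a = ?X c" by (rule dirichlet_char_cong[OF d]) (simp add: c cong_def)
      then show ?thesis using a(3) by simp
    qed
    ultimately show ?thesis using shift[OF cf, of b] by (metis mult_cancel_right1)
  qed
  \<comment> \<open>The exponent \<open>f - 1\<close> stands for \<open>-1\<close>.\<close>
  have "(\<Sum>b<f. T b * z ^ ((f - 1) * b)) = (\<Sum>a<f. ?X a * (\<Sum>b<f. (z ^ (a + (f - 1))) ^ b))"
  proof -
    have "(\<Sum>b<f. T b * z ^ ((f - 1) * b)) = (\<Sum>b<f. \<Sum>a<f. ?X a * (z ^ (a + (f - 1))) ^ b)"
    proof -
      have "z ^ (a * b) * z ^ ((f - 1) * b) = (z ^ (a + (f - 1))) ^ b" for a b
        by (simp only: power_add[symmetric] power_mult[symmetric] add_mult_distrib)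
      then show ?thesis unfolding T_def sum_distrib_right by (simp only: mult.assoc)
    qed
    also have "\<dots> = (\<Sum>a<f. ?X a * (\<Sum>b<f. (z ^ (a + (f - 1))) ^ b))"
      unfolding sum_distrib_left by (rule sum.swap)
    finally show ?thesis .
  qed
  also have "\<dots> = (\<Sum>a<f. if a = 1 then of_nat f else 0)"
  proof (intro sum.cong refl)
    fix a assume "a \<in> {..<f}"
    then have a: "a < f" by simp
    have "f dvd a + (f - 1) \<longleftrightarrow> a = 1"
    proof
      assume "f dvd a + (f - 1)"
      then obtain t where t: "a + (f - 1) = f * t" by blast
      then have "f * t < f * 2" using a f by linarith
      then have "t < 2" by simp
      moreover have "t \<noteq> 0"
      proof
        assume "t = 0"
        then show False using t f by simp
      qed
      ultimately have "t = 1" by simp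
      then show "a = 1" using t f by simp
    qed (use f in simp)
    then show "?X a * (\<Sum>b<f. (z ^ (a + (f - 1))) ^ b) = (if a = 1 then of_nat f else 0)"
      unfolding sum_primitive_root[OF z] using X(3) by auto
  qed
  also have "\<dots> = of_nat f" using f by simp
  finally show False unfolding T0 using f by simp
qed

section \<open>Character packets\<close>

context padic_ext begin

lemma tame_primitive:
  assumes z: "primitive_root_of_unity M z" and M: "coprime M p" "\<not> M dvd a" shows "tame_root (z ^ a)"
proof -
  have "(z ^ a) ^ M = 1" using primitive_root_power_eq_1_iff[OF z, of "a * M"] by (simp add: power_mult)
  then show ?thesis unfolding tame_root_def using M primitive_root_power_eq_1_iff[OF z, of a] by blast
qed

lemma not_dvd_coprime: "coprime a M \<Longrightarrow> M > 1 \<Longrightarrow> \<not> M dvd (a::nat)"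
  by (metis coprime_absorb_right nat_dvd_1_iff_1 less_irrefl coprime_commute dvd_refl)

lemma nu_packet_bmeas:
  assumes z: "primitive_root_of_unity M z" and M: "coprime M p" "M > 1"
  shows "nu_packet p M \<psi> z \<in> bounded_measures GG"
proof -
  have "(\<lambda>U. \<Sum>a\<in>totatives M. \<psi> (int a) * nu_z p (z ^ a) U) \<in> bounded_measures GG"
  proof (rule bmeas_lincomb[OF periodic_Gp])
    fix a assume "a \<in> totatives M"
    then have "\<not> M dvd a" using not_dvd_coprime M(2) by (simp add: totatives_def)
    then show "nu_z p (z ^ a) \<in> bounded_measures GG" using nu_z_bmeas tame_primitive[OF z M(1)] by blast
  qed simp
  then show ?thesis unfolding nu_packet_def[abs_def] .
qed

lemma pushforward_bmeas:
  fixes \<rho> :: "'k set \<Rightarrow> 'k"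
  assumes "\<rho> \<in> bounded_measures GG" "x \<in> GG" shows "pushforward Gp Gp (\<lambda>y. x * y) \<rho> \<in> bounded_measures GG"
  unfolding conv_dirac[OF assms, symmetric] by (rule conv_bmeas[OF dirac_bmeas[OF periodic_Gp] assms(1)])

text \<open>Writing the summation variable as \<open>b + f k\<close>, the roots \<open>z\<^bsup>d(b + f k)\<^esup>\<close> with \<open>k < u\<close> are
  all the \<open>u\<close>-th roots of \<open>z\<^bsup>g b\<^esup>\<close>, so the distribution relation applies to the inner sum. Classes \<open>b\<close>
  not prime to \<open>f\<close>, for which this root may be \<open>1\<close>, have character value zero.\<close>

lemma packet_distribution:
  fixes z :: 'k
  assumes z: "primitive_root_of_unity (f * g) z" and fg: "coprime (f * g) p" "f > 1"
    and \<psi>: "dirichlet_char f \<psi>" and u: "g = d * u"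
  shows "(\<Sum>b<f * u. \<psi> (int b) * nu_z p (z ^ (d * b)) U) =
    pushforward Gp Gp (\<lambda>x. of_nat u * x) (nu_packet p f \<psi> (z ^ g)) U"
proof -
  note X = dirichlet_char_nat[OF \<psi>]
  have cop: "coprime u p" "coprime f p" using fg(1) unfolding u by simp_all
  have zeta: "primitive_root_of_unity u (z ^ (d * f))"
    by (rule primitive_root_power) (use z u in \<open>simp add: mult_ac\<close>)
  have zf: "primitive_root_of_unity f (z ^ g)"
    by (rule primitive_root_power) (use z in \<open>simp add: mult_ac\<close>)
  have "(\<Sum>b<f * u. \<psi> (int b) * nu_z p (z ^ (d * b)) U) =
      (\<Sum>b<f. \<Sum>k<u. \<psi> (int (b + f * k)) * nu_z p (z ^ (d * (b + f * k))) U)"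
    unfolding sum_lessThan_mult by (rule sum.swap)
  also have "\<dots> = (\<Sum>b<f. \<psi> (int b) * pushforward Gp Gp (\<lambda>x. of_nat u * x) (nu_z p ((z ^ g) ^ b)) U)"
  proof (intro sum.cong refl)
    fix b
    have "\<psi> (int (b + f * k)) = \<psi> (int b)" for k
      using dirichlet_char_mod[OF \<psi>, of "b + f * k"] dirichlet_char_mod[OF \<psi>, of b] by simp
    then have "(\<Sum>k<u. \<psi> (int (b + f * k)) * nu_z p (z ^ (d * (b + f * k))) U) =
        \<psi> (int b) * (\<Sum>k<u. nu_z p (z ^ (d * b) * (z ^ (d * f)) ^ k) U)"
      by (simp only: sum_distrib_left distrib_left power_add power_mult mult.assoc)
    also have "\<dots> = \<psi> (int b) * pushforward Gp Gp (\<lambda>x. of_nat u * x) (nu_z p ((z ^ g) ^ b)) U"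
    proof (cases "coprime b f")
      case True
      have e: "(z ^ (d * b)) ^ u = (z ^ g) ^ b" unfolding u power_mult[symmetric] by (simp add: mult_ac)
      have "tame_root ((z ^ (d * b)) ^ u)"
        unfolding e by (rule tame_primitive[OF zf cop(2) not_dvd_coprime[OF True fg(2)]])
      from nu_z_distribution[OF zeta cop(1) this] show ?thesis unfolding e by simp
    qed (use X(2) in simp)
    finally show "(\<Sum>k<u. \<psi> (int (b + f * k)) * nu_z p (z ^ (d * (b + f * k))) U) =
        \<psi> (int b) * pushforward Gp Gp (\<lambda>x. of_nat u * x) (nu_z p ((z ^ g) ^ b)) U" .
  qed
  also have "\<dots> = pushforward Gp Gp (\<lambda>x. of_nat u * x) (nu_packet p f \<psi> (z ^ g)) U"
    unfolding pushforward_def nu_packet_def sum_totatives[OF fg(2)] using X(2) by (auto intro!: sum.cong)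
  finally show ?thesis .
qed

lemma nu_packet_imprimitive:
  fixes z :: 'k
  assumes z: "primitive_root_of_unity N z" and N: "N = f * g" "\<not> p dvd N" and f: "f > 1"
    and \<psi>: "dirichlet_char f \<psi>" and ind: "induced_char N \<psi>' f \<psi>"
  shows "nu_packet p N \<psi>' z = nu_fg p f g \<psi> (z ^ g)"
proof
  fix U
  note X = dirichlet_char_nat[OF \<psi>]
  have N0: "f * g > 0" using z N by (simp add: primitive_root_of_unity_def)
  then have g0: "g > 0" and N1: "N > 1" using f N by (auto intro: less_le_trans)
  have cop: "coprime (f * g) p" using N prime_p by (metis coprime_commute prime_imp_coprime)
  let ?push = "\<lambda>u. pushforward Gp Gp (\<lambda>x. of_nat u * x) (nu_packet p f \<psi> (z ^ g)) U"
  have "nu_packet p N \<psi>' z U = (\<Sum>a<f * g. if coprime a (f * g) then \<psi> (int a) * nu_z p (z ^ a) U else 0)"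
    unfolding nu_packet_def sum_totatives[OF N1] unfolding N
    using ind unfolding induced_char_def N by (intro sum.cong refl) simp
  also have "\<dots> = (\<Sum>d | d dvd g \<and> coprime d f. of_int (moebius_mu d) * \<psi> (int d) *
      (\<Sum>b<f * (g div d). \<psi> (int b) * nu_z p (z ^ (d * b)) U))"
    by (rule moebius_packet[OF N0, of "\<lambda>a. \<psi> (int a)"]) (use X in auto)
  also have "\<dots> = (\<Sum>d | d dvd g \<and> coprime d f. of_int (moebius_mu d) * \<psi> (int d) * ?push (g div d))"
    using z cop f \<psi> unfolding N by (intro sum.cong refl arg_cong2[where f = "(*)"] packet_distribution) auto
  also have "\<dots> = (\<Sum>u | u dvd g \<and> coprime (g div u) f.
      of_int (moebius_mu (g div u)) * \<psi> (int (g div u)) * ?push u)"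
    by (rule sum.reindex_bij_witness[where i = "\<lambda>u. g div u" and j = "\<lambda>d. g div d"])
      (use g0 in \<open>auto simp: div_div_eq_right\<close>)
  finally show "nu_packet p N \<psi>' z U = nu_fg p f g \<psi> (z ^ g) U" unfolding nu_fg_def .
qed

lemma mellin_nu_fg:
  assumes "nu_packet p f \<psi> z \<in> bounded_measures GG" and g: "coprime g p" "g > 0" and s: "s \<in> Zp"
  shows "mellin p j (nu_fg p f g \<psi> z) s = C_Iw p f g \<psi> j s * mellin p j (nu_packet p f \<psi> z) s"
proof -
  let ?I = "{u. u dvd g \<and> coprime (g div u) f}"
  have uG: "of_nat u \<in> GG" if "u \<in> ?I" for u
    using that g(1) coprime_divisors[of u g p p] by (intro of_nat_Gp) simp
  have fin: "finite ?I" using g(2) by simp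
  have "mellin p j (nu_fg p f g \<psi> z) s = (\<Sum>u\<in>?I. of_int (moebius_mu (g div u)) * \<psi> (int (g div u)) *
      mellin p j (pushforward Gp Gp (\<lambda>x. of_nat u * x) (nu_packet p f \<psi> z)) s)"
    unfolding nu_fg_def[abs_def] by (rule mellin_lincomb[OF fin pushforward_bmeas[OF assms(1) uG] s])
  also have "\<dots> = (\<Sum>u\<in>?I. of_int (moebius_mu (g div u)) * \<psi> (int (g div u)) *
      (mellin_kernel j s (of_nat u) * mellin p j (nu_packet p f \<psi> z) s))"
    by (intro sum.cong refl) (simp only: mellin_pushforward[OF assms(1) uG s])
  also have "\<dots> = C_Iw p f g \<psi> j s * mellin p j (nu_packet p f \<psi> z) s"
    unfolding C_Iw_def mellin_kernel_def sum_distrib_right by (simp only: mult.assoc)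
  finally show ?thesis .
qed

text \<open>For \<open>n \<equiv> j\<close> modulo \<open>p - 1\<close> the two parts of the kernel recombine to \<open>x\<^sup>n\<close>.\<close>

lemma mellin_kernel_of_nat:
  assumes x: "x \<in> GG" and j: "[int n = j] (mod int (p - 1))" shows "mellin_kernel j (of_nat n) x = x ^ n"
proof -
  let ?w = "teich p x"
  obtain k where k: "j = int n + int (p - 1) * k" using j unfolding cong_iff_lin by blast
  have w0: "?w \<noteq> 0" by (rule teich_nz[OF x])
  have "?w powi j = ?w ^ n * (?w powi int (p - 1)) powi k"
    unfolding k using w0 by (simp add: power_int_add power_int_mult)
  also have "\<dots> = ?w ^ n" using teich(2)[OF x] by simp
  finally show ?thesis unfolding mellin_kernel_def padic_pow_of_nat[OF one_unit_principal[OF x]]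
    using w0 by (simp add: one_unit_def power_divide)
qed

lemma C_Iw_of_nat:
  assumes g: "coprime g p" and j: "[int n = j] (mod int (p - 1))"
  shows "C_Iw p f g \<psi> j (of_nat n :: 'k) = C_int f g \<psi> n"
  unfolding C_Iw_def C_int_def mellin_kernel_def[symmetric]
proof (rule sum.cong[OF refl])
  fix u assume u: "u \<in> {u. u dvd g \<and> coprime (g div u) f}"
  then have "coprime u p" using g coprime_divisors[of u g p p] by simp
  then have "of_nat u \<in> GG" by (rule of_nat_Gp)
  then show "of_int (moebius_mu (g div u)) * \<psi> (int (g div u)) * mellin_kernel j (of_nat n) (of_nat u) =
      of_int (moebius_mu (g div u)) * \<psi> (int (g div u)) * of_nat u ^ n"
    by (simp only: mellin_kernel_of_nat[OF _ j])
qed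

section \<open>Mellin transforms of fractions\<close>

lemma Lambda_simps:
  "carrier (Lambda p) = bounded_measures GG" "x \<otimes>\<^bsub>Lambda p\<^esub> y = conv p x y" "\<one>\<^bsub>Lambda p\<^esub> = dirac GG 1"
  by (simp_all add: Lambda_def)

text \<open>Cross-multiplied form of \<open>M\<^bsub>(\<rho> \<nu>)/r\<^esub> = M\<^bsub>\<rho>/r\<^esub> M\<^sub>\<nu>\<close>, valid for all representatives and at all
  points. For \<open>\<nu>\<close> the unit it says that the quotient of transforms is independent of the
  representative.\<close>

lemma mellin_frac_cross:
  assumes \<rho>: "\<rho> \<in> bounded_measures GG" and \<nu>: "\<nu> \<in> bounded_measures GG" and r: "r \<in> Sigma_r p"
    and A: "(A, t) \<in> Lambda_frac p (conv p \<rho> \<nu>) r" and B: "(B, v) \<in> Lambda_frac p \<rho> r" and s: "s \<in> Zp"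
  shows "mellin p j A s * mellin p j v s = mellin p j B s * mellin p j \<nu> s * mellin p j t s"
proof -
  have car: "A \<in> bounded_measures GG" "t \<in> bounded_measures GG" "B \<in> bounded_measures GG" "v \<in> bounded_measures GG"
    using A B Sigma_r_bmeas unfolding ring_frac_def Lambda_simps by auto
  obtain x where x: "x \<in> Sigma_r p" "conv p x (conv p A v) = conv p x (conv p (conv p B \<nu>) t)"
    using ring_frac_cross[OF Lambda_comm_monoid, of "Sigma_r p" \<rho> \<nu> r A t B v]
      Sigma_r_bmeas Sigma_r_conv \<rho> \<nu> r A B unfolding Lambda_simps by blast
  have "mellin p j (conv p A v) s = mellin p j (conv p (conv p B \<nu>) t) s"
    by (rule mellin_cancel[OF x(1) _ _ x(2) s]) (intro conv_bmeas car \<nu>)+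
  then show ?thesis by (simp add: mellin_conv conv_bmeas car \<nu> s)
qed

lemma mellin_frac_eqI:
  assumes "(A, r) \<in> X" "mellin p j r s \<noteq> 0"
    and "\<And>A' r'. (A', r') \<in> X \<Longrightarrow> mellin p j A' s * mellin p j r s = mellin p j A s * mellin p j r' s"
  shows "mellin_frac p j X s = mellin p j A s / mellin p j r s"
  unfolding mellin_frac_def
proof (rule the_equality)
  show "\<exists>(A', r')\<in>X. mellin p j r' s \<noteq> 0 \<and> mellin p j A s / mellin p j r s = mellin p j A' s / mellin p j r' s"
    using assms(1,2) by blast
  fix v assume "\<exists>(A', r')\<in>X. mellin p j r' s \<noteq> 0 \<and> v = mellin p j A' s / mellin p j r' s"
  then obtain A' r' where "(A', r') \<in> X" "mellin p j r' s \<noteq> 0" "v = mellin p j A' s / mellin p j r' s" by blast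
  then show "v = mellin p j A s / mellin p j r s" using assms(2) assms(3)[of A' r'] by (simp add: frac_eq_eq)
qed

end

theorem theorem4p36:
  fixes p N f g c :: nat
    and chiN chif :: "int \<Rightarrow> 'k::{field_char_0,complete_space}"
    and zetaN zetaf :: 'k
  assumes K: "padic_field p TYPE('k)"
    and p: "prime p" "odd p"
    and chiN: "dirichlet_char N chiN" "odd_char chiN"
    and chif: "primitive_char f chif" "odd_char chif" "f > 1"
    and ind: "induced_char N chiN f chif"
    and N: "N = f * g" "\<not> p dvd N"
    and zeta: "primitive_root_of_unity N zetaN" "zetaf = zetaN ^ g"
    and c: "odd c" "1 < c" "coprime c p"
  shows "(I_packet p c N chiN zetaN =
           Z_half p c \<otimes>\<^bsub>Lambda_loc p\<^esub> Lambda_frac p (nu_fg p f g chif zetaf) \<one>\<^bsub>Lambda p\<^esub>)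
    \<and> (\<forall>(j::int). \<forall>s\<in>Zp. mellin_regular p j (Z_half p c) s \<longrightarrow>
           mellin_regular p j (I_packet p c N chiN zetaN) s \<and>
           mellin_frac p j (I_packet p c N chiN zetaN) s =
             gauss_sum f chif zetaf * mellin_frac p j (Z_half p c) s *
             C_Iw p f g chif j s * L_padic p f chif zetaf j s)
    \<and> (\<forall>(j::int). \<forall>(A, r) \<in> I_packet p c N chiN zetaN. \<forall>(B, t) \<in> Z_half p c. \<forall>s\<in>Zp.
           mellin p j A s * mellin p j t s =
             gauss_sum f chif zetaf * mellin p j B s *
             C_Iw p f g chif j s * L_padic p f chif zetaf j s * mellin p j r s)
    \<and> (\<forall>(j::int) (n::nat). [int n = j] (mod int (p - 1)) \<longrightarrow>
           C_Iw p f g chif j (of_nat n) = C_int f g chif n)"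
proof -
  interpret padic_ext p "TYPE('k)" by standard (rule K)
  define \<rho> where "\<rho> = (lambda_half_G p c :: 'k set \<Rightarrow> 'k)"
  define \<nu> where "\<nu> = nu_packet p N chiN zetaN"
  define \<nu>f where "\<nu>f = nu_packet p f chif zetaf"
  let ?r = "r_meas c :: 'k set \<Rightarrow> 'k" and ?G = "gauss_sum f chif zetaf"
  let ?L = "Lambda p :: ('k set \<Rightarrow> 'k) ring" and ?S = "Sigma_r p :: ('k set \<Rightarrow> 'k) set"
  have d: "dirichlet_char f chif" using chif(1) by (simp add: primitive_char_def)
  have N0: "N > 0" using zeta(1) by (simp add: primitive_root_of_unity_def)
  then have fg: "f > 0" "g > 0" using N(1) by auto
  have N1: "N > 1" unfolding N(1) using chif(3) fg(2) by (simp add: less_le_trans)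
  have copN: "coprime N p" using N(2) p(1) by (metis coprime_commute prime_imp_coprime)
  then have cop: "coprime f p" "coprime g p" unfolding N(1) by simp_all
  have zf: "primitive_root_of_unity f zetaf"
    unfolding zeta(2) by (rule primitive_root_power) (use zeta(1) N(1) in \<open>simp add: mult.commute\<close>)
  have \<rho>: "\<rho> \<in> bounded_measures GG" unfolding \<rho>_def by (rule lambda_half_G_bmeas[OF p(2) c(1,3)])
  have \<nu>: "\<nu> \<in> bounded_measures GG" unfolding \<nu>_def by (rule nu_packet_bmeas[OF zeta(1) copN N1])
  have \<nu>f: "\<nu>f \<in> bounded_measures GG" unfolding \<nu>f_def by (rule nu_packet_bmeas[OF zf cop(1) chif(3)])
  have \<nu>_eq: "\<nu> = nu_fg p f g chif zetaf"
    unfolding \<nu>_def zeta(2) by (rule nu_packet_imprimitive[OF zeta(1) N chif(3) d ind])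
  have r: "?r \<in> ?S" by (rule r_meas_Sigma[OF c])
  have one: "dirac GG 1 \<in> ?S" by (rule Sigma_r.one)
  have S: "?S \<subseteq> carrier ?L" "\<And>s t. s \<in> ?S \<Longrightarrow> t \<in> ?S \<Longrightarrow> s \<otimes>\<^bsub>?L\<^esub> t \<in> ?S"
    unfolding Lambda_simps using Sigma_r_bmeas Sigma_r_conv by auto
  have I: "I_packet p c N chiN zetaN = Lambda_frac p (conv p \<rho> \<nu>) ?r"
    unfolding I_packet_def \<rho>_def \<nu>_def ..
  have Z: "Z_half p c = Lambda_frac p \<rho> ?r" unfolding Z_half_def \<rho>_def ..
  have G: "?G \<noteq> 0" by (rule gauss_sum_nonzero[OF chif(1,3) zf])
  have M\<nu>: "mellin p j \<nu> s = ?G * C_Iw p f g chif j s * L_padic p f chif zetaf j s" if "s \<in> Zp" for j s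
    unfolding \<nu>_eq mellin_nu_fg[OF \<nu>f[unfolded \<nu>f_def] cop(2) fg(2) that] L_padic_def using G by simp
  have cross: "mellin p j A s * mellin p j t s = mellin p j B s * mellin p j \<nu> s * mellin p j v s"
    if "(A, v) \<in> I_packet p c N chiN zetaN" "(B, t) \<in> Z_half p c" "s \<in> Zp" for A v B t s j
    using mellin_frac_cross[OF \<rho> \<nu> r that[unfolded I Z]] .
  have unit: "mellin p j (dirac GG 1) s = 1" if "s \<in> Zp" for j s
    using that by (simp add: mellin_dirac mellin_kernel_1)
  have \<rho>1: "conv p \<rho> (dirac GG 1) = \<rho>"
    using conv_commute[OF \<rho> dirac_bmeas[OF periodic_Gp]] conv_one[OF \<rho>] by metis
  \<comment> \<open>The case \<open>\<nu> = 1\<close>: the value of a fraction does not depend on its representative.\<close>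
  have crossZ: "mellin p j A s * mellin p j t s = mellin p j B s * mellin p j v s"
    if "(A, v) \<in> Z_half p c" "(B, t) \<in> Z_half p c" "s \<in> Zp"
    for A v B t and s :: 'k and j
    using mellin_frac_cross[OF \<rho> dirac_bmeas[OF periodic_Gp, of 1] r, unfolded \<rho>1, OF that[unfolded Z], of j] unit[OF that(3), of j]
    by simp
  have "I_packet p c N chiN zetaN =
      Z_half p c \<otimes>\<^bsub>Lambda_loc p\<^esub> Lambda_frac p (nu_fg p f g chif zetaf) \<one>\<^bsub>Lambda p\<^esub>"
  proof -
    have "Z_half p c \<otimes>\<^bsub>Lambda_loc p\<^esub> Lambda_frac p \<nu> \<one>\<^bsub>?L\<^esub> = Lambda_frac p (\<rho> \<otimes>\<^bsub>?L\<^esub> \<nu>) (?r \<otimes>\<^bsub>?L\<^esub> \<one>\<^bsub>?L\<^esub>)"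
      unfolding Z by (rule localization_mult[OF Lambda_comm_monoid S]) (use \<rho> \<nu> r one in \<open>simp_all add: Lambda_simps\<close>)
    also have "?r \<otimes>\<^bsub>?L\<^esub> \<one>\<^bsub>?L\<^esub> = ?r"
      unfolding Lambda_simps using conv_commute[OF r_meas_bmeas dirac_bmeas[OF periodic_Gp]] conv_one[OF r_meas_bmeas] by metis
    finally show ?thesis unfolding I \<nu>_eq[symmetric] Lambda_simps by simp
  qed
  moreover have "mellin_regular p j (I_packet p c N chiN zetaN) s \<and>
      mellin_frac p j (I_packet p c N chiN zetaN) s =
        ?G * mellin_frac p j (Z_half p c) s * C_Iw p f g chif j s * L_padic p f chif zetaf j s"
    if s: "s \<in> Zp" and reg: "mellin_regular p j (Z_half p c) s" for j s
  proof -
    obtain B t where B: "(B, t) \<in> Z_half p c" "mellin p j t s \<noteq> 0" using reg unfolding mellin_regular_def by blast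
    have Bb: "B \<in> bounded_measures GG" using B(1) unfolding Z ring_frac_def Lambda_simps by blast
    have BI: "(conv p B \<nu>, t) \<in> I_packet p c N chiN zetaN"
      using ring_frac_mult_num[OF Lambda_comm_monoid S(1), of \<rho> \<nu> ?r B t] \<rho> \<nu> r B(1)
      unfolding I Z Lambda_simps by blast
    have MB: "mellin p j (conv p B \<nu>) s = mellin p j B s * mellin p j \<nu> s" by (rule mellin_conv[OF Bb \<nu> s])
    have "mellin_frac p j (I_packet p c N chiN zetaN) s = mellin p j (conv p B \<nu>) s / mellin p j t s"
      by (rule mellin_frac_eqI[OF BI B(2)]) (simp add: MB cross[OF _ B(1) s])
    moreover have "mellin_frac p j (Z_half p c) s = mellin p j B s / mellin p j t s"
      by (rule mellin_frac_eqI[OF B]) (rule crossZ[OF _ B(1) s])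
    moreover have "mellin_regular p j (I_packet p c N chiN zetaN) s"
      unfolding mellin_regular_def using BI B(2) by blast
    ultimately show ?thesis unfolding MB M\<nu>[OF s] by simp
  qed
  moreover have "mellin p j A s * mellin p j t s =
      ?G * mellin p j B s * C_Iw p f g chif j s * L_padic p f chif zetaf j s * mellin p j v s"
    if "(A, v) \<in> I_packet p c N chiN zetaN" "(B, t) \<in> Z_half p c" "s \<in> Zp" for A v B t s j
    using cross[OF that, of j] unfolding M\<nu>[OF that(3)] by (simp add: mult_ac)
  moreover have "C_Iw p f g chif j (of_nat n) = C_int f g chif n" if "[int n = j] (mod int (p - 1))" for j n
    by (rule C_Iw_of_nat[OF cop(2) that])
  ultimately show ?thesis by blast
qed

end
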